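(* Let $0<\alpha\le 2$, $q=\frac{2}{\alpha+2}$, and consider three equal masses $m>0$ in the plane. Let $\mathcal M=\{x\in\mathcal H_{\mathrm{eight}}: K(x)=1\}$, equipped with the $H^1$ distance, and $f=V^q:\mathcal M\to[0,+\infty]$. Then there exists $x_\ast\in\mathcal M$ such that $f(x_\ast)=\inf_{\mathcal M}f$. Moreover, there is a Palais–Smale type sequence $(x_n)\subset\mathcal M$, i.e. $f(x_n)\to\inf_{\mathcal M}f$ and $\|\nabla_{\mathcal M}f(x_n)\|\to 0$, which (after extraction of a subsequence) converges to $x_\ast$ in $H^1$ and uniformly.
   Context: $\mathbb T:=\mathbb R/(2\pi\mathbb Z)$. For $x=(x_0,x_1,x_2):\mathbb T\to(\mathbb R^2)^3$ set $K(x)=\frac12\int_0^{2\pi}\sum_i m|\dot x_i|^2\,dt$, $U(x)=\sum_{i<j}m^2|x_i-x_j|^{-\alpha}$, extended by $+\infty$ at collisions (points where $x_i=x_j$ for some $i\ne j$), and $V(x)=\int_0^{2\pi}U(x(t))\,dt\in[0,+\infty]$. The class $\mathcal H_{\mathrm{eight}}$ consists of the choreographies $x_i(t)=\gamma(t+2\pi i/3)$, $i=0,1,2$, generated by loops $\gamma=(\gamma^1,\gamma^2)\in H^1(\mathbb T;\mathbb R^2)$ with $\gamma(0)=(0,0)$ and, for all $t$: (A$_x$) $\gamma(t+\pi)=(\gamma^1(t),-\gamma^2(t))$; (Y$^\star$) $\gamma(\tfrac{\pi}{2}+t)=\big(-\gamma^1(\tfrac{\pi}{2}-t),\,\gamma^2(\tfrac{\pi}{2}-t)\big)$.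 $\mathcal H_{\mathrm{eight}}$ is a closed linear subspace of $H^1(\mathbb T;(\mathbb R^2)^3)$ and $\mathcal M$ is a $C^1$ submanifold of it. $V$ is $C^1$ on the open set of collision-free curves; $\nabla_{\mathcal M}f(x)$, defined at collision-free $x\in\mathcal M$, is the tangential gradient of $f$ along $\mathcal M$, i.e. the $H^1$-orthogonal projection of the gradient of $f$ onto $T_x\mathcal M$. *)

theory Defs
  imports "HOL-Analysis.Analysis"
begin

section \<open>The Hilbert space \<open>H\<^sup>1(\<real>/2\<pi>\<int>; 'a)\<close>\<close>

text \<open>
  Functions on the circle are \<open>2\<pi>\<close>-periodic functions on \<open>\<real>\<close>, and an \<open>H\<^sup>1\<close> class is represented by
  its continuous representative: \<open>g\<close> is an \<open>L\<^sup>2\<close> weak derivative of the periodic function \<open>x\<close> iff \<open>x\<close>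
  is the indefinite integral of \<open>g\<close>.  The condition on one period suffices, by periodicity of \<open>x\<close>; the
  values of \<open>g\<close> outside of the period are irrelevant.
\<close>

definition has_weak_derivative ::
    "(real \<Rightarrow> 'a::euclidean_space) \<Rightarrow> (real \<Rightarrow> 'a) \<Rightarrow> bool" where
  "has_weak_derivative x g \<longleftrightarrow>
     (\<forall>t. x (t + 2 * pi) = x t) \<and>
     g \<in> borel_measurable borel \<and>
     set_integrable lborel {0..2 * pi} (\<lambda>t. (norm (g t))\<^sup>2) \<and>
     (\<forall>t\<in>{0..2 * pi}. x t = x 0 + (LINT s:{0..t}|lborel. g s))"

lemma square_integrable_imp_integrable:
  fixes g :: "real \<Rightarrow> 'a::euclidean_space"
  assumes g: "g \<in> borel_measurable borel"
    and sq: "set_integrable lborel {0..2 * pi} (\<lambda>t. (norm (g t))\<^sup>2)"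
  shows "set_integrable lborel {0..2 * pi} g"
proof -
  have 1: "set_integrable lborel {0..2 * pi} (\<lambda>t. 1 + (norm (g t))\<^sup>2)"
    by (intro set_integral_add(1) sq borel_integrable_atLeastAtMost') simp
  have "norm (g t) \<le> norm (1 + (norm (g t))\<^sup>2)" for t
    using sum_power2_ge_zero[of "norm (g t) - 1" 0] self_le_power[of "norm (g t)" 2]
    by (cases "norm (g t) \<le> 1") (auto simp: add_nonneg_nonneg intro: order_trans)
  then show ?thesis
    by (intro set_integrable_bound[OF 1]) (use g in \<open>auto simp: set_borel_measurable_def\<close>)
qed

lemma has_weak_derivativeD:
  assumes "has_weak_derivative x g"
  shows "x (t + 2 * pi) = x t"
    and "g \<in> borel_measurable borel"
    and "set_integrable lborel {0..2 * pi} (\<lambda>t. (norm (g t))\<^sup>2)"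
    and "set_integrable lborel {0..2 * pi} g"
    and "t \<in> {0..2 * pi} \<Longrightarrow> x t = x 0 + (LINT s:{0..t}|lborel. g s)"
  using assms square_integrable_imp_integrable[of g]
  unfolding has_weak_derivative_def by blast+

lemma square_integrable_inner:
  fixes g h :: "real \<Rightarrow> 'a::euclidean_space"
  assumes g: "g \<in> borel_measurable borel" and h: "h \<in> borel_measurable borel"
    and sg: "set_integrable lborel {0..2 * pi} (\<lambda>t. (norm (g t))\<^sup>2)"
    and sh: "set_integrable lborel {0..2 * pi} (\<lambda>t. (norm (h t))\<^sup>2)"
  shows "set_integrable lborel {0..2 * pi} (\<lambda>t. inner (g t) (h t))"
proof -
  have 1: "set_integrable lborel {0..2 * pi} (\<lambda>t. (norm (g t))\<^sup>2 + (norm (h t))\<^sup>2)"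
    by (intro set_integral_add(1) sg sh)
  have "norm (inner (g t) (h t)) \<le> norm ((norm (g t))\<^sup>2 + (norm (h t))\<^sup>2)" for t
  proof -
    have "norm (inner (g t) (h t)) \<le> norm (g t) * norm (h t)"
      by (simp add: Cauchy_Schwarz_ineq2)
    also have "2 * (norm (g t) * norm (h t)) \<le> (norm (g t))\<^sup>2 + (norm (h t))\<^sup>2"
      using sum_squares_bound[of "norm (g t)" "norm (h t)"] by simp
    then have "norm (g t) * norm (h t) \<le> (norm (g t))\<^sup>2 + (norm (h t))\<^sup>2"
      using zero_le_mult_iff[of "norm (g t)" "norm (h t)"]
      by (smt (verit) norm_ge_zero)
    finally show ?thesis by simp
  qed
  then show ?thesis
    by (intro set_integrable_bound[OF 1]) (use g h in \<open>auto simp: set_borel_measurable_def\<close>)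
qed

lemma has_weak_derivative_add:
  assumes x: "has_weak_derivative x g" and y: "has_weak_derivative y h"
  shows "has_weak_derivative (\<lambda>t. x t + y t) (\<lambda>t. g t + h t)"
  unfolding has_weak_derivative_def
proof (intro conjI allI ballI)
  note dx = has_weak_derivativeD[OF x] and dy = has_weak_derivativeD[OF y]
  show "x (t + 2 * pi) + y (t + 2 * pi) = x t + y t" for t
    by (simp only: dx(1) dy(1))
  show "(\<lambda>t. g t + h t) \<in> borel_measurable borel"
    using dx(2) dy(2) by (rule borel_measurable_add)
  have "set_integrable lborel {0..2 * pi} (\<lambda>t. inner (g t) (g t) + inner (g t) (h t)
      + (inner (h t) (g t) + inner (h t) (h t)))"
    using dx(2,3) dy(2,3) by (intro set_integral_add(1) square_integrable_inner)
  then show "set_integrable lborel {0..2 * pi} (\<lambda>t. (norm (g t + h t))\<^sup>2)"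
    by (simp add: power2_norm_eq_inner inner_add_left inner_add_right ac_simps)
  show "x t + y t = x 0 + y 0 + (LINT s:{0..t}|lborel. g s + h s)" if t: "t \<in> {0..2 * pi}" for t
  proof -
    have "set_integrable lborel {0..t} g" "set_integrable lborel {0..t} h"
      using t by (auto intro: set_integrable_subset[OF dx(4)] set_integrable_subset[OF dy(4)])
    then have "(LINT s:{0..t}|lborel. g s + h s)
        = (LINT s:{0..t}|lborel. g s) + (LINT s:{0..t}|lborel. h s)"
      by (rule set_integral_add(2))
    then show ?thesis
      using dx(5)[OF t] dy(5)[OF t] by (metis (no_types, lifting) add.assoc add.left_commute)
  qed
qed

lemma has_weak_derivative_scaleR:
  assumes x: "has_weak_derivative x g"
  shows "has_weak_derivative (\<lambda>t. r *\<^sub>R x t) (\<lambda>t. r *\<^sub>R g t)"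
  unfolding has_weak_derivative_def
proof (intro conjI allI ballI)
  note dx = has_weak_derivativeD[OF x]
  show "r *\<^sub>R x (t + 2 * pi) = r *\<^sub>R x t" for t
    by (simp only: dx(1))
  show "(\<lambda>t. r *\<^sub>R g t) \<in> borel_measurable borel"
    using dx(2) by (intro borel_measurable_scaleR borel_measurable_const)
  have "set_integrable lborel {0..2 * pi} (\<lambda>t. r\<^sup>2 * (norm (g t))\<^sup>2)"
    using dx(3) by simp
  then show "set_integrable lborel {0..2 * pi} (\<lambda>t. (norm (r *\<^sub>R g t))\<^sup>2)"
    by (simp add: power_mult_distrib)
  show "r *\<^sub>R x t = r *\<^sub>R x 0 + (LINT s:{0..t}|lborel. r *\<^sub>R g s)" if "t \<in> {0..2 * pi}" for t
    by (subst dx(5)[OF that]) (simp only: set_integral_scaleR_right scaleR_add_right)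
qed

lemma has_weak_derivative_zero: "has_weak_derivative (\<lambda>t. 0) (\<lambda>t. 0)"
  by (auto simp: has_weak_derivative_def set_integrable_def set_lebesgue_integral_def)

lemma has_weak_derivative_continuous:
  assumes x: "has_weak_derivative x g"
  shows "continuous_on {0..2 * pi} x"
proof -
  note dx = has_weak_derivativeD[OF x]
  have "g integrable_on {0..2 * pi}"
    using set_borel_integral_eq_integral(1)[OF dx(4)] .
  then have c: "continuous_on {0..2 * pi} (\<lambda>t. x 0 + integral {0..t} g)"
    by (intro continuous_intros indefinite_integral_continuous_1)
  have "x t = x 0 + integral {0..t} g" if t: "t \<in> {0..2 * pi}" for t
  proof -
    have "set_integrable lborel {0..t} g"
      using t by (auto intro: set_integrable_subset[OF dx(4)])
    from set_borel_integral_eq_integral(2)[OF this] dx(5)[OF t] show ?thesis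
      by metis
  qed
  then show ?thesis
    using c continuous_on_cong[of "{0..2 * pi}" "{0..2 * pi}" x "\<lambda>t. x 0 + integral {0..t} g"]
    by blast
qed

lemma AE_zero_if_primitive_zero_real:
  fixes g :: "real \<Rightarrow> real"
  assumes g: "set_integrable lborel {0..2 * pi} g"
    and z: "\<And>t. t \<in> {0..2 * pi} \<Longrightarrow> (LINT s:{0..t}|lborel. g s) = 0"
  shows "AE t in lborel. t \<in> {0..2 * pi} \<longrightarrow> g t = 0"
proof -
  define h where "h = (\<lambda>t. indicator {0..2 * pi} t * g t)"
  have h: "integrable lborel h"
    using g by (simp add: h_def set_integrable_def)
  have hb: "h \<in> borel_measurable lborel" using h by auto
  let ?P = "density lborel (\<lambda>t. ennreal (h t))" and ?N = "density lborel (\<lambda>t. ennreal (- h t))"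
  have z': "(LINT s|lborel. indicator {t<..} s * h s) = 0" for t
  proof -
    have all: "(LINT s|lborel. h s) = 0"
      using z[of "2 * pi"] by (simp add: h_def set_lebesgue_integral_def)
    show ?thesis
    proof (cases "t < 0")
      case True
      then have "(\<lambda>s. indicator {t<..} s * h s) = h"
        by (auto simp: h_def indicator_def)
      then show ?thesis using all by simp
    next
      case False
      define u where "u = min t (2 * pi)"
      have u: "u \<in> {0..2 * pi}" using False by (auto simp: u_def)
      have "indicator {t<..} s * h s = h s - indicator {0..u} s *\<^sub>R g s" for s
        using False by (auto simp: h_def indicator_def u_def min_def)
      moreover have "integrable lborel (\<lambda>s. indicator {0..u} s *\<^sub>R g s)"
        using set_integrable_subset[OF g, of "{0..u}"] u by (simp add: set_integrable_def)
      ultimately have "(LINT s|lborel. indicator {t<..} s * h s)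
          = (LINT s|lborel. h s) - (LINT s:{0..u}|lborel. g s)"
        using h by (simp add: set_lebesgue_integral_def)
      then show ?thesis using all z[OF u] by simp
    qed
  qed
  have fin: "(\<integral>\<^sup>+s. ennreal (h s) \<partial>lborel) < \<infinity>" "(\<integral>\<^sup>+s. ennreal (- h s) \<partial>lborel) < \<infinity>"
    using integrableD(2,3)[OF h] by (auto simp: top.not_eq_extremum)
  have eq: "emeasure ?P {t<..} = emeasure ?N {t<..}" for t
  proof -
    define k where "k = (\<lambda>s. indicator {t<..} s * h s)"
    have k: "integrable lborel k"
      using integrable_mult_indicator[OF _ h, of "{t<..}"] by (simp add: k_def)
    have P: "emeasure ?P {t<..} = (\<integral>\<^sup>+s. ennreal (k s) \<partial>lborel)"
      using hb by (subst emeasure_density)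
        (auto simp: k_def indicator_def intro!: nn_integral_cong)
    have N: "emeasure ?N {t<..} = (\<integral>\<^sup>+s. ennreal (- k s) \<partial>lborel)"
      using hb by (subst emeasure_density)
        (auto simp: k_def indicator_def intro!: nn_integral_cong)
    have "enn2real (\<integral>\<^sup>+s. ennreal (k s) \<partial>lborel) = enn2real (\<integral>\<^sup>+s. ennreal (- k s) \<partial>lborel)"
      using real_lebesgue_integral_def[OF k] z'[of t] by (simp add: k_def)
    moreover have "(\<integral>\<^sup>+s. ennreal (k s) \<partial>lborel) \<noteq> \<infinity>" "(\<integral>\<^sup>+s. ennreal (- k s) \<partial>lborel) \<noteq> \<infinity>"
      using integrableD(2,3)[OF k] by auto
    ultimately show ?thesis
      unfolding P N by (metis ennreal_enn2real infinity_ennreal_def top.not_eq_extremum)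
  qed
  have "?P = ?N"
  proof (rule measure_eqI_lessThan)
    fix t
    have "emeasure ?P {t<..} \<le> emeasure ?P UNIV"
      by (rule emeasure_mono) auto
    also have "\<dots> = (\<integral>\<^sup>+s. ennreal (h s) \<partial>lborel)"
      using hb by (subst emeasure_density) auto
    finally show "emeasure ?P {t<..} < \<infinity>"
      using fin(1) by (rule le_less_trans)
  qed (auto simp: eq)
  moreover have "(\<integral>\<^sup>+s. ennreal (h s) \<partial>lborel) \<noteq> \<infinity>" using fin by auto
  ultimately have "AE s in lborel. ennreal (h s) = ennreal (- h s)"
    using hb by (intro finite_density_unique[THEN iffD1]) auto
  then show ?thesis
  proof (eventually_elim, intro impI)
    fix s assume eqs: "ennreal (h s) = ennreal (- h s)" and s: "s \<in> {0..2 * pi}"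
    from eqs have "h s = 0"
      by (metis ennreal_eq_0_iff ennreal_neg le_cases neg_0_le_iff_le neg_le_0_iff_le order_antisym)
    with s show "g s = 0" by (simp add: h_def)
  qed
qed

lemma AE_zero_if_primitive_zero:
  fixes g :: "real \<Rightarrow> 'a::euclidean_space"
  assumes g: "set_integrable lborel {0..2 * pi} g"
    and z: "\<And>t. t \<in> {0..2 * pi} \<Longrightarrow> (LINT s:{0..t}|lborel. g s) = 0"
  shows "AE t in lborel. t \<in> {0..2 * pi} \<longrightarrow> g t = 0"
proof -
  have "AE t in lborel. t \<in> {0..2 * pi} \<longrightarrow> inner (g t) b = 0" for b
  proof (rule AE_zero_if_primitive_zero_real)
    show "set_integrable lborel {0..2 * pi} (\<lambda>t. inner (g t) b)"
      using integrable_inner_left[of b lborel "\<lambda>t. indicator {0..2 * pi} t *\<^sub>R g t"] g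
      by (simp add: set_integrable_def)
  next
    fix t assume t: "t \<in> {0..2 * pi}"
    have "integrable lborel (\<lambda>s. indicator {0..t} s *\<^sub>R g s)"
      using set_integrable_subset[OF g, of "{0..t}"] t by (simp add: set_integrable_def)
    then have "(LINT s:{0..t}|lborel. inner (g s) b) = inner (LINT s:{0..t}|lborel. g s) b"
      using integral_inner_left[of b lborel "\<lambda>s. indicator {0..t} s *\<^sub>R g s"]
      by (simp add: set_lebesgue_integral_def)
    then show "(LINT s:{0..t}|lborel. inner (g s) b) = 0"
      using z[OF t] by simp
  qed
  then have "AE t in lborel. \<forall>b\<in>Basis. t \<in> {0..2 * pi} \<longrightarrow> inner (g t) b = 0"
    by (intro AE_finite_allI) auto
  then show ?thesis
    by eventually_elim (auto simp: euclidean_all_zero_iff)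
qed

lemma has_weak_derivative_unique:
  assumes x: "has_weak_derivative x g" and y: "has_weak_derivative x h"
  shows "AE t in lborel. t \<in> {0..2 * pi} \<longrightarrow> g t = h t"
proof -
  have d: "has_weak_derivative (\<lambda>t. 0) (\<lambda>t. g t + (-1) *\<^sub>R h t)"
    using has_weak_derivative_add[OF x has_weak_derivative_scaleR[OF y, of "-1"]] by simp
  have "AE t in lborel. t \<in> {0..2 * pi} \<longrightarrow> g t + (-1) *\<^sub>R h t = 0"
  proof (rule AE_zero_if_primitive_zero)
    show "set_integrable lborel {0..2 * pi} (\<lambda>t. g t + (-1) *\<^sub>R h t)"
      by (rule has_weak_derivativeD(4)[OF d])
    show "(LINT s:{0..t}|lborel. g s + (-1) *\<^sub>R h s) = 0" if "t \<in> {0..2 * pi}" for t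
      using has_weak_derivativeD(5)[OF d that] by simp
  qed
  then show ?thesis by eventually_elim auto
qed

typedef (overloaded) ('a::euclidean_space) h1loop =
    "{x :: real \<Rightarrow> 'a. \<exists>g. has_weak_derivative x g}"
  morphisms curve Abs_h1loop
  using has_weak_derivative_zero by blast

setup_lifting type_definition_h1loop

text \<open>The weak derivative is determined almost everywhere; any choice will do below an integral.\<close>

definition velocity :: "'a::euclidean_space h1loop \<Rightarrow> real \<Rightarrow> 'a" where
  "velocity x = (SOME g. has_weak_derivative (curve x) g)"

lemma has_weak_derivative_velocity: "has_weak_derivative (curve x) (velocity x)"
proof -
  have "\<exists>g. has_weak_derivative (curve x) g" using curve[of x] by simp
  then show ?thesis unfolding velocity_def by (rule someI_ex)
qed

instantiation h1loop :: (euclidean_space) real_vector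
begin

lift_definition zero_h1loop :: "'a h1loop" is "\<lambda>t. 0"
  using has_weak_derivative_zero by blast

lift_definition plus_h1loop :: "'a h1loop \<Rightarrow> 'a h1loop \<Rightarrow> 'a h1loop" is "\<lambda>x y t. x t + y t"
  using has_weak_derivative_add by blast

lift_definition scaleR_h1loop :: "real \<Rightarrow> 'a h1loop \<Rightarrow> 'a h1loop" is "\<lambda>r x t. r *\<^sub>R x t"
  using has_weak_derivative_scaleR by blast

definition uminus_h1loop :: "'a h1loop \<Rightarrow> 'a h1loop" where
  "uminus_h1loop x = (-1) *\<^sub>R x"

definition minus_h1loop :: "'a h1loop \<Rightarrow> 'a h1loop \<Rightarrow> 'a h1loop" where
  "minus_h1loop x y = x + (-1) *\<^sub>R y"

instance
proof
  fix x y z :: "'a h1loop" and a b :: real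
  note [simp] = curve_inject[symmetric] fun_eq_iff plus_h1loop.rep_eq zero_h1loop.rep_eq
    scaleR_h1loop.rep_eq uminus_h1loop_def minus_h1loop_def
  show "x + y + z = x + (y + z)" by (simp add: add.assoc)
  show "x + y = y + x" by (simp add: add.commute)
  show "0 + x = x" by simp
  show "- x + x = 0" by simp
  show "x - y = x + - y" by simp
  show "a *\<^sub>R (x + y) = a *\<^sub>R x + a *\<^sub>R y" by (simp add: scaleR_add_right)
  show "(a + b) *\<^sub>R x = a *\<^sub>R x + b *\<^sub>R x" by (simp add: scaleR_add_left)
  show "a *\<^sub>R b *\<^sub>R x = (a * b) *\<^sub>R x" by simp
  show "1 *\<^sub>R x = x" by simp
qed

end

lemma velocity_add:
  "AE t in lborel. t \<in> {0..2 * pi} \<longrightarrow> velocity (x + y) t = velocity x t + velocity y t"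
proof (rule has_weak_derivative_unique)
  show "has_weak_derivative (curve (x + y)) (\<lambda>t. velocity x t + velocity y t)"
    unfolding plus_h1loop.rep_eq
    by (intro has_weak_derivative_add has_weak_derivative_velocity)
qed (rule has_weak_derivative_velocity)

lemma velocity_scaleR:
  "AE t in lborel. t \<in> {0..2 * pi} \<longrightarrow> velocity (r *\<^sub>R x) t = r *\<^sub>R velocity x t"
proof (rule has_weak_derivative_unique)
  show "has_weak_derivative (curve (r *\<^sub>R x)) (\<lambda>t. r *\<^sub>R velocity x t)"
    unfolding scaleR_h1loop.rep_eq
    by (intro has_weak_derivative_scaleR has_weak_derivative_velocity)
qed (rule has_weak_derivative_velocity)

lemma continuous_on_curve: "continuous_on {0..2 * pi} (curve x)"
  by (rule has_weak_derivative_continuous[OF has_weak_derivative_velocity])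

lemma curve_periodic: "curve x (t + 2 * pi) = curve x t"
  by (rule has_weak_derivativeD(1)[OF has_weak_derivative_velocity])

lemma curve_reduce:
  obtains s where "s \<in> {0..2 * pi}" "curve x t = curve x s"
proof -
  have n: "curve x (t + 2 * pi * real n) = curve x t" for t n
  proof (induction n)
    case (Suc n)
    have "t + 2 * pi * real (Suc n) = (t + 2 * pi * real n) + 2 * pi"
      by (simp add: algebra_simps)
    then show ?case using Suc by (simp only: curve_periodic)
  qed simp
  define k where "k = \<lfloor>t / (2 * pi)\<rfloor>"
  define s where "s = t - 2 * pi * of_int k"
  have "of_int k \<le> t / (2 * pi)" "t / (2 * pi) < of_int k + 1"
    unfolding k_def by linarith+
  then have "s \<in> {0..2 * pi}"
    by (simp add: s_def field_simps)
  moreover have "curve x t = curve x s"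
  proof (cases "0 \<le> k")
    case True
    then show ?thesis using n[of s "nat k"] by (simp add: s_def)
  next
    case False
    then show ?thesis using n[of t "nat (- k)"] by (simp add: s_def)
  qed
  ultimately show thesis by (rule that)
qed

lemma integrable_curve_inner:
  "set_integrable lborel {0..2 * pi} (\<lambda>t. inner (curve x t) (curve y t))"
  by (rule borel_integrable_atLeastAtMost')
    (intro continuous_on_inner continuous_on_curve)

lemma integrable_velocity_inner:
  "set_integrable lborel {0..2 * pi} (\<lambda>t. inner (velocity x t) (velocity y t))"
  by (rule square_integrable_inner;
      rule has_weak_derivativeD(2)[OF has_weak_derivative_velocity]
        has_weak_derivativeD(3)[OF has_weak_derivative_velocity])

lemma integrable_h1_inner:
  "set_integrable lborel {0..2 * pi}
     (\<lambda>t. inner (curve x t) (curve y t) + inner (velocity x t) (velocity y t))"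
  by (rule set_integral_add(1)[OF integrable_curve_inner integrable_velocity_inner])

instantiation h1loop :: (euclidean_space) real_inner
begin

definition inner_h1loop :: "'a h1loop \<Rightarrow> 'a h1loop \<Rightarrow> real" where
  "inner_h1loop x y = (LINT t:{0..2 * pi}|lborel.
     inner (curve x t) (curve y t) + inner (velocity x t) (velocity y t))"

definition norm_h1loop :: "'a h1loop \<Rightarrow> real" where
  "norm_h1loop x = sqrt (inner x x)"

definition sgn_h1loop :: "'a h1loop \<Rightarrow> 'a h1loop" where
  "sgn_h1loop x = x /\<^sub>R norm x"

definition dist_h1loop :: "'a h1loop \<Rightarrow> 'a h1loop \<Rightarrow> real" where
  "dist_h1loop x y = norm (x - y)"

definition uniformity_h1loop :: "('a h1loop \<times> 'a h1loop) filter" where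
  "uniformity_h1loop = (INF e\<in>{0 <..}. principal {(x, y). dist x y < e})"

definition open_h1loop :: "'a h1loop set \<Rightarrow> bool" where
  "open_h1loop S \<longleftrightarrow> (\<forall>x\<in>S. \<forall>\<^sub>F (x', y) in uniformity. x' = x \<longrightarrow> y \<in> S)"

instance
proof
  fix x y z :: "'a h1loop" and r :: real
  show "dist x y = norm (x - y)" by (rule dist_h1loop_def)
  show "sgn x = x /\<^sub>R norm x" by (rule sgn_h1loop_def)
  show "uniformity = (INF e\<in>{0 <..}. principal {(x, y :: 'a h1loop). dist x y < e})"
    by (rule uniformity_h1loop_def)
  show "open U \<longleftrightarrow> (\<forall>x\<in>U. \<forall>\<^sub>F (x', y) in uniformity. x' = x \<longrightarrow> y \<in> U)" for U :: "'a h1loop set"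
    by (rule open_h1loop_def)
  show "inner x y = inner y x"
    by (simp add: inner_h1loop_def inner_commute)
  show "norm x = sqrt (inner x x)" by (rule norm_h1loop_def)
  show "inner (x + y) z = inner x z + inner y z"
  proof -
    let ?I = "\<lambda>x y t. inner (curve x t) (curve y t) + inner (velocity x t) (velocity y t)"
    have "inner x z + inner y z = (LINT t:{0..2 * pi}|lborel. ?I x z t + ?I y z t)"
      unfolding inner_h1loop_def
      by (rule set_integral_add(2)[OF integrable_h1_inner integrable_h1_inner, symmetric])
    also have "\<dots> = inner (x + y) z"
      unfolding inner_h1loop_def set_lebesgue_integral_def
    proof (rule integral_cong_AE)
      show "AE t in lborel. indicator {0..2 * pi} t *\<^sub>R (?I x z t + ?I y z t)
          = indicator {0..2 * pi} t *\<^sub>R ?I (x + y) z t"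
        using velocity_add[of x y] by eventually_elim
          (auto simp: indicator_def plus_h1loop.rep_eq inner_add_left)
    qed (rule borel_measurable_integrable[OF set_integral_add(1)[OF integrable_h1_inner
          integrable_h1_inner, unfolded set_integrable_def]]
        borel_measurable_integrable[OF integrable_h1_inner[unfolded set_integrable_def]])+
    finally show ?thesis by simp
  qed
  show scale: "inner (r *\<^sub>R x) y = r * inner x y" for r and x y :: "'a h1loop"
  proof -
    let ?I = "\<lambda>x y t. inner (curve x t) (curve y t) + inner (velocity x t) (velocity y t)"
    have "r * inner x y = (LINT t:{0..2 * pi}|lborel. r * ?I x y t)"
      unfolding inner_h1loop_def by (rule set_integral_mult_right[symmetric])
    also have "\<dots> = inner (r *\<^sub>R x) y"
      unfolding inner_h1loop_def set_lebesgue_integral_def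
    proof (rule integral_cong_AE)
      show "AE t in lborel. indicator {0..2 * pi} t *\<^sub>R (r * ?I x y t)
          = indicator {0..2 * pi} t *\<^sub>R ?I (r *\<^sub>R x) y t"
        using velocity_scaleR[of r x] by eventually_elim
          (auto simp: indicator_def scaleR_h1loop.rep_eq distrib_left)
    qed (rule borel_measurable_integrable[OF
          set_integrable_mult_right[OF integrable_h1_inner, unfolded set_integrable_def]]
        borel_measurable_integrable[OF integrable_h1_inner[unfolded set_integrable_def]])+
    finally show ?thesis by simp
  qed
  have nn: "0 \<le> (LINT t:{0..2 * pi}|lborel. inner (u t) (u t))" for u :: "real \<Rightarrow> 'a"
    unfolding set_lebesgue_integral_def
    by (intro integral_nonneg_AE AE_I2) (auto simp: indicator_def)
  have split: "inner x x = (LINT t:{0..2 * pi}|lborel. inner (curve x t) (curve x t))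
      + (LINT t:{0..2 * pi}|lborel. inner (velocity x t) (velocity x t))"
    unfolding inner_h1loop_def
    by (rule set_integral_add(2)[OF integrable_curve_inner integrable_velocity_inner])
  show "0 \<le> inner x x"
    unfolding split by (intro add_nonneg_nonneg nn)
  show "inner x x = 0 \<longleftrightarrow> x = 0"
  proof
    assume "x = 0"
    then show "inner x x = 0" using scale[of 0 x x] by simp
  next
    assume 0: "inner x x = 0"
    have "(LINT t:{0..2 * pi}|lborel. inner (curve x t) (curve x t)) = 0"
      using 0 nn[of "curve x"] nn[of "velocity x"] unfolding split by linarith
    then have "integral {0..2 * pi} (\<lambda>t. inner (curve x t) (curve x t)) = 0"
      using set_borel_integral_eq_integral(2)[OF integrable_curve_inner[of x x]] by simp
    moreover have "continuous_on {0..2 * pi} (\<lambda>t. inner (curve x t) (curve x t))"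
      by (intro continuous_on_inner continuous_on_curve)
    ultimately have c: "\<forall>t\<in>{0..2 * pi}. inner (curve x t) (curve x t) = 0"
      by (subst (asm) integral_eq_0_iff) auto
    have "curve x t = 0" for t
    proof -
      obtain s where "s \<in> {0..2 * pi}" "curve x t = curve x s"
        by (rule curve_reduce)
      then show ?thesis using c by auto
    qed
    then show "x = 0"
      by (metis curve_inject ext zero_h1loop.rep_eq)
  qed
qed

end

section \<open>Tangential gradients on subsets of an inner product space\<close>

definition tangent_space :: "'a::real_normed_vector set \<Rightarrow> 'a \<Rightarrow> 'a set" where
  "tangent_space M x =
     {v. \<exists>c :: real \<Rightarrow> 'a. c 0 = x \<and> (\<forall>s. c s \<in> M) \<and> (c has_vector_derivative v) (at 0)}"

text \<open>
  \<open>g\<close> is the orthogonal projection of the gradient \<open>D\<close> of \<open>f\<close> at \<open>x\<close> onto the tangent space of \<open>M\<close>.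
\<close>

definition has_tangential_gradient ::
    "('a::real_inner \<Rightarrow> real) \<Rightarrow> 'a set \<Rightarrow> 'a \<Rightarrow> 'a \<Rightarrow> bool" where
  "has_tangential_gradient f M x g \<longleftrightarrow>
     (\<exists>D. (GDERIV f x :> D) \<and> g \<in> tangent_space M x \<and>
          (\<forall>v\<in>tangent_space M x. orthogonal (D - g) v))"

section \<open>Three equal masses in the plane\<close>

text \<open>
  A configuration is a vector in \<open>(\<real>\<^sup>2)\<^sup>3\<close>; the bodies are indexed by \<open>0, 1, 2 :: 3\<close>.
\<close>

type_synonym configuration = "real ^ 2 ^ 3"

definition kinetic :: "real \<Rightarrow> configuration h1loop \<Rightarrow> real" where
  "kinetic m x = 1 / 2 * (LINT t:{0..2 * pi}|lborel. (\<Sum>i\<in>UNIV. m * (norm (velocity x t $ i))\<^sup>2))"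

definition collision :: "configuration \<Rightarrow> bool" where
  "collision z \<longleftrightarrow> (\<exists>i j. i \<noteq> j \<and> z $ i = z $ j)"

definition collision_free :: "configuration h1loop \<Rightarrow> bool" where
  "collision_free x \<longleftrightarrow> (\<forall>t. \<not> collision (curve x t))"

definition potential :: "real \<Rightarrow> real \<Rightarrow> configuration \<Rightarrow> ennreal" where
  "potential \<alpha> m z =
     (if collision z then \<infinity>
      else ennreal (\<Sum>j<3::nat. \<Sum>i<j. m\<^sup>2 * norm (z $ of_nat i - z $ of_nat j) powr (- \<alpha>)))"

definition potential_integral :: "real \<Rightarrow> real \<Rightarrow> configuration h1loop \<Rightarrow> ennreal" where
  "potential_integral \<alpha> m x = (\<integral>\<^sup>+t\<in>{0..2 * pi}. potential \<alpha> m (curve x t) \<partial>lborel)"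

text \<open>For \<open>q > 0\<close>: the real power, extended by \<open>\<infinity>\<^sup>q = \<infinity>\<close>.\<close>

definition ennreal_powr :: "ennreal \<Rightarrow> real \<Rightarrow> ennreal" where
  "ennreal_powr a q = (if a = \<infinity> then \<infinity> else ennreal (enn2real a powr q))"

definition eight_generator :: "(real ^ 2) h1loop \<Rightarrow> bool" where
  "eight_generator \<gamma> \<longleftrightarrow>
     curve \<gamma> 0 = 0 \<and>
     (\<forall>t. curve \<gamma> (t + pi) = vector [curve \<gamma> t $ 1, - (curve \<gamma> t $ 2)]) \<and>
     (\<forall>t. curve \<gamma> (pi / 2 + t) = vector [- (curve \<gamma> (pi / 2 - t) $ 1), curve \<gamma> (pi / 2 - t) $ 2])"

definition H_eight :: "configuration h1loop set" where
  "H_eight = {x. \<exists>\<gamma>. eight_generator \<gamma> \<and>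
     (\<forall>i<3::nat. \<forall>t. curve x t $ of_nat i = curve \<gamma> (t + 2 * pi * real i / 3))}"

definition M_eight :: "real \<Rightarrow> configuration h1loop set" where
  "M_eight m = {x \<in> H_eight. kinetic m x = 1}"

end

theory Submission
  imports Defs "HOL-Complex_Analysis.Great_Picard"
begin

text \<open>
  A minimizer of the potential on \<open>M_eight\<close> exists by the direct method: a weak limit of a minimizing
  sequence has no more kinetic energy and, by Fatou, no more potential, and scaling it up to the
  right kinetic energy only lowers the potential.  It has no collisions by a level estimate.  A
  collision makes each mutual position vanish after every time \<open>\<pi>\<close>, so its action is at least that of
  a radial Kepler-like motion between two collisions; this is compared with the explicit eight
  \<open>(A sin 2t, B sin t)\<close>, \<open>B\<^sup>2 = 16 A\<^sup>2\<close>, which lies below that level for all exponents \<open>\<alpha> \<le> 2\<close>.  Since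
  the potential is differentiable at a collision-free minimizer, the minimizer is a critical point,
  and the constant sequence is a Palais--Smale sequence.
\<close>

section \<open>Loops of class \<open>H\<^sup>1\<close>\<close>

text \<open>A gradient exists only at a collision-free curve, so everything hinges on excluding
  collisions, and this for all exponents \<alpha> = 2 \<beta> \<le> 2 at once. The radial collision
  orbit has an elementary parametrization for the exponents 2/n, with radius sin^n. Therefore
  \<open>n\<close> is taken with 1/n \<le> \<beta> \<le> 1/(n - 1), or as 2 if \<beta> \<ge> 1/2,
  and Bernoulli's inequality carries the bound from the exponent 2/n to 2 \<beta>. The logarithmic
  derivative of the orbit solves a Riccati equation and so acts as a calibration: it bounds from
  below the action of every loop with the same collision times. It is singular at the collisions,
  hence the cuts at distance \<open>e\<close> and the limit. The resulting bound is affine in the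
  energy of a pair, so that only the sum of the three energies matters, which the kinetic constraint
  controls. For the test loop the integral of Q^(-\<beta>) is interpolated between the means of ln
  Q, 1/Q and Q; this leaves one numerical inequality that has to hold for all
  \<open>n\<close>.\<close>

lemma set_integral_Icc_combine:
  fixes f :: "real \<Rightarrow> 'a::euclidean_space"
  assumes f: "set_integrable lborel {a..c} f" and ab: "a \<le> b" "b \<le> c"
  shows "(LINT t:{a..c}|lborel. f t) = (LINT t:{a..b}|lborel. f t) + (LINT t:{b..c}|lborel. f t)"
proof -
  have "set_integrable lborel {a..b} f" "set_integrable lborel {b..c} f"
    using ab by (auto intro: set_integrable_subset[OF f])
  moreover have "integral {a..c} f = integral {a..b} f + integral {b..c} f"
    using ab set_borel_integral_eq_integral(1)[OF f]
    by (simp add: Henstock_Kurzweil_Integration.integral_combine)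
  ultimately show ?thesis
    using set_borel_integral_eq_integral(2) f by metis
qed

lemma weak_derivative_diff:
  assumes x: "has_weak_derivative x g" and ab: "0 \<le> a" "a \<le> b" "b \<le> 2 * pi"
  shows "x b - x a = (LINT s:{a..b}|lborel. g s)"
proof -
  have "set_integrable lborel {0..b} g"
    using ab by (auto intro: set_integrable_subset[OF has_weak_derivativeD(4)[OF x]])
  from set_integral_Icc_combine[OF this ab(1,2)] show ?thesis
    using has_weak_derivativeD(5)[OF x, of a] has_weak_derivativeD(5)[OF x, of b] ab by simp
qed

text \<open>This is Cauchy-Schwarz. It follows by integrating 2 c |g| \<le> |g|^2 + c^2 for the mean
  \<open>c\<close> of |g|, the best possible constant.\<close>

lemma set_integral_norm_square_le:
  fixes g :: "real \<Rightarrow> 'a::euclidean_space"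
  assumes ab: "a \<le> b" and g: "set_integrable lborel {a..b} g"
    and sq: "set_integrable lborel {a..b} (\<lambda>t. (norm (g t))\<^sup>2)"
  shows "(norm (LINT t:{a..b}|lborel. g t))\<^sup>2 \<le> (b - a) * (LINT t:{a..b}|lborel. (norm (g t))\<^sup>2)"
proof (cases "a = b")
  case True
  then have "(LINT t:{a..b}|lborel. g t) = 0"
    using set_borel_integral_eq_integral(2)[OF g] by simp
  then show ?thesis using True by simp
next
  case False
  define I where "I = (LINT t:{a..b}|lborel. norm (g t))"
  define J where "J = (LINT t:{a..b}|lborel. (norm (g t))\<^sup>2)"
  define c where "c = I / (b - a)"
  have n: "set_integrable lborel {a..b} (\<lambda>t. norm (g t))"
    using g by (rule set_integrable_norm)
  have k: "set_integrable lborel {a..b} (\<lambda>t. c\<^sup>2)"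
    by (rule borel_integrable_atLeastAtMost') simp
  have "(LINT t:{a..b}|lborel. 2 * c * norm (g t)) \<le> (LINT t:{a..b}|lborel. (norm (g t))\<^sup>2 + c\<^sup>2)"
  proof (rule set_integral_mono)
    show "set_integrable lborel {a..b} (\<lambda>t. 2 * c * norm (g t))"
      using n by simp
    show "set_integrable lborel {a..b} (\<lambda>t. (norm (g t))\<^sup>2 + c\<^sup>2)"
      using sq k by (rule set_integral_add)
    show "2 * c * norm (g t) \<le> (norm (g t))\<^sup>2 + c\<^sup>2" for t
      using sum_squares_bound[of c "norm (g t)"] by (simp add: ac_simps)
  qed
  moreover have "(LINT t:{a..b}|lborel. (norm (g t))\<^sup>2 + c\<^sup>2) = J + c\<^sup>2 * (b - a)"
    using ab by (subst set_integral_add(2)[OF sq k]) (simp add: J_def set_integral_const)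
  ultimately have "2 * c * I \<le> J + c\<^sup>2 * (b - a)"
    by (simp add: I_def)
  moreover have "2 * c * I = 2 * (I\<^sup>2 / (b - a))" "c\<^sup>2 * (b - a) = I\<^sup>2 / (b - a)"
    using False by (auto simp: c_def power2_eq_square)
  ultimately have "I\<^sup>2 / (b - a) \<le> J"
    by linarith
  then have "I\<^sup>2 \<le> (b - a) * J"
    using False ab by (simp add: pos_divide_le_eq mult.commute)
  moreover have "norm (LINT t:{a..b}|lborel. g t) \<le> I"
    unfolding I_def by (rule set_integral_norm_bound[OF g])
  ultimately show ?thesis
    unfolding J_def by (meson norm_ge_zero order_trans power_mono)
qed

lemma weak_derivative_holder:
  assumes x: "has_weak_derivative x g" and ab: "0 \<le> a" "a \<le> b" "b \<le> 2 * pi"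
  shows "(norm (x b - x a))\<^sup>2 \<le> (b - a) * (LINT t:{a..b}|lborel. (norm (g t))\<^sup>2)"
  unfolding weak_derivative_diff[OF assms] using ab
  by (intro set_integral_norm_square_le)
    (auto intro: set_integrable_subset[OF has_weak_derivativeD(4)[OF x]]
      set_integrable_subset[OF has_weak_derivativeD(3)[OF x]])

definition energy :: "'a::euclidean_space h1loop \<Rightarrow> real" where
  "energy x = (LINT t:{0..2 * pi}|lborel. (norm (velocity x t))\<^sup>2)"

lemmas velocityD = has_weak_derivativeD[OF has_weak_derivative_velocity]

lemma set_integral_cong_AE_lborel:
  fixes f g :: "real \<Rightarrow> 'a::{banach, second_countable_topology}"
  assumes "set_integrable lborel A f" "set_integrable lborel A g"
    and "AE t in lborel. t \<in> A \<longrightarrow> f t = g t"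
  shows "(LINT t:A|lborel. f t) = (LINT t:A|lborel. g t)"
  unfolding set_lebesgue_integral_def
proof (rule integral_cong_AE)
  show "AE t in lborel. indicat_real A t *\<^sub>R f t = indicat_real A t *\<^sub>R g t"
    using assms(3) by eventually_elim (auto simp: indicator_def)
qed (use assms(1,2) in \<open>auto simp: set_integrable_def\<close>)

text \<open>\<open>velocity\<close> is an arbitrary choice of a weak derivative; uniqueness almost
  everywhere lets any other one compute the energy.\<close>

lemma energy_eq:
  assumes "has_weak_derivative (curve x) g"
  shows "energy x = (LINT t:{0..2 * pi}|lborel. (norm (g t))\<^sup>2)"
  unfolding energy_def
proof (rule set_integral_cong_AE_lborel)
  show "AE t in lborel. t \<in> {0..2 * pi} \<longrightarrow> (norm (velocity x t))\<^sup>2 = (norm (g t))\<^sup>2"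
    using has_weak_derivative_unique[OF has_weak_derivative_velocity assms]
    by eventually_elim auto
qed (use velocityD(3) has_weak_derivativeD(3)[OF assms] in auto)

lemma set_integral_nonneg_real:
  fixes f :: "real \<Rightarrow> real"
  assumes "\<And>t. t \<in> A \<Longrightarrow> 0 \<le> f t"
  shows "0 \<le> (LINT t:A|lborel. f t)"
  unfolding set_lebesgue_integral_def
  by (rule integral_nonneg_AE) (use assms in \<open>auto simp: indicator_def\<close>)

lemma set_integral_subset_mono:
  fixes f :: "real \<Rightarrow> real"
  assumes f: "set_integrable lborel B f" and A: "A \<in> sets borel" "A \<subseteq> B"
    and nn: "\<And>t. t \<in> B \<Longrightarrow> 0 \<le> f t"
  shows "(LINT t:A|lborel. f t) \<le> (LINT t:B|lborel. f t)"
  unfolding set_lebesgue_integral_def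
proof (rule integral_mono)
  show "integrable lborel (\<lambda>t. indicator A t *\<^sub>R f t)"
    using set_integrable_subset[OF f, of A] A by (simp add: set_integrable_def)
qed (use A nn f in \<open>auto simp: indicator_def set_integrable_def\<close>)

lemma energy_nonneg: "0 \<le> energy x"
  unfolding energy_def by (rule set_integral_nonneg_real) simp

lemma norm_h1loop_square:
  "(norm x)\<^sup>2 = (LINT t:{0..2 * pi}|lborel. (norm (curve x t))\<^sup>2) + energy x"
proof -
  have "(norm x)\<^sup>2 = inner x x"
    by (simp add: power2_norm_eq_inner)
  also have "\<dots> = (LINT t:{0..2 * pi}|lborel. inner (curve x t) (curve x t))
      + (LINT t:{0..2 * pi}|lborel. inner (velocity x t) (velocity x t))"
    unfolding inner_h1loop_def
    by (rule set_integral_add(2)[OF integrable_curve_inner integrable_velocity_inner])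
  finally show ?thesis
    by (simp add: energy_def power2_norm_eq_inner)
qed

lemma energy_scaleR: "energy (r *\<^sub>R x) = r\<^sup>2 * energy x"
proof -
  have "has_weak_derivative (curve (r *\<^sub>R x)) (\<lambda>t. r *\<^sub>R velocity x t)"
    unfolding scaleR_h1loop.rep_eq by (intro has_weak_derivative_scaleR has_weak_derivative_velocity)
  then show ?thesis
    by (simp add: energy_eq power_mult_distrib) (simp add: energy_def)
qed

lemma curve_holder:
  assumes "0 \<le> a" "a \<le> b" "b \<le> 2 * pi"
  shows "(norm (curve x b - curve x a))\<^sup>2 \<le> (b - a) * energy x"
proof -
  have "(LINT t:{a..b}|lborel. (norm (velocity x t))\<^sup>2) \<le> energy x"
    unfolding energy_def using assms velocityD(3)[of x]
    by (intro set_integral_subset_mono) auto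
  then show ?thesis
    using weak_derivative_holder[OF has_weak_derivative_velocity assms, of x] assms
    by (meson diff_ge_0_iff_ge mult_left_mono order_trans)
qed

text \<open>Sobolev embedding with an explicit constant. The Hoelder estimate compares the value at
  \<open>s\<close> with the value at every other time \<open>r\<close>; averaging over
  \<open>r\<close> leaves the mean square of the curve and the energy.\<close>

lemma curve_le_norm: "norm (curve x t) \<le> 4 * norm x"
proof -
  obtain s where s: "s \<in> {0..2 * pi}" "curve x t = curve x s" by (rule curve_reduce)
  have le: "(norm (curve x s))\<^sup>2 \<le> 2 * (norm (curve x r))\<^sup>2 + 4 * pi * energy x"
    if r: "r \<in> {0..2 * pi}" for r
  proof -
    have "(norm (curve x s - curve x r))\<^sup>2 \<le> 2 * pi * energy x"
    proof (cases "r \<le> s")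
      case True
      have "(s - r) * energy x \<le> 2 * pi * energy x"
        using s r energy_nonneg[of x] by (intro mult_right_mono) auto
      then show ?thesis using curve_holder[of r s x] True s r by auto
    next
      case False
      have "(r - s) * energy x \<le> 2 * pi * energy x"
        using s r energy_nonneg[of x] by (intro mult_right_mono) auto
      then show ?thesis using curve_holder[of s r x] False s r by (auto simp: norm_minus_commute)
    qed
    moreover have "(norm (curve x s))\<^sup>2 \<le> 2 * (norm (curve x r))\<^sup>2 + 2 * (norm (curve x s - curve x r))\<^sup>2"
    proof -
      have "norm (curve x s) \<le> norm (curve x r) + norm (curve x s - curve x r)"
        by (metis add.commute diff_add_cancel norm_triangle_ineq)
      then have "(norm (curve x s))\<^sup>2 \<le> (norm (curve x r) + norm (curve x s - curve x r))\<^sup>2"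
        by (intro power_mono) auto
      also have "\<dots> \<le> 2 * (norm (curve x r))\<^sup>2 + 2 * (norm (curve x s - curve x r))\<^sup>2"
        using sum_squares_bound[of "norm (curve x r)" "norm (curve x s - curve x r)"]
        by (simp add: power2_sum)
      finally show ?thesis .
    qed
    ultimately show ?thesis by linarith
  qed
  have i: "set_integrable lborel {0..2 * pi} (\<lambda>r. (norm (curve x r))\<^sup>2)"
    using integrable_curve_inner[of x x] by (simp add: power2_norm_eq_inner)
  have k: "set_integrable lborel {0..2 * pi} (\<lambda>r. c)" for c :: real
    by (rule borel_integrable_atLeastAtMost') simp
  have "(LINT r:{0..2 * pi}|lborel. (norm (curve x s))\<^sup>2)
      \<le> (LINT r:{0..2 * pi}|lborel. 2 * (norm (curve x r))\<^sup>2 + 4 * pi * energy x)"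
    using le by (intro set_integral_mono k set_integral_add(1)) (use i in simp_all)
  also have "\<dots> = 2 * (LINT r:{0..2 * pi}|lborel. (norm (curve x r))\<^sup>2) + 8 * pi\<^sup>2 * energy x"
    by (subst set_integral_add(2)) (use i k in \<open>simp_all add: set_integral_const power2_eq_square\<close>)
  finally have "2 * pi * (norm (curve x s))\<^sup>2
      \<le> 2 * (LINT r:{0..2 * pi}|lborel. (norm (curve x r))\<^sup>2) + 8 * pi\<^sup>2 * energy x"
    by (simp add: set_integral_const)
  also have "\<dots> \<le> 8 * pi\<^sup>2 * (norm x)\<^sup>2 "
  proof -
    have "1 \<le> pi" using pi_gt3 by simp
    then have "1 \<le> pi\<^sup>2" by (rule one_le_power)
    then have "2 * (LINT r:{0..2 * pi}|lborel. (norm (curve x r))\<^sup>2)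
        \<le> 8 * pi\<^sup>2 * (LINT r:{0..2 * pi}|lborel. (norm (curve x r))\<^sup>2)"
      by (intro mult_right_mono set_integral_nonneg_real) auto
    then show ?thesis
      unfolding norm_h1loop_square distrib_left by (rule add_right_mono)
  qed
  also have "\<dots> = 2 * pi * (4 * pi * (norm x)\<^sup>2)"
    by (simp add: power2_eq_square)
  finally have "(norm (curve x s))\<^sup>2 \<le> 4 * pi * (norm x)\<^sup>2" 
    by (subst (asm) mult_le_cancel_left_pos) auto
  also have "\<dots> \<le> 4 * 4 * (norm x)\<^sup>2"
    using pi_less_4 by (intro mult_right_mono) auto
  finally have "(norm (curve x s))\<^sup>2 \<le> (4 * norm x)\<^sup>2"
    by (simp add: power_mult_distrib)
  then show ?thesis
    unfolding s(2) by (rule power2_le_imp_le) simp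
qed

section \<open>Completeness and the Riesz representation\<close>

lemma Cauchy_if_norm_square_le:
  fixes u :: "nat \<Rightarrow> 'a::real_normed_vector"
  assumes le: "\<And>n m. n \<le> m \<Longrightarrow> (norm (u n - u m))\<^sup>2 \<le> a n" and a: "a \<longlonglongrightarrow> 0"
  shows "Cauchy u"
proof (rule metric_CauchyI)
  fix e :: real assume e: "0 < e"
  then have "0 < (e / 2)\<^sup>2" by simp
  then have "\<forall>\<^sub>F n in sequentially. a n < (e / 2)\<^sup>2"
    using order_tendstoD(2)[OF a] by blast
  then obtain N where N: "a N < (e / 2)\<^sup>2"
    by (auto simp: eventually_sequentially)
  have "dist (u N) (u m) < e / 2" if "N \<le> m" for m
    unfolding dist_norm by (rule power2_less_imp_less[OF le_less_trans[OF le[OF that] N]]) (use e in simp)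
  then show "\<exists>M. \<forall>m\<ge>M. \<forall>n\<ge>M. dist (u m) (u n) < e"
    by (metis dist_commute dist_triangle_half_l)
qed

text \<open>A stand-in for weak compactness of balls. Almost shortest vectors in the hulls of the
  tails are close to each other by the parallelogram law: the hulls are nested, so a midpoint
  competes with the infimum \<open>a n\<close>, and these infima increase and are bounded.\<close>

lemma Cauchy_convex_hull_tails:
  fixes X :: "nat \<Rightarrow> 'a::real_inner"
  assumes B: "\<And>k. norm (X k) \<le> B"
  obtains y where "Cauchy y" "\<And>n. y n \<in> convex hull (X ` {n..})"
proof -
  define C where "C n = convex hull (X ` {n..})" for n :: nat
  define a where "a n = Inf ((\<lambda>u. (norm u)\<^sup>2) ` C n)" for n
  have X: "X k \<in> C n" if "n \<le> k" for k n
    unfolding C_def by (rule hull_inc) (use that in auto)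
  have mono: "C m \<subseteq> C n" if "n \<le> m" for m n
    unfolding C_def by (rule hull_mono) (use that in auto)
  have bdd: "bdd_below ((\<lambda>u. (norm u)\<^sup>2) ` C n)" for n
    by (intro bdd_belowI[of _ 0]) auto
  have le: "a n \<le> (norm u)\<^sup>2" if "u \<in> C n" for u n
    unfolding a_def by (rule cInf_lower) (use that bdd in auto)
  have inc: "incseq a"
  proof (rule incseq_SucI)
    fix n
    show "a n \<le> a (Suc n)"
      unfolding a_def by (rule cInf_superset_mono) (use X[of "Suc n" "Suc n"] bdd mono[of n "Suc n"] in auto)
  qed
  have "a n \<le> B\<^sup>2" for n
    using le[OF X[of n n]] power_mono[OF B[of n], of 2] by simp
  then obtain L where L: "a \<longlonglongrightarrow> L"
    using incseq_convergent[OF inc] by blast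
  have "\<exists>u\<in>C n. (norm u)\<^sup>2 < a n + 1 / real (Suc n)" for n
    using cInf_lessD[of "(\<lambda>u. (norm u)\<^sup>2) ` C n" "a n + 1 / real (Suc n)"] X[of n n]
    by (auto simp: a_def)
  then obtain y where y: "\<And>n. y n \<in> C n" "\<And>n. (norm (y n))\<^sup>2 < a n + 1 / real (Suc n)"
    by metis
  have close: "(norm (y n - y m))\<^sup>2 \<le> 2 * (a m - a n) + 4 / real (Suc n)" if nm: "n \<le> m" for n m
  proof -
    have "(1 / 2) *\<^sub>R y n + (1 / 2) *\<^sub>R y m \<in> C n"
      using y(1)[of n] mono[OF nm] y(1)[of m] unfolding C_def
      by (intro convexD[OF convex_convex_hull]) auto
    from le[OF this] have "a n \<le> (norm (y n + y m))\<^sup>2 / 4"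
      by (simp flip: scaleR_add_right add: power_mult_distrib power2_eq_square)
    moreover have "(norm (y n - y m))\<^sup>2 + (norm (y n + y m))\<^sup>2 = 2 * (norm (y n))\<^sup>2 + 2 * (norm (y m))\<^sup>2"
      by (simp add: power2_norm_eq_inner inner_diff inner_add inner_commute)
    moreover have "1 / real (Suc m) \<le> 1 / real (Suc n)"
      using nm by (simp add: frac_le)
    ultimately have "(norm (y n - y m))\<^sup>2 \<le> 2 * (a m - a n) + 4 * (1 / real (Suc n))"
      using y(2)[of n] y(2)[of m] unfolding right_diff_distrib by linarith
    then show ?thesis by simp
  qed
  have lim: "(\<lambda>n. 2 * (L - a n) + 4 / real (Suc n)) \<longlonglongrightarrow> 2 * (L - L) + 0"
    by (intro tendsto_intros L LIMSEQ_Suc[OF lim_const_over_n, of 4])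
  have "Cauchy y"
  proof (rule Cauchy_if_norm_square_le)
    fix n m :: nat assume nm: "n \<le> m"
    have "2 * (a m - a n) \<le> 2 * (L - a n)" using incseq_le[OF inc L, of m] by simp
    then show "(norm (y n - y m))\<^sup>2 \<le> 2 * (L - a n) + 4 / real (Suc n)"
      using close[OF nm] by (meson add_right_mono order_trans)
  qed (use lim in simp)
  with y(1) show thesis
    by (intro that) (auto simp: C_def)
qed

lemma velocity_diff:
  "AE t in lborel. t \<in> {0..2 * pi} \<longrightarrow> velocity (x - y) t = velocity x t - velocity y t"
  using velocity_add[of x "(-1) *\<^sub>R y"] velocity_scaleR[of "-1" y]
  unfolding minus_h1loop_def by eventually_elim auto

lemma curve_diff: "curve (x - y) t = curve x t - curve y t"
  unfolding minus_h1loop_def plus_h1loop.rep_eq scaleR_h1loop.rep_eq by simp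

lemma energy_le_norm: "energy x \<le> (norm x)\<^sup>2"
  unfolding norm_h1loop_square using set_integral_nonneg_real[of "{0..2 * pi}" "\<lambda>t. (norm (curve x t))\<^sup>2"]
  by simp

lemma nn_integral_velocity_diff:
  "(\<integral>\<^sup>+t\<in>{0..2 * pi}. ennreal ((norm (velocity x t - velocity y t))\<^sup>2) \<partial>lborel) = ennreal (energy (x - y))"
proof -
  have "(\<integral>\<^sup>+t\<in>{0..2 * pi}. ennreal ((norm (velocity x t - velocity y t))\<^sup>2) \<partial>lborel)
      = (\<integral>\<^sup>+t. ennreal (indicator {0..2 * pi} t *\<^sub>R (norm (velocity (x - y) t))\<^sup>2) \<partial>lborel)"
  proof (rule nn_integral_cong_AE)
    show "AE t in lborel. ennreal ((norm (velocity x t - velocity y t))\<^sup>2) * indicator {0..2 * pi} t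
        = ennreal (indicator {0..2 * pi} t *\<^sub>R (norm (velocity (x - y) t))\<^sup>2)"
      using velocity_diff[of x y] by eventually_elim (auto simp: indicator_def)
  qed
  also have "\<dots> = ennreal (energy (x - y))"
    unfolding energy_def set_lebesgue_integral_def
    by (rule nn_integral_eq_integral) (use velocityD(3) in \<open>auto simp: set_integrable_def\<close>)
  finally show ?thesis .
qed

text \<open>Completeness by the Riesz-Fischer argument for the velocities. A fast subsequence
  converges almost everywhere, Fatou's lemma bounds its mean square distance to the limit
  \<open>g\<close>, and by the Sobolev bound the curves converge pointwise, to a primitive of
  \<open>g\<close>.\<close>

lemma h1loop_Cauchy_convergent:
  fixes y :: "nat \<Rightarrow> 'a::euclidean_space h1loop"
  assumes "Cauchy y"
  shows "\<exists>z. y \<longlonglongrightarrow> z"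
proof -
  let ?I = "{0..2 * pi}"
  have "\<exists>N. \<forall>m\<ge>N. \<forall>n\<ge>N. dist (y m) (y n) < (1 / 2) ^ k" for k :: nat
    using metric_CauchyD[OF assms, of "(1 / 2) ^ k"] by simp
  then obtain N where N: "\<And>k m n. m \<ge> N k \<Longrightarrow> n \<ge> N k \<Longrightarrow> dist (y m) (y n) < (1 / 2) ^ k"
    by metis
  \<comment> \<open>\<open>M k\<close> dominates \<open>N 0\<close>, ..., \<open>N k\<close>, so
    this index is late enough for all earlier tolerances too.\<close>
  define M where "M k = (\<Sum>i\<le>k. N i)" for k
  have M: "N k \<le> M k'" if "k \<le> k'" for k k'
    unfolding M_def by (rule member_le_sum) (use that in auto)
  define w where "w k = y (M k)" for k
  define v where "v k = velocity (w k)" for k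
  have vm [measurable]: "v k \<in> borel_measurable borel" for k
    unfolding v_def by (rule velocityD(2))
  have wd: "norm (w j - w k) < (1 / 2) ^ j" if "j \<le> k" for j k
    unfolding w_def using N[OF M[OF order_refl, of j] M[OF that]] by (simp add: dist_norm)
  have sq: "(\<integral>\<^sup>+t\<in>?I. ennreal ((norm (v j t - v k t))\<^sup>2) \<partial>lborel) \<le> ennreal ((1 / 4) ^ j)" if "j \<le> k" for j k
  proof -
    have "energy (w j - w k) \<le> (norm (w j - w k))\<^sup>2" by (rule energy_le_norm)
    also have "\<dots> \<le> ((1 / 2) ^ j)\<^sup>2" using wd[OF that] by (intro power_mono) auto
    also have "\<dots> = (1 / 4) ^ j" by (simp add: power_mult[symmetric] power2_eq_square power_mult_distrib[symmetric])
    finally show ?thesis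
      unfolding v_def nn_integral_velocity_diff by (rule ennreal_leI)
  qed
  have "AE t in lborel. t \<in> ?I \<longrightarrow> convergent (\<lambda>k. v k t)"
  proof -
    have one: "(\<integral>\<^sup>+t\<in>?I. ennreal (norm (v k t - v (Suc k) t)) \<partial>lborel) \<le> ennreal ((2 * pi + 1) * (1 / 2) ^ k)" for k
    proof -
      let ?c = "ennreal (2 ^ k)" and ?d = "ennreal ((1 / 2) ^ k)"
      \<comment> \<open>Weighting the arithmetic-geometric inequality with 2^k turns the mean square
        bound 4^(-k) into a bound of order 2^(-k) for the mean, which is summable.\<close>
      have pt: "ennreal (norm u) \<le> ?c * ennreal ((norm u)\<^sup>2) + ?d" for u :: 'a
      proof -
        have "2 * (2 ^ k * norm u) * 1 \<le> (2 ^ k * norm u)\<^sup>2 + 1\<^sup>2"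
          by (rule sum_squares_bound)
        then have "2 ^ k * norm u \<le> (2 ^ k * norm u)\<^sup>2 + 1"
          using mult_nonneg_nonneg[of "2 ^ k" "norm u"] by (simp del: mult_nonneg_nonneg)
        then have "2 ^ k * norm u \<le> 2 ^ k * (2 ^ k * (norm u)\<^sup>2 + (1 / 2) ^ k)"
          by (simp add: power_mult_distrib distrib_left power2_eq_square power_one_over ac_simps)
        then have "norm u \<le> 2 ^ k * (norm u)\<^sup>2 + (1 / 2) ^ k"
          by (subst (asm) mult_le_cancel_left_pos) auto
        then show ?thesis
          by (simp add: ennreal_mult[symmetric] ennreal_plus[symmetric] ennreal_leI del: ennreal_plus)
      qed
      have "(\<integral>\<^sup>+t\<in>?I. ennreal (norm (v k t - v (Suc k) t)) \<partial>lborel)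
          \<le> (\<integral>\<^sup>+t. ?c * (ennreal ((norm (v k t - v (Suc k) t))\<^sup>2) * indicator ?I t) + ?d * indicator ?I t \<partial>lborel)"
        using pt by (intro nn_integral_mono) (auto simp: indicator_def)
      also have "\<dots> = ?c * (\<integral>\<^sup>+t\<in>?I. ennreal ((norm (v k t - v (Suc k) t))\<^sup>2) \<partial>lborel) + ?d * ennreal (2 * pi)"
        by (simp add: nn_integral_add nn_integral_cmult)
      also have "\<dots> \<le> ?c * ennreal ((1 / 4) ^ k) + ?d * ennreal (2 * pi)"
        using sq[of k "Suc k"] by (intro add_mono mult_left_mono) auto
      also have "\<dots> = ennreal ((2 * pi + 1) * (1 / 2) ^ k)"
      proof -
        have "(2::real) ^ k * (1 / 4) ^ k = (1 / 2) ^ k"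
          by (simp add: power_mult_distrib[symmetric])
        then show ?thesis
          by (simp add: ennreal_mult[symmetric] ennreal_plus[symmetric] algebra_simps del: ennreal_plus)
      qed
      finally show ?thesis .
    qed
    have "(\<integral>\<^sup>+t. (\<Sum>k. ennreal (norm (v k t - v (Suc k) t)) * indicator ?I t) \<partial>lborel)
        = (\<Sum>k. \<integral>\<^sup>+t\<in>?I. ennreal (norm (v k t - v (Suc k) t)) \<partial>lborel)"
      by (rule nn_integral_suminf) measurable
    also have "\<dots> \<le> (\<Sum>k. ennreal ((2 * pi + 1) * (1 / 2) ^ k))"
      by (intro suminf_le one) auto
    also have "\<dots> = ennreal (\<Sum>k. (2 * pi + 1) * (1 / 2) ^ k)"
      by (rule suminf_ennreal2) (auto intro!: summable_mult summable_geometric)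
    also have "\<dots> < \<infinity>" by simp
    finally have fin: "(\<integral>\<^sup>+t. (\<Sum>k. ennreal (norm (v k t - v (Suc k) t)) * indicator ?I t) \<partial>lborel) \<noteq> \<infinity>"
      by simp
    have "AE t in lborel. (\<Sum>k. ennreal (norm (v k t - v (Suc k) t)) * indicator ?I t) \<noteq> \<infinity>"
      by (rule nn_integral_PInf_AE[OF _ fin]) measurable
    then show ?thesis
    proof (eventually_elim, intro impI)
      fix t assume "(\<Sum>k. ennreal (norm (v k t - v (Suc k) t)) * indicator ?I t) \<noteq> \<infinity>" and t: "t \<in> ?I"
      then have "(\<Sum>k. ennreal (norm (v k t - v (Suc k) t))) \<noteq> \<infinity>" by simp
      then have "summable (\<lambda>k. norm (v k t - v (Suc k) t))"
        by (intro summable_suminf_not_top) auto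
      then have "summable (\<lambda>k. v k t - v (Suc k) t)" by (rule summable_norm_cancel)
      then have "convergent (\<lambda>n. \<Sum>k<n. v k t - v (Suc k) t)"
        by (simp add: summable_iff_convergent)
      then have "convergent (\<lambda>n. v 0 t - (\<Sum>k<n. v k t - v (Suc k) t))"
        by (intro convergent_diff convergent_const)
      then show "convergent (\<lambda>k. v k t)"
        by (simp add: sum_lessThan_telescope'[of "\<lambda>k. v k t"])
    qed
  qed
  note conv = this
  define g where "g t = lim (\<lambda>k. v k t)" for t
  have gm [measurable]: "g \<in> borel_measurable borel"
    unfolding g_def by measurable
  have fatou: "(\<integral>\<^sup>+t\<in>?I. ennreal ((norm (v j t - g t))\<^sup>2) \<partial>lborel) \<le> ennreal ((1 / 4) ^ j)" for j
  proof -
    have "(\<integral>\<^sup>+t\<in>?I. ennreal ((norm (v j t - g t))\<^sup>2) \<partial>lborel)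
        = (\<integral>\<^sup>+t. liminf (\<lambda>k. ennreal ((norm (v j t - v k t))\<^sup>2) * indicator ?I t) \<partial>lborel)"
    proof (rule nn_integral_cong_AE)
      show "AE t in lborel. ennreal ((norm (v j t - g t))\<^sup>2) * indicator ?I t
          = liminf (\<lambda>k. ennreal ((norm (v j t - v k t))\<^sup>2) * indicator ?I t)"
        using conv
      proof eventually_elim
        fix t assume c: "t \<in> ?I \<longrightarrow> convergent (\<lambda>k. v k t)"
        show "ennreal ((norm (v j t - g t))\<^sup>2) * indicator ?I t
            = liminf (\<lambda>k. ennreal ((norm (v j t - v k t))\<^sup>2) * indicator ?I t)"
        proof (cases "t \<in> ?I")
          case True
          then have "(\<lambda>k. v k t) \<longlonglongrightarrow> g t"
            using c by (simp add: g_def convergent_LIMSEQ_iff)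
          then have "(\<lambda>k. ennreal ((norm (v j t - v k t))\<^sup>2)) \<longlonglongrightarrow> ennreal ((norm (v j t - g t))\<^sup>2)"
            by (intro tendsto_intros)
          then show ?thesis
            using True lim_imp_Liminf[OF sequentially_bot, symmetric] by auto
        qed (simp add: Liminf_const)
      qed
    qed
    also have "\<dots> \<le> liminf (\<lambda>k. \<integral>\<^sup>+t\<in>?I. ennreal ((norm (v j t - v k t))\<^sup>2) \<partial>lborel)"
      by (rule nn_integral_liminf) measurable
    also have "\<dots> \<le> ennreal ((1 / 4) ^ j)"
      by (rule Liminf_le) (use sq[of j] in \<open>auto simp: eventually_sequentially\<close>)
    finally show ?thesis .
  qed
  have dsq: "set_integrable lborel ?I (\<lambda>t. (norm (v j t - g t))\<^sup>2)" for j
    unfolding set_integrable_def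
  proof (rule integrableI_bounded)
    show "(\<integral>\<^sup>+t. ennreal (norm (indicator ?I t *\<^sub>R (norm (v j t - g t))\<^sup>2)) \<partial>lborel) < \<infinity>"
    proof -
      have "(\<integral>\<^sup>+t. ennreal (norm (indicator ?I t *\<^sub>R (norm (v j t - g t))\<^sup>2)) \<partial>lborel)
          = (\<integral>\<^sup>+t\<in>?I. ennreal ((norm (v j t - g t))\<^sup>2) \<partial>lborel)"
        by (intro nn_integral_cong) (auto simp: indicator_def)
      also have "\<dots> < \<infinity>"
        using fatou[of j] by (simp add: order_le_less_trans)
      finally show ?thesis .
    qed
  qed measurable
  have dint: "(LINT t:?I|lborel. (norm (v j t - g t))\<^sup>2) \<le> (1 / 4) ^ j" for j
  proof -
    have "ennreal (LINT t:?I|lborel. (norm (v j t - g t))\<^sup>2)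
        = (\<integral>\<^sup>+t. ennreal (indicator ?I t *\<^sub>R (norm (v j t - g t))\<^sup>2) \<partial>lborel)"
      unfolding set_lebesgue_integral_def
      by (rule nn_integral_eq_integral[symmetric]) (use dsq in \<open>auto simp: set_integrable_def\<close>)
    also have "\<dots> = (\<integral>\<^sup>+t\<in>?I. ennreal ((norm (v j t - g t))\<^sup>2) \<partial>lborel)"
      by (intro nn_integral_cong) (auto simp: indicator_def)
    finally have "ennreal (LINT t:?I|lborel. (norm (v j t - g t))\<^sup>2) \<le> ennreal ((1 / 4) ^ j)"
      using fatou[of j] by simp
    then show ?thesis by simp
  qed
  have gsq: "set_integrable lborel ?I (\<lambda>t. (norm (g t))\<^sup>2)"
  proof (rule set_integrable_bound)
    show "set_integrable lborel ?I (\<lambda>t. 2 * (norm (v 0 t - g t))\<^sup>2 + 2 * (norm (v 0 t))\<^sup>2)"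
      using dsq[of 0] velocityD(3)[of "w 0"] by (intro set_integral_add(1)) (simp_all add: v_def)
    show "AE t in lborel. t \<in> ?I \<longrightarrow> norm ((norm (g t))\<^sup>2)
        \<le> norm (2 * (norm (v 0 t - g t))\<^sup>2 + 2 * (norm (v 0 t))\<^sup>2)"
    proof (intro AE_I2 impI)
      fix t
      have "norm (g t) \<le> norm (v 0 t - g t) + norm (v 0 t)"
        by (metis add.commute norm_minus_commute norm_triangle_sub)
      then have "(norm (g t))\<^sup>2 \<le> (norm (v 0 t - g t) + norm (v 0 t))\<^sup>2"
        by (intro power_mono) auto
      also have "\<dots> \<le> 2 * (norm (v 0 t - g t))\<^sup>2 + 2 * (norm (v 0 t))\<^sup>2"
        using sum_squares_bound[of "norm (v 0 t - g t)" "norm (v 0 t)"] by (simp add: power2_sum)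
      finally show "norm ((norm (g t))\<^sup>2) \<le> norm (2 * (norm (v 0 t - g t))\<^sup>2 + 2 * (norm (v 0 t))\<^sup>2)"
        by simp
    qed
  qed (auto simp: set_borel_measurable_def)
  note gi = square_integrable_imp_integrable[OF gm gsq]
  define Z where "Z t = lim (\<lambda>k. curve (w k) t)" for t
  have Z: "(\<lambda>k. curve (w k) t) \<longlonglongrightarrow> Z t" for t
  proof -
    have "Cauchy (\<lambda>k. curve (w k) t)"
    proof (rule metric_CauchyI)
      fix e :: real assume e: "0 < e"
      obtain j where j: "(1 / 2) ^ j < e / 8"
        using real_arch_pow_inv[of "e / 8" "1 / 2"] e by auto
      have "dist (curve (w j) t) (curve (w k) t) < e / 2" if "j \<le> k" for k
        using curve_le_norm[of "w j - w k" t] wd[OF that] j by (simp add: dist_norm curve_diff)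
      then show "\<exists>M. \<forall>m\<ge>M. \<forall>n\<ge>M. dist (curve (w m) t) (curve (w n) t) < e"
        by (metis dist_commute dist_triangle_half_l)
    qed
    then show ?thesis
      unfolding Z_def by (simp add: Cauchy_convergent_iff convergent_LIMSEQ_iff)
  qed
  have "has_weak_derivative Z g"
    unfolding has_weak_derivative_def
  proof (intro conjI allI ballI gm gsq)
    show "Z (t + 2 * pi) = Z t" for t
      unfolding Z_def by (simp only: curve_periodic)
    fix t assume t: "t \<in> ?I"
    have ii: "set_integrable lborel {0..t} (v k)" "set_integrable lborel {0..t} g" for k
      using t velocityD(4)[of "w k"] gi by (auto intro: set_integrable_subset simp: v_def)
    have "(\<lambda>k. LINT s:{0..t}|lborel. v k s) \<longlonglongrightarrow> (LINT s:{0..t}|lborel. g s)"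
    proof (rule LIMSEQ_I)
      fix e :: real assume e: "0 < e"
      obtain j where j: "(1 / 4) ^ j < e\<^sup>2 / (2 * pi)"
        using real_arch_pow_inv[of "e\<^sup>2 / (2 * pi)" "1 / 4"] e by auto
      have "norm ((LINT s:{0..t}|lborel. v k s) - (LINT s:{0..t}|lborel. g s)) < e" if k: "j \<le> k" for k
      proof -
        have "(LINT s:{0..t}|lborel. v k s) - (LINT s:{0..t}|lborel. g s) = (LINT s:{0..t}|lborel. v k s - g s)"
          using ii by (simp add: set_integral_diff)
        also have "(norm \<dots>)\<^sup>2 \<le> (t - 0) * (LINT s:{0..t}|lborel. (norm (v k s - g s))\<^sup>2)"
          using t ii dsq[of k] by (intro set_integral_norm_square_le)
            (auto intro: set_integrable_subset set_integral_diff)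
        also have "\<dots> \<le> (2 * pi) * (LINT s:?I|lborel. (norm (v k s - g s))\<^sup>2)"
          using t dsq[of k] by (intro mult_mono set_integral_subset_mono set_integral_nonneg_real) auto
        also have "\<dots> \<le> (2 * pi) * (1 / 4) ^ k"
          using dint[of k] by (intro mult_left_mono) auto
        also have "\<dots> \<le> (2 * pi) * (1 / 4) ^ j"
          using k by (intro mult_left_mono power_decreasing) auto
        also have "\<dots> < e\<^sup>2"
          using j by (simp add: field_simps)
        finally show ?thesis
          by (rule power2_less_imp_less) (use e in simp)
      qed
      then show "\<exists>no. \<forall>n\<ge>no. norm ((LINT s:{0..t}|lborel. v n s) - (LINT s:{0..t}|lborel. g s)) < e"
        by blast
    qed
    then have "(\<lambda>k. curve (w k) 0 + (LINT s:{0..t}|lborel. v k s)) \<longlonglongrightarrow> Z 0 + (LINT s:{0..t}|lborel. g s)"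
      by (intro tendsto_add Z)
    moreover have "(\<lambda>k. curve (w k) 0 + (LINT s:{0..t}|lborel. v k s)) = (\<lambda>k. curve (w k) t)"
      unfolding v_def by (rule ext) (rule velocityD(5)[OF t, symmetric])
    ultimately show "Z t = Z 0 + (LINT s:{0..t}|lborel. g s)"
      using Z[of t] LIMSEQ_unique by metis
  qed
  note wZ = this
  define z where "z = Abs_h1loop Z"
  have cz: "curve z = Z"
    unfolding z_def using wZ by (intro Abs_h1loop_inverse) auto
  \<comment> \<open>The 32 pi is the length of the period times 16, the square of the Sobolev
    constant.\<close>
  have est: "(norm (w k - z))\<^sup>2 \<le> (32 * pi + 1) * (1 / 4) ^ k" for k
  proof -
    have "energy (w k - z) \<le> (1 / 4) ^ k"
    proof -
      have "has_weak_derivative (curve (w k - z)) (\<lambda>t. v k t + (-1) *\<^sub>R g t)"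
        using has_weak_derivative_add[OF has_weak_derivative_velocity[of "w k"]
            has_weak_derivative_scaleR[OF wZ, of "-1"]]
        unfolding minus_h1loop_def plus_h1loop.rep_eq scaleR_h1loop.rep_eq cz v_def .
      from energy_eq[OF this] show ?thesis using dint[of k] by simp
    qed
    moreover have "(LINT t:?I|lborel. (norm (curve (w k - z) t))\<^sup>2) \<le> (LINT t:?I|lborel. 16 * (1 / 4) ^ k)"
    proof (rule set_integral_mono)
      show "set_integrable lborel ?I (\<lambda>t. (norm (curve (w k - z) t))\<^sup>2)"
        using integrable_curve_inner[of "w k - z" "w k - z"] by (simp add: power2_norm_eq_inner)
      show "set_integrable lborel ?I (\<lambda>t. 16 * (1 / 4) ^ k :: real)"
        by (rule borel_integrable_atLeastAtMost') simp
      fix t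
      have "(\<lambda>j. norm (curve (w k) t - curve (w j) t)) \<longlonglongrightarrow> norm (curve (w k) t - Z t)"
        by (intro tendsto_intros Z)
      moreover have "norm (curve (w k) t - curve (w j) t) \<le> 4 * (1 / 2) ^ k" if "k \<le> j" for j
        using curve_le_norm[of "w k - w j" t] wd[OF that] by (simp add: curve_diff)
      ultimately have "norm (curve (w k) t - Z t) \<le> 4 * (1 / 2) ^ k"
        by (intro tendsto_upperbound[of _ _ sequentially]) (auto simp: eventually_sequentially)
      then have "(norm (curve (w k) t - Z t))\<^sup>2 \<le> (4 * (1 / 2) ^ k)\<^sup>2"
        by (intro power_mono) auto
      also have "\<dots> = 16 * (1 / 4) ^ k"
        by (simp add: power_mult_distrib power_mult[symmetric] power2_eq_square power_mult_distrib[symmetric])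
      finally show "(norm (curve (w k - z) t))\<^sup>2 \<le> 16 * (1 / 4) ^ k"
        by (simp add: curve_diff cz)
    qed
    ultimately show ?thesis
      by (simp add: norm_h1loop_square set_integral_const algebra_simps)
  qed
  have "y \<longlonglongrightarrow> z"
  proof (rule LIMSEQ_I)
    fix e :: real assume e: "0 < e"
    obtain j where j: "(1 / 2) ^ j < e / 24"
      using real_arch_pow_inv[of "e / 24" "1 / 2"] e by auto
    have "(norm (w j - z))\<^sup>2 \<le> (32 * pi + 1) * (1 / 4) ^ j" by (rule est)
    also have "\<dots> \<le> 144 * (1 / 4) ^ j"
      using pi_less_4 by (intro mult_right_mono) auto
    also have "\<dots> = (12 * (1 / 2) ^ j)\<^sup>2"
      by (simp add: power_mult_distrib power_mult[symmetric] power2_eq_square power_mult_distrib[symmetric])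
    finally have wz: "norm (w j - z) \<le> 12 * (1 / 2) ^ j"
      by (rule power2_le_imp_le) simp
    have "norm (y n - z) < e" if "M j \<le> n" for n
    proof -
      have "norm (y n - w j) < (1 / 2) ^ j"
        using N[of j n "M j"] M[of j j] that by (simp add: w_def dist_norm)
      then show ?thesis
        using norm_triangle_ineq[of "y n - w j" "w j - z"] wz j e by simp
    qed
    then show "\<exists>no. \<forall>n\<ge>no. norm (y n - z) < e" by blast
  qed
  then show ?thesis by blast
qed

text \<open>\<open>GDERIV\<close> asks for a derivative of the form \<open>inner h D\<close>. The
  vector \<open>D\<close> minimizes |u|^2 / 2 - L u; the midpoint identity of this functional makes
  minimizing sequences Cauchy.\<close>

lemma h1loop_riesz_representation:
  fixes L :: "'a::euclidean_space h1loop \<Rightarrow> real"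
  assumes "bounded_linear L"
  shows "\<exists>D. \<forall>h. L h = inner h D"
proof -
  interpret L: bounded_linear L by fact
  obtain B where B: "\<And>u. \<bar>L u\<bar> \<le> norm u * B"
    using L.bounded by auto
  define J where "J u = (norm u)\<^sup>2 / 2 - L u" for u
  have low: "- (B\<^sup>2 / 2) \<le> J u" for u
    using B[of u] sum_squares_bound[of "norm u" B] unfolding J_def by linarith
  then have bdd: "bdd_below (range J)" by (rule bdd_belowI2)
  define I where "I = Inf (range J)"
  have IJ: "I \<le> J u" for u unfolding I_def using bdd by (intro cInf_lower) auto
  have "\<exists>u. J u < I + 1 / real (Suc n)" for n
    using cInf_lessD[of "range J" "I + 1 / real (Suc n)"] by (auto simp: I_def)
  then obtain u where u: "\<And>n. J (u n) < I + 1 / real (Suc n)" by metis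
  have close: "(norm (u n - u m))\<^sup>2 \<le> 8 / real (Suc n)" if "n \<le> m" for n m
  proof -
    have "J (u n) + J (u m) - 2 * J ((1 / 2) *\<^sub>R (u n + u m)) = (norm (u n - u m))\<^sup>2 / 4"
      by (simp add: J_def L.scaleR L.add power2_norm_eq_inner inner_diff inner_add inner_commute field_simps)
    moreover have "1 / real (Suc m) \<le> 1 / real (Suc n)"
      using that by (simp add: frac_le)
    ultimately show ?thesis
      using u[of n] u[of m] IJ[of "(1 / 2) *\<^sub>R (u n + u m)"] by linarith
  qed
  have "Cauchy u"
    by (rule Cauchy_if_norm_square_le[OF close LIMSEQ_Suc[OF lim_const_over_n]])
  then obtain D where D: "u \<longlonglongrightarrow> D" using h1loop_Cauchy_convergent by blast
  have "(\<lambda>n. J (u n)) \<longlonglongrightarrow> J D"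
    unfolding J_def by (intro tendsto_intros L.tendsto D) simp
  moreover have "(\<lambda>n. I + 1 / real (Suc n)) \<longlonglongrightarrow> I + 0"
    by (intro tendsto_intros LIMSEQ_Suc[OF lim_const_over_n])
  ultimately have "J D \<le> I + 0"
    by (rule LIMSEQ_le) (use u in \<open>auto intro!: exI[of _ 0] less_imp_le\<close>)
  then have min: "J D \<le> J (D + t *\<^sub>R h)" for t h using IJ[of "D + t *\<^sub>R h"] by simp
  have "L h = inner h D" for h
  proof (cases "h = 0")
    case False
    define c where "c = inner h D - L h"
    define n where "n = (norm h)\<^sup>2"
    have n: "0 < n" using False by (simp add: n_def)
    \<comment> \<open>The minimum point of the quadratic polynomial in \<open>t\<close> computed
      next; its value -c^2 / (2 n) must be nonnegative, which forces \<open>c = 0\<close>.\<close>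
    define t where "t = - (c / n)"
    have "J (D + t *\<^sub>R h) = J D + t * c + t\<^sup>2 * n / 2"
    proof -
      have "(norm (D + t *\<^sub>R h))\<^sup>2 = (norm D)\<^sup>2 + 2 * t * inner h D + t\<^sup>2 * n"
        by (simp add: n_def power2_norm_eq_inner inner_add inner_commute power2_eq_square[of t])
      then show ?thesis
        by (simp add: J_def c_def L.add L.scaleR field_simps)
    qed
    then have "0 \<le> t * c + t\<^sup>2 * n / 2" using min[of t h] by linarith
    also have "\<dots> = - (c\<^sup>2 / (2 * n))"
      using n by (simp add: t_def power2_eq_square field_simps)
    finally have "c = 0" using n by (simp add: divide_le_0_iff)
    then show ?thesis by (simp add: c_def)
  qed (simp add: L.zero)
  then show ?thesis by blast
qed

section \<open>The Riccati inequality\<close>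

text \<open>The product is an integral over the plane. Cutting the plane along the diagonal and
  applying Fubini to both halves yields integration by parts for functions that are merely
  indefinite integrals.\<close>

lemma integral_mult_eq_iterated:
  fixes G H :: "real \<Rightarrow> real"
  assumes G: "integrable lborel G" and H: "integrable lborel H"
  shows "(LINT t|lborel. G t) * (LINT t|lborel. H t)
    = (LINT t|lborel. G t * (LINT s:{..t}|lborel. H s)) + (LINT s|lborel. H s * (LINT t:{..s}|lborel. G t))"
    and "integrable lborel (\<lambda>t. G t * (LINT s:{..t}|lborel. H s))"
proof -
  have [measurable]: "G \<in> borel_measurable borel" "H \<in> borel_measurable borel"
    using G H by auto
  interpret pair_sigma_finite lborel lborel ..
  have GH: "integrable (lborel \<Otimes>\<^sub>M lborel) (\<lambda>(t, s). G t * H s)"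
    by (rule lborel_pair.Fubini_integrable)
      (use G H in \<open>auto simp: norm_mult abs_mult intro!: integrable_mult_left\<close>)
  have I1: "integrable (lborel \<Otimes>\<^sub>M lborel) (\<lambda>(t, s). G t * (indicator {..t} s * H s))"
    by (rule Bochner_Integration.integrable_bound[OF GH])
      (auto simp: indicator_def split: prod.splits)
  have I2: "integrable (lborel \<Otimes>\<^sub>M lborel) (\<lambda>(t, s). (indicator {..<s} t * G t) * H s)"
    by (rule Bochner_Integration.integrable_bound[OF GH])
      (auto simp: indicator_def split: prod.splits)
  have "(LINT t|lborel. G t) * (LINT t|lborel. H t) = (LINT t|lborel. LINT s|lborel. G t * H s)"
    by simp
  also have "\<dots> = (LINT p|(lborel \<Otimes>\<^sub>M lborel). (case p of (t, s) \<Rightarrow> G t * H s))"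
    using lborel_pair.integral_fst[OF GH] by simp
  also have "(\<lambda>p. case p of (t, s) \<Rightarrow> G t * H s)
      = (\<lambda>p. (case p of (t, s) \<Rightarrow> G t * (indicator {..t} s * H s))
        + (case p of (t, s) \<Rightarrow> (indicator {..<s} t * G t) * H s))"
    by (auto simp: indicator_def fun_eq_iff)
  also have "(LINT p|(lborel \<Otimes>\<^sub>M lborel). \<dots> p)
      = (LINT p|(lborel \<Otimes>\<^sub>M lborel). (case p of (t, s) \<Rightarrow> G t * (indicator {..t} s * H s)))
      + (LINT p|(lborel \<Otimes>\<^sub>M lborel). (case p of (t, s) \<Rightarrow> (indicator {..<s} t * G t) * H s))"
    using I1 I2 by (rule Bochner_Integration.integral_add)
  also have "(LINT p|(lborel \<Otimes>\<^sub>M lborel). (case p of (t, s) \<Rightarrow> G t * (indicator {..t} s * H s)))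
      = (LINT t|lborel. G t * (LINT s:{..t}|lborel. H s))"
    using lborel_pair.integral_fst[OF I1] by (simp add: set_lebesgue_integral_def)
  also have "(LINT p|(lborel \<Otimes>\<^sub>M lborel). (case p of (t, s) \<Rightarrow> (indicator {..<s} t * G t) * H s))
      = (LINT s|lborel. H s * (LINT t:{..<s}|lborel. G t))"
    using lborel_pair.integral_snd[OF I2] by (simp add: set_lebesgue_integral_def mult.commute)
  also have "(\<lambda>s. LINT t:{..<s}|lborel. G t) = (\<lambda>s. LINT t:{..s}|lborel. G t)"
  proof
    fix s :: real
    show "(LINT t:{..<s}|lborel. G t) = (LINT t:{..s}|lborel. G t)"
      unfolding set_lebesgue_integral_def
    proof (rule integral_cong_AE)
      show "AE t in lborel. indicator {..<s} t *\<^sub>R G t = indicator {..s} t *\<^sub>R G t"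
        using AE_lborel_singleton[of s] by eventually_elim (auto simp: indicator_def)
    qed auto
  qed
  finally show "(LINT t|lborel. G t) * (LINT t|lborel. H t)
    = (LINT t|lborel. G t * (LINT s:{..t}|lborel. H s)) + (LINT s|lborel. H s * (LINT t:{..s}|lborel. G t))" .
  show "integrable lborel (\<lambda>t. G t * (LINT s:{..t}|lborel. H s))"
    using lborel_pair.integrable_fst[OF I1] by (simp add: set_lebesgue_integral_def)
qed

text \<open>The Riccati argument differentiates \<open>P u\<^sup>2\<close>, where \<open>u\<close>
  has only an integrable derivative. This is the product rule in the integrated form that such
  functions satisfy.\<close>

lemma absolutely_continuous_mult:
  fixes u v g k :: "real \<Rightarrow> real"
  assumes ab: "a \<le> b"
    and g: "set_integrable lborel {a..b} g" and k: "set_integrable lborel {a..b} k"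
    and u: "\<And>t. t \<in> {a..b} \<Longrightarrow> u t = u a + (LINT s:{a..t}|lborel. g s)"
    and v: "\<And>t. t \<in> {a..b} \<Longrightarrow> v t = v a + (LINT s:{a..t}|lborel. k s)"
  shows "u b * v b - u a * v a = (LINT t:{a..b}|lborel. g t * v t + u t * k t)"
    and "set_integrable lborel {a..b} (\<lambda>t. g t * v t + u t * k t)"
proof -
  define G where "G t = indicator {a..b} t * g t" for t
  define H where "H t = indicator {a..b} t * k t" for t
  have G: "integrable lborel G" and H: "integrable lborel H"
    unfolding G_def H_def using g k by (simp_all add: set_integrable_def)
  have Gt: "(LINT s:{..t}|lborel. G s) = u t - u a" and Ht: "(LINT s:{..t}|lborel. H s) = v t - v a"
    if "t \<in> {a..b}" for t
  proof -
    have "indicator {..t} s *\<^sub>R G s = indicator {a..t} s *\<^sub>R g s"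
      "indicator {..t} s *\<^sub>R H s = indicator {a..t} s *\<^sub>R k s" for s
      using that by (auto simp: G_def H_def indicator_def)
    then show "(LINT s:{..t}|lborel. G s) = u t - u a" "(LINT s:{..t}|lborel. H s) = v t - v a"
      using u[OF that] v[OF that] by (simp_all add: set_lebesgue_integral_def)
  qed
  have GI: "(LINT t|lborel. G t) = u b - u a" "(LINT t|lborel. H t) = v b - v a"
    using u[of b] v[of b] ab by (simp_all add: G_def H_def set_lebesgue_integral_def)
  have e1: "G t * (LINT s:{..t}|lborel. H s) = indicator {a..b} t * (g t * v t) - v a * G t" for t
    by (cases "t \<in> {a..b}") (simp_all add: Ht, simp_all add: G_def algebra_simps)
  have e2: "H t * (LINT s:{..t}|lborel. G s) = indicator {a..b} t * (u t * k t) - u a * H t" for t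
    by (cases "t \<in> {a..b}") (simp_all add: Gt, simp_all add: H_def algebra_simps)
  note i1 = integral_mult_eq_iterated(2)[OF G H, unfolded e1]
    and i2 = integral_mult_eq_iterated(2)[OF H G, unfolded e2]
  have j1: "integrable lborel (\<lambda>t. indicator {a..b} t * (g t * v t))"
    using Bochner_Integration.integrable_add[OF i1 integrable_mult_right[OF G, of "v a"]] by simp
  have j2: "integrable lborel (\<lambda>t. indicator {a..b} t * (u t * k t))"
    using Bochner_Integration.integrable_add[OF i2 integrable_mult_right[OF H, of "u a"]] by simp
  have "(u b - u a) * (v b - v a)
      = (LINT t|lborel. indicator {a..b} t * (g t * v t)) - v a * (u b - u a)
      + ((LINT t|lborel. indicator {a..b} t * (u t * k t)) - u a * (v b - v a))"
    using integral_mult_eq_iterated(1)[OF G H] j1 j2 G H unfolding e1 e2 GI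
    by (simp add: GI)
  moreover have "(LINT t:{a..b}|lborel. g t * v t + u t * k t)
      = (LINT t|lborel. indicator {a..b} t * (g t * v t)) + (LINT t|lborel. indicator {a..b} t * (u t * k t))"
    using j1 j2 by (simp add: set_lebesgue_integral_def distrib_left)
  ultimately show "u b * v b - u a * v a = (LINT t:{a..b}|lborel. g t * v t + u t * k t)"
    by (simp add: algebra_simps)
  show "set_integrable lborel {a..b} (\<lambda>t. g t * v t + u t * k t)"
    using Bochner_Integration.integrable_add[OF j1 j2] by (simp add: set_integrable_def distrib_left)
qed

text \<open>
  Jacobi's form of the Legendre condition: if \<open>P\<close> solves the Riccati equation \<open>P' = - h - P\<^sup>2\<close>, then
  \<open>(g - P u)\<^sup>2 \<ge> 0\<close> says that \<open>g\<^sup>2 - h u\<^sup>2\<close> is at least the derivative of \<open>P u\<^sup>2\<close>.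
\<close>

lemma riccati_inequality_real:
  fixes u g P h :: "real \<Rightarrow> real"
  assumes ab: "a \<le> b"
    and g: "set_integrable lborel {a..b} g" and g2: "set_integrable lborel {a..b} (\<lambda>t. (g t)\<^sup>2)"
    and u: "\<And>t. t \<in> {a..b} \<Longrightarrow> u t = u a + (LINT s:{a..t}|lborel. g s)"
    and P: "\<And>t. t \<in> {a..b} \<Longrightarrow> (P has_real_derivative - h t - (P t)\<^sup>2) (at t)"
    and h: "continuous_on {a..b} h" and cu: "continuous_on {a..b} u"
  shows "P b * (u b)\<^sup>2 - P a * (u a)\<^sup>2 + (LINT t:{a..b}|lborel. h t * (u t)\<^sup>2)
    \<le> (LINT t:{a..b}|lborel. (g t)\<^sup>2)"
proof -
  define k where "k t = - h t - (P t)\<^sup>2" for t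
  have cP: "continuous_on {a..b} P"
    by (rule DERIV_continuous_on) (use P in \<open>auto intro: has_field_derivative_at_within\<close>)
  have ck: "continuous_on {a..b} k"
    unfolding k_def by (intro continuous_intros h cP)
  have ik: "set_integrable lborel {a..b} k"
    by (rule borel_integrable_atLeastAtMost') (rule ck)
  have Pk: "P t = P a + (LINT s:{a..t}|lborel. k s)" if t: "t \<in> {a..b}" for t
  proof -
    have "(LINT s|lborel. indicator {a..t} s *\<^sub>R k s) = P t - P a"
      by (rule integral_FTC_Icc)
        (use t P ck in \<open>auto simp: k_def has_real_derivative_iff_has_vector_derivative
           intro: has_vector_derivative_at_within continuous_on_subset\<close>)
    then show ?thesis by (simp add: set_lebesgue_integral_def)
  qed
  define w where "w t = (u t)\<^sup>2" for t
  have w: "w t = w a + (LINT s:{a..t}|lborel. g s * u s + u s * g s)" if t: "t \<in> {a..b}" for t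
  proof -
    have "u t * u t - u a * u a = (LINT s:{a..t}|lborel. g s * u s + u s * g s)"
    proof (rule absolutely_continuous_mult)
      show "set_integrable lborel {a..t} g"
        using t by (intro set_integrable_subset[OF g]) auto
      then show "set_integrable lborel {a..t} g" .
      show "u s = u a + (LINT s:{a..s}|lborel. g s)" if "s \<in> {a..t}" for s
        by (rule u) (use t that in auto)
      then show "u s = u a + (LINT s:{a..s}|lborel. g s)" if "s \<in> {a..t}" for s
        using that .
    qed (use t in auto)
    then show ?thesis by (simp add: w_def power2_eq_square)
  qed
  have iw: "set_integrable lborel {a..b} (\<lambda>s. g s * u s + u s * g s)"
    by (rule absolutely_continuous_mult(2)[OF ab g g u u])
  note prod = absolutely_continuous_mult[OF ab iw ik w Pk]
  have ih: "set_integrable lborel {a..b} (\<lambda>t. h t * w t)"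
    unfolding w_def by (rule borel_integrable_atLeastAtMost') (intro continuous_intros h cu)
  have "(LINT t:{a..b}|lborel. ((g t * u t + u t * g t) * P t + w t * k t) + h t * w t)
      \<le> (LINT t:{a..b}|lborel. (g t)\<^sup>2)"
  proof (rule set_integral_mono)
    show "set_integrable lborel {a..b} (\<lambda>t. ((g t * u t + u t * g t) * P t + w t * k t) + h t * w t)"
      by (intro set_integral_add(1) prod(2) ih)
    show "((g t * u t + u t * g t) * P t + w t * k t) + h t * w t \<le> (g t)\<^sup>2" for t
      using zero_le_power2[of "g t - P t * u t"]
      by (simp add: w_def k_def power2_eq_square algebra_simps)
  qed (rule g2)
  also have "(LINT t:{a..b}|lborel. ((g t * u t + u t * g t) * P t + w t * k t) + h t * w t)
      = (w b * P b - w a * P a) + (LINT t:{a..b}|lborel. h t * w t)"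
    using set_integral_add(2)[OF prod(2) ih] prod(1) by simp
  finally show ?thesis by (simp add: w_def mult.commute)
qed

lemma set_integrable_norm_square_Basis:
  fixes g :: "real \<Rightarrow> 'a::euclidean_space"
  assumes g: "set_integrable lborel A g" and g2: "set_integrable lborel A (\<lambda>t. (norm (g t))\<^sup>2)"
    and b: "b \<in> Basis"
  shows "set_integrable lborel A (\<lambda>t. (inner (g t) b)\<^sup>2)"
proof (rule set_integrable_bound[OF g2])
  have "integrable lborel (\<lambda>t. inner (indicator A t *\<^sub>R g t) b)"
    using g integrable_inner_left[of b lborel "\<lambda>t. indicator A t *\<^sub>R g t"] by (simp only: set_integrable_def)
  then have "(\<lambda>t. (indicator A t * inner (g t) b)\<^sup>2) \<in> borel_measurable lborel"
    by (intro borel_measurable_power) (auto dest: borel_measurable_integrable)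
  moreover have "(\<lambda>t. (indicator A t * inner (g t) b)\<^sup>2) = (\<lambda>t. indicator A t *\<^sub>R (inner (g t) b)\<^sup>2)"
    by (auto simp: indicator_def)
  ultimately show "set_borel_measurable lborel A (\<lambda>t. (inner (g t) b)\<^sup>2)"
    by (simp add: set_borel_measurable_def)
  show "AE t in lborel. t \<in> A \<longrightarrow> norm ((inner (g t) b)\<^sup>2) \<le> norm ((norm (g t))\<^sup>2)"
    using Basis_le_norm[OF b] by (intro AE_I2) (simp add: abs_le_square_iff[symmetric])
qed

text \<open>\<open>P\<close> and \<open>h\<close> are scalar and all other terms are sums of squares
  of coordinates, so the real inequality can be summed over the basis.\<close>

lemma riccati_inequality:
  fixes x g :: "real \<Rightarrow> 'a::euclidean_space" and P h :: "real \<Rightarrow> real"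
  assumes x: "has_weak_derivative x g" and ab: "0 \<le> a" "a \<le> b" "b \<le> 2 * pi"
    and P: "\<And>t. t \<in> {a..b} \<Longrightarrow> (P has_real_derivative - h t - (P t)\<^sup>2) (at t)"
    and h: "continuous_on {a..b} h"
  shows "P b * (norm (x b))\<^sup>2 - P a * (norm (x a))\<^sup>2 + (LINT t:{a..b}|lborel. h t * (norm (x t))\<^sup>2)
    \<le> (LINT t:{a..b}|lborel. (norm (g t))\<^sup>2)"
proof -
  have g: "set_integrable lborel {a..b} g" and g2: "set_integrable lborel {a..b} (\<lambda>t. (norm (g t))\<^sup>2)"
    using ab has_weak_derivativeD(3,4)[OF x] by (auto intro: set_integrable_subset)
  have cx: "continuous_on {a..b} x"
    using has_weak_derivative_continuous[OF x] by (rule continuous_on_subset) (use ab in auto)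
  have comp: "P b * (inner (x b) e)\<^sup>2 - P a * (inner (x a) e)\<^sup>2 + (LINT t:{a..b}|lborel. h t * (inner (x t) e)\<^sup>2)
      \<le> (LINT t:{a..b}|lborel. (inner (g t) e)\<^sup>2)" if e: "e \<in> Basis" for e
  proof (rule riccati_inequality_real[OF ab(2) _ _ _ P h])
    have gi: "set_integrable lborel {a..t} g" if "t \<in> {a..b}" for t
      using that by (auto intro: set_integrable_subset[OF g])
    have gie: "integrable lborel (\<lambda>s. inner (indicator {a..t} s *\<^sub>R g s) e)" if "t \<in> {a..b}" for t
      using gi[OF that] integrable_inner_left[of e lborel "\<lambda>s. indicator {a..t} s *\<^sub>R g s"]
      by (simp only: set_integrable_def)
    show "set_integrable lborel {a..b} (\<lambda>t. inner (g t) e)"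
      using gie[of b] ab by (simp add: set_integrable_def)
    show "inner (x t) e = inner (x a) e + (LINT s:{a..t}|lborel. inner (g s) e)" if t: "t \<in> {a..b}" for t
    proof -
      have "inner (x t - x a) e = (LINT s:{a..t}|lborel. inner (g s) e)"
        using weak_derivative_diff[OF x, of a t] t ab gi[OF t]
          integral_inner_left[of e lborel "\<lambda>s. indicator {a..t} s *\<^sub>R g s"]
        by (simp add: set_lebesgue_integral_def set_integrable_def)
      then show ?thesis by (simp add: inner_diff_left)
    qed
  qed (use set_integrable_norm_square_Basis[OF g g2 e] in \<open>auto intro!: continuous_intros cx\<close>)
  have n: "(norm y)\<^sup>2 = (\<Sum>e\<in>Basis. (inner y e)\<^sup>2)" for y :: 'a
    by (simp add: norm_eq_sqrt_inner euclidean_inner[of y y] power2_eq_square sum_nonneg)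
  have i1: "set_integrable lborel {a..b} (\<lambda>t. h t * (inner (x t) e)\<^sup>2)" for e
    by (rule borel_integrable_atLeastAtMost') (intro continuous_intros h cx)
  have "(LINT t:{a..b}|lborel. h t * (norm (x t))\<^sup>2) = (\<Sum>e\<in>Basis. LINT t:{a..b}|lborel. h t * (inner (x t) e)\<^sup>2)"
    unfolding n sum_distrib_left set_lebesgue_integral_def scaleR_sum_right
    by (rule Bochner_Integration.integral_sum) (use i1 in \<open>auto simp: set_integrable_def\<close>)
  moreover have "(LINT t:{a..b}|lborel. (norm (g t))\<^sup>2) = (\<Sum>e\<in>Basis. LINT t:{a..b}|lborel. (inner (g t) e)\<^sup>2)"
    unfolding n set_lebesgue_integral_def scaleR_sum_right
    by (rule Bochner_Integration.integral_sum)
      (use set_integrable_norm_square_Basis[OF g g2] in \<open>auto simp: set_integrable_def\<close>)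
  ultimately show ?thesis
    using sum_mono[of Basis, OF comp]
    by (simp add: n sum.distrib sum_subtractf sum_distrib_left)
qed

section \<open>Radial collision orbits\<close>

fun sin_primitive :: "nat \<Rightarrow> real \<Rightarrow> real" where
  "sin_primitive 0 x = x"
| "sin_primitive (Suc 0) x = 1 - cos x"
| "sin_primitive (Suc (Suc n)) x =
    (real (Suc n) * sin_primitive n x - sin x ^ Suc n * cos x) / real (Suc (Suc n))"

lemma sin_primitive_0 [simp]: "sin_primitive n 0 = 0"
  by (induction n "0::real" rule: sin_primitive.induct) auto

text \<open>The recursion of \<open>sin_primitive\<close> is the reduction formula of integration by
  parts; the constants are such that every primitive vanishes at 0.\<close>

lemma sin_primitive_deriv: "(sin_primitive n has_real_derivative sin x ^ n) (at x)"
proof (induction n x rule: sin_primitive.induct)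
  case (3 n x)
  have "((\<lambda>x. (real (Suc n) * sin_primitive n x - sin x ^ Suc n * cos x) / real (Suc (Suc n)))
      has_real_derivative (real (Suc n) * sin x ^ n
        - (real (Suc n) * sin x ^ n * cos x * cos x + sin x ^ Suc n * (- sin x))) / real (Suc (Suc n))) (at x)"
    by (rule derivative_eq_intros 3 refl | simp)+
  moreover have "(real (Suc n) * sin x ^ n
        - (real (Suc n) * sin x ^ n * cos x * cos x + sin x ^ Suc n * (- sin x))) / real (Suc (Suc n))
      = sin x ^ Suc (Suc n)"
  proof -
    have c: "cos x * cos x = 1 - sin x * sin x"
      using sin_cos_squared_add[of x] by (simp add: power2_eq_square)
    have "real (Suc n) * sin x ^ n - (real (Suc n) * sin x ^ n * (cos x * cos x) + sin x ^ Suc n * (- sin x))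
        = real (Suc (Suc n)) * sin x ^ Suc (Suc n)"
      unfolding c by (simp add: algebra_simps)
    then show ?thesis by (simp add: mult.assoc)
  qed
  ultimately show ?case
    by (simp add: fun_eq_iff[symmetric])
qed (auto intro!: derivative_eq_intros)

lemmas sin_primitive_deriv' [derivative_intros] = DERIV_chain2[OF sin_primitive_deriv]

lemma continuous_on_sin_primitive: "continuous_on A (sin_primitive n)"
  by (rule DERIV_continuous_on) (rule has_field_derivative_at_within[OF sin_primitive_deriv])

text \<open>These are the Wallis integrals, taken over a half period.\<close>

definition sin_integral :: "nat \<Rightarrow> real" where
  "sin_integral n = sin_primitive n pi"

lemma sin_integral_Suc_Suc:
  "sin_integral (Suc (Suc n)) = real (Suc n) / real (Suc (Suc n)) * sin_integral n"
  by (simp add: sin_integral_def)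

lemma sin_integral_mult: "sin_integral n * sin_integral (Suc n) = 2 * pi / real (Suc n)"
proof (induction n)
  case (Suc n)
  have "sin_integral (Suc n) * sin_integral (Suc (Suc n))
      = (sin_integral n * sin_integral (Suc n)) * (real (Suc n) / real (Suc (Suc n)))"
    by (simp add: sin_integral_Suc_Suc)
  also have "\<dots> = 2 * pi / real (Suc (Suc n))"
    unfolding Suc by simp
  finally show ?case .
qed (simp add: sin_integral_def)

lemma sin_primitive_mono:
  assumes "0 \<le> a" "a \<le> b" "b \<le> pi"
  shows "sin_primitive n a \<le> sin_primitive n b"
proof (rule DERIV_nonneg_imp_nondecreasing[OF assms(2)])
  fix x assume "a \<le> x" "x \<le> b"
  then have "0 \<le> sin x ^ n" using assms by (intro zero_le_power sin_ge_zero) auto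
  then show "\<exists>y. (sin_primitive n has_real_derivative y) (at x) \<and> 0 \<le> y"
    using sin_primitive_deriv by blast
qed

lemma sin_primitive_strict_mono:
  assumes "0 \<le> a" "a < b" "b \<le> pi"
  shows "sin_primitive n a < sin_primitive n b"
proof (rule DERIV_pos_imp_increasing_open[OF assms(2)])
  fix x assume "a < x" "x < b"
  then have "0 < sin x ^ n" using assms by (intro zero_less_power sin_gt_zero) auto
  then show "\<exists>y. (sin_primitive n has_real_derivative y) (at x) \<and> 0 < y"
    using sin_primitive_deriv by blast
qed (rule continuous_on_sin_primitive)

lemma sin_integral_pos: "0 < sin_integral n"
  using sin_primitive_strict_mono[of 0 pi n] by (simp add: sin_integral_def)

lemma sin_integral_Suc_le: "sin_integral (Suc n) \<le> sin_integral n"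
proof -
  have "sin_primitive n 0 - sin_primitive (Suc n) 0 \<le> sin_primitive n pi - sin_primitive (Suc n) pi"
  proof (rule DERIV_nonneg_imp_nondecreasing[where f = "\<lambda>x. sin_primitive n x - sin_primitive (Suc n) x"])
    fix x :: real assume x: "0 \<le> x" "x \<le> pi"
    have "((\<lambda>x. sin_primitive n x - sin_primitive (Suc n) x) has_real_derivative sin x ^ n - sin x ^ Suc n) (at x)"
      by (intro derivative_intros sin_primitive_deriv)
    moreover have "0 \<le> sin x ^ n - sin x ^ Suc n"
      using x sin_ge_zero[of x] by (simp add: mult_left_le_one_le)
    ultimately show "\<exists>y. ((\<lambda>x. sin_primitive n x - sin_primitive (Suc n) x) has_real_derivative y) (at x) \<and> 0 \<le> y"
      by blast
  qed simp
  then show ?thesis by (simp add: sin_integral_def)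
qed

text \<open>By monotonicity the square is at least the product of two neighbouring Wallis integrals,
  which has a closed form. Through \<open>collision_const\<close> this bounds the collision level
  from below for all \<open>n\<close>.\<close>

lemma sin_integral_square_ge: "2 * pi / real (Suc n) \<le> (sin_integral n)\<^sup>2"
  using mult_left_mono[OF sin_integral_Suc_le[of n], of "sin_integral n"] sin_integral_pos[of n]
  by (simp add: sin_integral_mult power2_eq_square)

text \<open>For the orbit this becomes \<open>t * P t \<le> 1\<close>. Up to pi / 2 the difference
  of the two sides increases from 0; afterwards the cosine is nonpositive and the signs
  decide.\<close>

lemma sin_primitive_le:
  assumes "0 \<le> x" "x \<le> pi"
  shows "real n * cos x * sin_primitive n x \<le> sin x ^ Suc n"
proof (cases "x \<le> pi / 2")
  case True
  have "sin 0 ^ Suc n - real n * cos 0 * sin_primitive n 0 \<le> sin x ^ Suc n - real n * cos x * sin_primitive n x"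
  proof (rule DERIV_nonneg_imp_nondecreasing[OF assms(1), where f = "\<lambda>x. sin x ^ Suc n - real n * cos x * sin_primitive n x"])
    fix y assume y: "0 \<le> y" "y \<le> x"
    have "((\<lambda>x. sin x ^ Suc n - real n * cos x * sin_primitive n x) has_real_derivative
        sin y ^ n * cos y + real n * sin y * sin_primitive n y) (at y)"
      by (rule derivative_eq_intros refl | simp add: algebra_simps)+
    moreover have "0 \<le> sin y ^ n * cos y + real n * sin y * sin_primitive n y"
      using y True sin_primitive_mono[of 0 y n]
      by (intro add_nonneg_nonneg mult_nonneg_nonneg zero_le_power sin_ge_zero cos_ge_zero) auto
    ultimately show "\<exists>z. ((\<lambda>x. sin x ^ Suc n - real n * cos x * sin_primitive n x) has_real_derivative z) (at y) \<and> 0 \<le> z"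
      by blast
  qed
  then show ?thesis by simp
next
  case False
  have "cos x \<le> 0"
    using False assms cos_monotone_0_pi_le[of "pi / 2" x] by simp
  then have "real n * cos x * sin_primitive n x \<le> 0"
    using sin_primitive_mono[of 0 x n] assms by (simp add: mult_nonneg_nonpos mult_nonpos_nonneg)
  also have "0 \<le> sin x ^ Suc n"
    using assms by (intro zero_le_power sin_ge_zero)
  finally show ?thesis .
qed

text \<open>The reflection of the previous bound at pi / 2; for the orbit it controls
  \<open>P\<close> before the second collision.\<close>

lemma sin_primitive_ge:
  assumes "0 \<le> x" "x \<le> pi"
  shows "- (real n * cos x * (sin_integral n - sin_primitive n x)) \<le> sin x ^ Suc n"
proof (cases "x \<le> pi / 2")
  case False
  have "sin pi ^ Suc n + real n * cos pi * (sin_integral n - sin_primitive n pi)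
      \<le> sin x ^ Suc n + real n * cos x * (sin_integral n - sin_primitive n x)"
  proof (rule DERIV_nonpos_imp_nonincreasing[OF assms(2), where f = "\<lambda>x. sin x ^ Suc n + real n * cos x * (sin_integral n - sin_primitive n x)"])
    fix y assume y: "x \<le> y" "y \<le> pi"
    have "((\<lambda>x. sin x ^ Suc n + real n * cos x * (sin_integral n - sin_primitive n x)) has_real_derivative
        sin y ^ n * cos y - real n * sin y * (sin_integral n - sin_primitive n y)) (at y)"
      by (rule derivative_eq_intros refl | simp add: algebra_simps)+
    moreover have "sin y ^ n * cos y - real n * sin y * (sin_integral n - sin_primitive n y) \<le> 0"
    proof -
      have "cos y \<le> 0" using False y cos_monotone_0_pi_le[of "pi / 2" y] by simp
      moreover have "0 \<le> sin y" using False y assms by (intro sin_ge_zero) auto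
      moreover have "0 \<le> sin_integral n - sin_primitive n y"
        using sin_primitive_mono[of y pi n] y assms by (simp add: sin_integral_def)
      ultimately have "sin y ^ n * cos y \<le> 0" "0 \<le> real n * sin y * (sin_integral n - sin_primitive n y)"
        by (simp_all add: mult_nonneg_nonpos)
      then show ?thesis by linarith
    qed
    ultimately show "\<exists>z. ((\<lambda>x. sin x ^ Suc n + real n * cos x * (sin_integral n - sin_primitive n x)) has_real_derivative z) (at y) \<and> z \<le> 0"
      by blast
  qed
  then show ?thesis by (simp add: sin_integral_def)
next
  case True
  have "0 \<le> cos x" using True assms by (intro cos_ge_zero) auto
  moreover have "0 \<le> sin_integral n - sin_primitive n x"
    using sin_primitive_mono[of x pi n] assms by (simp add: sin_integral_def)
  ultimately have "0 \<le> real n * cos x * (sin_integral n - sin_primitive n x)" by simp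
  moreover have "0 \<le> sin x ^ Suc n"
    using assms by (intro zero_le_power sin_ge_zero)
  ultimately show ?thesis by linarith
qed

text \<open>
  A radial collision orbit of exponent \<open>2/n\<close> between two collisions at distance \<open>\<pi>\<close> is
  \<open>\<rho> = sin\<^sup>n \<theta>\<close>, where the time is proportional to the primitive of \<open>sin\<^sup>n \<theta>\<close>.  Here \<open>P\<close> is the
  logarithmic derivative of \<open>\<rho>\<close> and \<open>q = 1 / sin\<^sup>2 \<theta>\<close> has the primitive \<open>G\<close>.
\<close>

definition collision_const :: "nat \<Rightarrow> real" where
  "collision_const n = real n * (sin_integral n)\<^sup>2 / pi\<^sup>2"

text \<open>For the exponent 2/n, the \<open>n\<close>-th root of this number is the mean of
  r^(-2/n) along the radial collision orbit, scaled to mean squared speed 1. The factor n / (n - 1)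
  is the mean of \<open>q\<close>.\<close>

definition collision_level :: "nat \<Rightarrow> real" where
  "collision_level n = collision_const n * (real n / (real n - 1)) ^ Suc n"

lemma collision_const_pos: "0 < n \<Longrightarrow> 0 < collision_const n"
  using sin_integral_pos[of n] by (simp add: collision_const_def)

lemma collision_level_pos: "2 \<le> n \<Longrightarrow> 0 < collision_level n"
  unfolding collision_level_def by (intro mult_pos_pos collision_const_pos zero_less_power) auto

text \<open>The last two pointwise conditions say that \<open>P\<close> is at most 1 / t and at
  least -1 / (pi - t). They tame the boundary terms near the collisions, where \<open>P\<close> is
  unbounded.\<close>

definition collision_orbit :: "nat \<Rightarrow> (real \<Rightarrow> real) \<Rightarrow> (real \<Rightarrow> real) \<Rightarrow> (real \<Rightarrow> real) \<Rightarrow> bool" where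
  "collision_orbit n P q G \<longleftrightarrow>
    (\<forall>t\<in>{0<..<pi}. 0 < q t \<and> isCont q t
       \<and> (P has_real_derivative - (collision_const n * q t ^ Suc n) - (P t)\<^sup>2) (at t)
       \<and> (G has_real_derivative q t) (at t)
       \<and> t * P t \<le> 1 \<and> - ((pi - t) * P t) \<le> 1)
    \<and> continuous_on {0..pi} G \<and> G pi - G 0 = pi * real n / (real n - 1)"

text \<open>The orbit is explicit in the angle, and the time \<open>T\<close> is normalized to run
  from 0 to pi. Its derivative vanishes at the collisions, but \<open>T\<close> is strictly
  monotone, so the angle is a continuous function of the time and differentiable in between.\<close>

lemma collision_orbit_exists:
  assumes n: "2 \<le> n"
  shows "\<exists>P q G. collision_orbit n P q G"
proof -
  define S where "S = sin_integral n"
  have S: "0 < S" by (simp add: S_def sin_integral_pos)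
  define T where "T x = pi / S * sin_primitive n x" for x
  have dT: "(T has_real_derivative pi / S * sin x ^ n) (at x)" for x
    unfolding T_def by (intro DERIV_cmult sin_primitive_deriv)
  have cT: "continuous_on {0..pi} T"
    unfolding T_def by (intro continuous_intros continuous_on_sin_primitive)
  have T0: "T 0 = 0" and Tpi: "T pi = pi"
    using S by (simp_all add: T_def S_def sin_integral_def)
  have Tmono: "T a < T b" if "0 \<le> a" "a < b" "b \<le> pi" for a b
    using sin_primitive_strict_mono[OF that, of n] S by (simp add: T_def divide_strict_right_mono)
  have inj: "inj_on T {0..pi}"
    by (intro inj_onI) (metis Tmono atLeastAtMost_iff less_irrefl linorder_neqE_linordered_idom)
  have img: "T ` {0..pi} = {0..pi}"
  proof (intro equalityI subsetI)
    fix y assume "y \<in> T ` {0..pi}"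
    then obtain x where x: "x \<in> {0..pi}" "y = T x" by blast
    have "T 0 \<le> T x" "T x \<le> T pi"
      using x Tmono[of 0 x] Tmono[of x pi] by (cases "x = 0"; cases "x = pi"; auto)+
    then show "y \<in> {0..pi}" using x T0 Tpi by simp
  next
    fix y assume "y \<in> {0..pi}"
    then obtain x where "0 \<le> x" "x \<le> pi" "T x = y"
      using IVT'[of T 0 y pi] cT T0 Tpi by auto
    then show "y \<in> T ` {0..pi}" by auto
  qed
  define \<Theta> where "\<Theta> = inv_into {0..pi} T"
  have \<Theta>T: "\<Theta> (T x) = x" if "x \<in> {0..pi}" for x
    unfolding \<Theta>_def using inj that by (rule inv_into_f_f)
  have T\<Theta>: "T (\<Theta> t) = t" and \<Theta>in: "\<Theta> t \<in> {0..pi}" if "t \<in> {0..pi}" for t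
    unfolding \<Theta>_def using f_inv_into_f[of t T "{0..pi}"] inv_into_into[of t T "{0..pi}"] that
    unfolding img by auto
  have c\<Theta>: "continuous_on {0..pi} \<Theta>"
    using continuous_on_inv[OF cT compact_Icc, of \<Theta>] \<Theta>T by (simp add: img)
  have \<Theta>0: "\<Theta> 0 = 0" and \<Theta>pi: "\<Theta> pi = pi"
    using \<Theta>T[of 0] \<Theta>T[of pi] T0 Tpi by auto
  have \<Theta>o: "0 < \<Theta> t" "\<Theta> t < pi" if t: "t \<in> {0<..<pi}" for t
    using \<Theta>in[of t] T\<Theta>[of t] T0 Tpi t by (auto simp: less_le)
  have s: "0 < sin (\<Theta> t)" if t: "t \<in> {0<..<pi}" for t
    using \<Theta>o[OF t] by (rule sin_gt_zero)
  have d\<Theta>: "(\<Theta> has_real_derivative S / (pi * sin (\<Theta> t) ^ n)) (at t)" if t: "t \<in> {0<..<pi}" for t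
  proof -
    have "(\<Theta> has_real_derivative inverse (pi / S * sin (\<Theta> t) ^ n)) (at t)"
    proof (rule DERIV_inverse_function[where a = 0 and b = pi])
      show "(T has_real_derivative pi / S * sin (\<Theta> t) ^ n) (at (\<Theta> t))" by (rule dT)
      show "pi / S * sin (\<Theta> t) ^ n \<noteq> 0" using s[OF t] S by simp
      show "isCont \<Theta> t"
        using continuous_on_interior[OF c\<Theta>] t by simp
    qed (use t T\<Theta> in auto)
    then show ?thesis using S s[OF t] by (simp add: field_simps)
  qed
  \<comment> \<open>The time derivative of ln sin^n \<Theta>, namely n cot \<Theta> times the
    derivative of \<Theta>.\<close>
  define P where "P t = real n * S / pi * (cos (\<Theta> t) / sin (\<Theta> t) ^ Suc n)" for t
  define q where "q t = 1 / (sin (\<Theta> t))\<^sup>2" for t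
  \<comment> \<open>Dividing sin^(n - 2) by the sin^n of the time change leaves 1 / sin^2, so the
    primitive of \<open>q\<close> is again a \<open>sin_primitive\<close>. This is where 2 \<le> n
    enters.\<close>
  define G where "G t = pi / S * sin_primitive (n - 2) (\<Theta> t)" for t
  have "collision_orbit n P q G"
    unfolding collision_orbit_def
  proof (intro conjI ballI)
    fix t assume t: "t \<in> {0<..<pi}"
    define x where "x = sin (\<Theta> t)"
    define y where "y = cos (\<Theta> t)"
    have x: "0 < x" using s[OF t] by (simp add: x_def)
    have xy: "y\<^sup>2 = 1 - x\<^sup>2" by (simp add: x_def y_def cos_squared_eq)
    show "0 < q t" using s[OF t] by (simp add: q_def)
    have "isCont \<Theta> t" using d\<Theta>[OF t] by (rule DERIV_isCont)
    then show "isCont q t"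
      unfolding q_def using s[OF t] by (intro continuous_intros) auto
    show "(P has_real_derivative - (collision_const n * q t ^ Suc n) - (P t)\<^sup>2) (at t)"
    proof -
      have "(P has_real_derivative real n * S / pi *
          (((- x * (S / (pi * x ^ n))) * x ^ Suc n - y * (real (Suc n) * x ^ n * (y * (S / (pi * x ^ n)))))
            / (x ^ Suc n * x ^ Suc n))) (at t)"
      proof -
        define d where "d = S / (pi * x ^ n)"
        have "((\<lambda>t. sin (\<Theta> t)) has_real_derivative y * d) (at t)"
          "((\<lambda>t. cos (\<Theta> t)) has_real_derivative - x * d) (at t)"
          using DERIV_chain2[OF DERIV_sin d\<Theta>[OF t]] DERIV_chain2[OF DERIV_cos d\<Theta>[OF t]]
          unfolding d_def x_def y_def by simp_all
        note DERIV_cmult[OF DERIV_divide[OF this(2) DERIV_power_Suc[OF this(1)]], of n "real n * S / pi"]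
        then show ?thesis
          using x unfolding P_def d_def[symmetric] by (simp add: x_def[symmetric] y_def[symmetric] ac_simps)
      qed
      moreover have "real n * S / pi *
          (((- x * (S / (pi * x ^ n))) * x ^ Suc n - y * (real (Suc n) * x ^ n * (y * (S / (pi * x ^ n)))))
            / (x ^ Suc n * x ^ Suc n)) = - (collision_const n * q t ^ Suc n) - (P t)\<^sup>2"
      proof -
        define z where "z = x ^ n"
        have z: "0 < z" using x by (simp add: z_def)
        have q: "q t ^ Suc n = 1 / (x * x * (z * z))"
          using x by (simp add: q_def x_def[symmetric] z_def power_divide power2_eq_square power_mult_distrib field_simps)
        have e1: "real n * S / pi *
          (((- x * (S / (pi * z))) * (x * z) - y * (real (Suc n) * z * (y * (S / (pi * z)))))
            / ((x * z) * (x * z))) = real n * S\<^sup>2 / pi\<^sup>2 * ((- (x\<^sup>2) - real (Suc n) * y\<^sup>2) / (x * x * (z * z)))"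
          using x z by (simp add: power2_eq_square field_simps)
        have e2: "(P t)\<^sup>2 = (real n)\<^sup>2 * S\<^sup>2 / pi\<^sup>2 * (y\<^sup>2 / (x * x * (z * z)))"
        proof -
          have Pt: "P t = real n * S / pi * (y / (x * z))"
            by (simp add: P_def x_def[symmetric] y_def[symmetric] z_def)
          show ?thesis
            unfolding Pt using x z by (simp add: power2_eq_square field_simps)
        qed
        show ?thesis
          unfolding power_Suc z_def[symmetric] e1 e2 q[unfolded power_Suc] collision_const_def S_def[symmetric] xy
          using x z by (simp add: power2_eq_square field_simps)
      qed
      ultimately show ?thesis by simp
    qed
    show "(G has_real_derivative q t) (at t)"
    proof -
      have "(G has_real_derivative pi / S * (x ^ (n - 2) * (S / (pi * x ^ n)))) (at t)"
        using DERIV_cmult[OF DERIV_chain2[OF sin_primitive_deriv d\<Theta>[OF t]], of "pi / S" "n - 2"]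
        unfolding G_def x_def .
      moreover have "x ^ n = x ^ (n - 2) * x\<^sup>2"
        using n by (metis le_add_diff_inverse2 power_add)
      ultimately show ?thesis
        using S x by (simp add: q_def x_def[symmetric])
    qed
    have Tt: "t = pi / S * sin_primitive n (\<Theta> t)"
      using T\<Theta>[of t] t by (simp add: T_def)
    have Tt': "pi - t = pi / S * (S - sin_primitive n (\<Theta> t))"
      using S arg_cong[OF Tt, of "\<lambda>t. pi - t"] by (simp add: field_simps)
    have Pt: "P t = real n * S / pi * (y / x ^ Suc n)"
      by (simp add: P_def x_def y_def)
    have cancel: "pi / S * u * (real n * S / pi * (y / w)) = real n * y * u / w" for u w
      using S by simp
    have in0: "0 \<le> \<Theta> t" "\<Theta> t \<le> pi" using \<Theta>o[OF t] by auto
    have "t * P t = real n * y * sin_primitive n (\<Theta> t) / x ^ Suc n"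
      using cancel[of "sin_primitive n (\<Theta> t)" "x ^ Suc n"] unfolding Pt Tt[symmetric] .
    also have "\<dots> \<le> 1"
      using sin_primitive_le[OF in0, of n] x by (simp add: x_def y_def divide_le_eq)
    finally show "t * P t \<le> 1" .
    have "- ((pi - t) * P t) = - (real n * y * (S - sin_primitive n (\<Theta> t))) / x ^ Suc n"
      using cancel[of "S - sin_primitive n (\<Theta> t)" "x ^ Suc n"] unfolding Pt Tt'[symmetric]
      by (simp only: minus_divide_left)
    also have "\<dots> \<le> 1"
      using sin_primitive_ge[OF in0, of n] zero_less_power[OF x, of "Suc n"]
      by (subst pos_divide_le_eq) (simp_all only: x_def y_def S_def mult_1)
    finally show "- ((pi - t) * P t) \<le> 1" .
  next
    show "continuous_on {0..pi} G"
      unfolding G_def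
      by (intro continuous_intros continuous_on_compose2[OF continuous_on_sin_primitive[of UNIV]] c\<Theta>) auto
    obtain k where k: "n = Suc (Suc k)" using n by (metis add_2_eq_Suc le_Suc_ex)
    \<comment> \<open>The Wallis recursion is what makes the mean of \<open>q\<close> equal to n /
      (n - 1).\<close>
    have "sin_integral (n - 2) = S * (real n / (real n - 1))"
      unfolding S_def k sin_integral_Suc_Suc by simp
    then show "G pi - G 0 = pi * real n / (real n - 1)"
      using S by (simp add: G_def \<Theta>0 \<Theta>pi sin_integral_def[symmetric])
  qed
  then show ?thesis by blast
qed

section \<open>The action of a loop with collisions\<close>

lemma curve_floor: "curve x t = curve x (t - 2 * pi * of_int \<lfloor>t / (2 * pi)\<rfloor>)"
proof -
  have n: "curve x (t + 2 * pi * real n) = curve x t" for t n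
  proof (induction n)
    case (Suc n)
    have "t + 2 * pi * real (Suc n) = (t + 2 * pi * real n) + 2 * pi"
      by (simp add: algebra_simps)
    then show ?case using Suc by (simp only: curve_periodic)
  qed simp
  define k where "k = \<lfloor>t / (2 * pi)\<rfloor>"
  have "curve x t = curve x (t - 2 * pi * of_int k)"
  proof (cases "0 \<le> k")
    case True
    then show ?thesis using n[of "t - 2 * pi * of_int k" "nat k"] by simp
  next
    case False
    then show ?thesis using n[of t "nat (- k)"] by simp
  qed
  then show ?thesis by (simp add: k_def)
qed

text \<open>Continuity is known on one period. The loop is a composition of a continuous function,
  obtained by clamping the time to that period, with the measurable reduction modulo the
  period.\<close>

lemma curve_measurable [measurable]: "curve x \<in> borel_measurable borel"
proof -
  define y where "y t = curve x (max 0 (min t (2 * pi)))" for t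
  have "continuous_on UNIV y"
    unfolding y_def by (rule continuous_on_compose2[OF continuous_on_curve]) (auto intro!: continuous_intros)
  then have [measurable]: "y \<in> borel_measurable borel"
    by (rule borel_measurable_continuous_onI)
  have "curve x t = y (t - 2 * pi * of_int \<lfloor>t / (2 * pi)\<rfloor>)" for t
  proof -
    have "of_int \<lfloor>t / (2 * pi)\<rfloor> * (2 * pi) \<le> t" "t < (of_int \<lfloor>t / (2 * pi)\<rfloor> + 1) * (2 * pi)"
      by (simp_all flip: pos_le_divide_eq pos_divide_less_eq)
    then have "0 \<le> t - 2 * pi * of_int \<lfloor>t / (2 * pi)\<rfloor>" "t - 2 * pi * of_int \<lfloor>t / (2 * pi)\<rfloor> \<le> 2 * pi"
      by (simp_all add: algebra_simps)
    then show ?thesis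
      unfolding y_def by (subst curve_floor) (simp add: max_def min_def)
  qed
  then show ?thesis
    by (subst ext[of "curve x" "\<lambda>t. y (t - 2 * pi * of_int \<lfloor>t / (2 * pi)\<rfloor>)"]) measurable
qed

text \<open>Since \<open>0 powr a\<close> is 0, the infinite value at a collision has to be set
  apart.\<close>

definition power_potential :: "real \<Rightarrow> real \<Rightarrow> ennreal" where
  "power_potential \<alpha> r = (if r = 0 then \<infinity> else ennreal (r powr (- \<alpha>)))"

lemma power_potential_measurable [measurable]: "power_potential \<alpha> \<in> borel_measurable borel"
  unfolding power_potential_def by measurable

definition loop_potential :: "real \<Rightarrow> 'a::euclidean_space h1loop \<Rightarrow> ennreal" where
  "loop_potential \<alpha> y = (\<integral>\<^sup>+t\<in>{0..2 * pi}. power_potential \<alpha> (norm (curve y t)) \<partial>lborel)"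

text \<open>The tangent at \<open>y = 1\<close>, composed from the tangent of the exponential at 0
  and that of the logarithm at 1.\<close>

lemma powr_neg_ge_tangent:
  fixes n y :: real
  assumes y: "0 < y" and n: "0 < n"
  shows "1 + 1 / n - y / n \<le> y powr (- (1 / n))"
proof -
  have "1 - ln y / n \<le> y powr (- (1 / n))"
    using exp_ge_add_one_self[of "- (ln y / n)"] y by (simp add: powr_def)
  moreover have "ln y / n \<le> (y - 1) / n"
    using ln_le_minus_one[OF y] n by (simp add: divide_right_mono)
  ultimately show ?thesis
    by (simp add: diff_divide_distrib)
qed

text \<open>Bernoulli's inequality for real exponents: the tangent of the convex power at
  \<open>X = 1\<close>.\<close>

lemma powr_ge_tangent:
  fixes p X :: real
  assumes X: "0 < X" and p: "1 \<le> p"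
  shows "1 + p * (X - 1) \<le> X powr p"
proof -
  have "X * (1 + (p - 1) * ln X) \<le> X * X powr (p - 1)"
    using exp_ge_add_one_self[of "(p - 1) * ln X"] X by (intro mult_left_mono) (auto simp: powr_def)
  also have "\<dots> = X powr p"
    using X by (simp add: powr_diff)
  finally have "X + (p - 1) * (X * ln X) \<le> X powr p"
    by (simp add: algebra_simps)
  moreover have "X - 1 \<le> X * ln X"
  proof -
    have "1 - 1 / X \<le> ln X"
      using ln_le_minus_one[of "1 / X"] X by (simp add: ln_div)
    then show ?thesis
      using mult_left_mono[of "1 - 1 / X" "ln X" X] X by (simp add: right_diff_distrib)
  qed
  then have "(p - 1) * (X - 1) \<le> (p - 1) * (X * ln X)"
    using p by (intro mult_left_mono) auto
  ultimately show ?thesis by (simp add: algebra_simps)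
qed

text \<open>
  The first step linearizes \<open>r \<mapsto> r\<^sup>-\<^sup>2\<^sup>/\<^sup>n\<close> as a function of \<open>r\<^sup>2\<close> at the radius of the comparison orbit,
  the second one linearizes the power \<open>n \<beta> \<ge> 1\<close> that leads to the exponent \<open>2 \<beta>\<close>.
\<close>

lemma potential_ge_quadratic:
  fixes r q \<kappa> \<beta> :: real and n :: nat
  assumes r: "0 < r" and q: "0 < q" and \<kappa>: "0 < \<kappa>" and n: "2 \<le> n" and \<beta>: "1 \<le> real n * \<beta>"
  shows "(collision_level n / \<kappa>\<^sup>2) powr \<beta> * (1 - real n * \<beta> + (real n + 1) * \<beta> * ((real n - 1) / real n) * q
      - \<beta> / \<kappa>\<^sup>2 * (collision_const n * q ^ Suc n * r\<^sup>2)) \<le> r powr (- (2 * \<beta>))"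
proof -
  define c where "c = collision_const n"
  define \<mu> where "\<mu> = real n / (real n - 1)"
  define \<Lambda> where "\<Lambda> = collision_level n"
  have c: "0 < c" using n by (simp add: c_def collision_const_pos)
  have \<mu>: "0 < \<mu>" using n by (simp add: \<mu>_def)
  have \<Lambda>: "0 < \<Lambda>" using n by (simp add: \<Lambda>_def collision_level_pos)
  have \<Lambda>eq: "\<Lambda> = c * \<mu> ^ Suc n" by (simp add: \<Lambda>_def collision_level_def c_def \<mu>_def)
  \<comment> \<open>The square of \<open>r\<close> relative to that of the comparison radius: sin^n
    squared is 1 / q^n, and \<kappa>^2 / (c \<mu>) is the squared amplitude.\<close>
  define y where "y = r\<^sup>2 * c * \<mu> * q ^ n / \<kappa>\<^sup>2"
  have y: "0 < y" using r c \<mu> q \<kappa> by (simp add: y_def)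
  \<comment> \<open>This is r^(-2/n) relative to its mean along the comparison orbit. Both tangents
    are taken at 1, so nothing is lost there if the exponent is 2/n and the loop is the comparison
    orbit.\<close>
  define X where "X = (\<kappa>\<^sup>2 / (r\<^sup>2 * \<Lambda>)) powr (1 / real n)"
  have X: "0 < X" using r \<kappa> \<Lambda> by (simp add: X_def)
  have "\<kappa>\<^sup>2 / (r\<^sup>2 * \<Lambda>) = (q / \<mu>) ^ n * (1 / y)"
    using r c \<mu> q \<kappa> by (simp add: y_def \<Lambda>eq power_divide field_simps)
  then have "X = ((q / \<mu>) ^ n * (1 / y)) powr (1 / real n)"
    by (simp only: X_def)
  also have "\<dots> = ((q / \<mu>) ^ n) powr (1 / real n) * (1 / y) powr (1 / real n)"
    by (rule powr_mult)
  also have "((q / \<mu>) ^ n) powr (1 / real n) = q / \<mu>"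
    using q \<mu> n by (simp add: powr_realpow[symmetric] powr_powr)
  also have "(1 / y) powr (1 / real n) = y powr (- (1 / real n))"
    using y by (simp add: powr_minus powr_divide inverse_eq_divide)
  finally have Xy: "X = q / \<mu> * y powr (- (1 / real n))" .
  have "q / \<mu> * (1 + 1 / real n - y / real n) \<le> X"
    unfolding Xy using powr_neg_ge_tangent[OF y, of "real n"] n q \<mu> by (intro mult_left_mono) auto
  then have "real n * \<beta> * (q / \<mu> * (1 + 1 / real n - y / real n)) \<le> real n * \<beta> * X"
    using \<beta> by (intro mult_left_mono) auto
  also have "1 - real n * \<beta> + \<dots> \<le> X powr (real n * \<beta>)"
    using powr_ge_tangent[OF X \<beta>] by (simp add: algebra_simps)
  finally have 1: "1 - real n * \<beta> + real n * \<beta> * (q / \<mu> * (1 + 1 / real n - y / real n)) \<le> X powr (real n * \<beta>)"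
    by simp
  have e1: "real n * \<beta> * (q / \<mu> * (1 + 1 / real n - y / real n))
      = (real n + 1) * \<beta> * ((real n - 1) / real n) * q - \<beta> * (q / \<mu> * y)"
    using n by (simp add: \<mu>_def field_simps)
  have e2: "q / \<mu> * y = c * q ^ Suc n * r\<^sup>2 / \<kappa>\<^sup>2"
    using \<mu> by (simp add: y_def)
  have e3: "X powr (real n * \<beta>) = r powr (- (2 * \<beta>)) / (\<Lambda> / \<kappa>\<^sup>2) powr \<beta>"
  proof -
    have "X powr (real n * \<beta>) = (r powr (- 2) * (1 / (\<Lambda> / \<kappa>\<^sup>2))) powr \<beta>"
      using n r by (simp add: X_def powr_powr powr_minus_divide)
    also have "\<dots> = r powr (- (2 * \<beta>)) / (\<Lambda> / \<kappa>\<^sup>2) powr \<beta>"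
      using r \<Lambda> \<kappa> by (simp add: powr_mult powr_powr powr_divide)
    finally show ?thesis .
  qed
  have "1 - real n * \<beta> + ((real n + 1) * \<beta> * ((real n - 1) / real n) * q
      - \<beta> * (c * q ^ Suc n * r\<^sup>2 / \<kappa>\<^sup>2)) \<le> r powr (- (2 * \<beta>)) / (\<Lambda> / \<kappa>\<^sup>2) powr \<beta>"
    using 1 unfolding e1 e2 e3 .
  then have "(1 - real n * \<beta> + ((real n + 1) * \<beta> * ((real n - 1) / real n) * q
      - \<beta> * (c * q ^ Suc n * r\<^sup>2 / \<kappa>\<^sup>2))) * (\<Lambda> / \<kappa>\<^sup>2) powr \<beta> \<le> r powr (- (2 * \<beta>))"
    using \<Lambda> \<kappa> by (subst (asm) pos_le_divide_eq) auto
  then show ?thesis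
    by (simp add: c_def \<Lambda>_def algebra_simps)
qed

text \<open>The minorant \<open>f\<close> may be negative, where \<open>ennreal\<close> cuts it off
  at 0; hence the passage through \<open>max 0\<close>.\<close>

lemma ennreal_integral_le_nn_integral:
  fixes f :: "real \<Rightarrow> real"
  assumes f: "set_integrable lborel A f" and le: "\<And>t. t \<in> A \<Longrightarrow> ennreal (f t) \<le> F t"
  shows "ennreal (LINT t:A|lborel. f t) \<le> (\<integral>\<^sup>+t\<in>A. F t \<partial>lborel)"
proof -
  have i: "integrable lborel (\<lambda>t. indicator A t *\<^sub>R f t)" using f by (simp add: set_integrable_def)
  have "ennreal (LINT t:A|lborel. f t) \<le> ennreal (LINT t|lborel. max 0 (indicator A t *\<^sub>R f t))"
    unfolding set_lebesgue_integral_def using i by (intro ennreal_leI integral_mono) auto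
  also have "\<dots> = (\<integral>\<^sup>+t. ennreal (max 0 (indicator A t *\<^sub>R f t)) \<partial>lborel)"
    using i by (intro nn_integral_eq_integral[symmetric]) auto
  also have "\<dots> \<le> (\<integral>\<^sup>+t\<in>A. F t \<partial>lborel)"
    using le by (intro nn_integral_mono) (auto simp: indicator_def max_def ennreal_neg)
  finally show ?thesis .
qed

text \<open>Because negative numbers are cut off at 0, \<open>ennreal\<close> is only subadditive.
  This is the direction in which lower bounds over several intervals or pairs are added.\<close>

lemma ennreal_add_le: "ennreal (a + b) \<le> ennreal a + ennreal b"
  by (cases "0 \<le> a"; cases "0 \<le> b")
    (auto simp: ennreal_neg intro: ennreal_leI simp flip: ennreal_plus)

text \<open>\<kappa> is the root mean square speed to which the comparison orbit is scaled: the
  correction \<open>2 * pi - energy y / \<kappa>\<^sup>2\<close> in the final bound vanishes for a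
  loop with that mean speed. The condition 1 \<le> n \<beta> is that of Bernoulli's
  inequality.\<close>

locale collision_comparison =
  fixes n :: nat and P q G :: "real \<Rightarrow> real" and \<kappa> \<beta> :: real and y :: "'a::euclidean_space h1loop"
  assumes orbit: "collision_orbit n P q G" and n: "2 \<le> n" and \<beta>: "1 \<le> real n * \<beta>" and \<kappa>: "0 < \<kappa>"
begin

definition level :: real where "level = (collision_level n / \<kappa>\<^sup>2) powr \<beta>"

definition kin :: "real \<Rightarrow> real \<Rightarrow> real" where
  "kin a b = (LINT t:{a..b}|lborel. (norm (velocity y t))\<^sup>2)"

definition pot :: "real \<Rightarrow> real \<Rightarrow> ennreal" where
  "pot a b = (\<integral>\<^sup>+t\<in>{a..b}. power_potential (2 * \<beta>) (norm (curve y t)) \<partial>lborel)"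

lemma orbitD:
  assumes "s \<in> {0<..<pi}"
  shows "0 < q s" "isCont q s"
    "(P has_real_derivative - (collision_const n * q s ^ Suc n) - (P s)\<^sup>2) (at s)"
    "(G has_real_derivative q s) (at s)" "s * P s \<le> 1" "- ((pi - s) * P s) \<le> 1"
  using orbit assms unfolding collision_orbit_def by blast+

lemma \<beta>_pos: "0 < \<beta>"
  using \<beta> n by (metis less_le_trans of_nat_0_le_iff zero_less_mult_iff zero_less_one not_less)

lemma kin_combine: "0 \<le> a \<Longrightarrow> a \<le> b \<Longrightarrow> b \<le> c \<Longrightarrow> c \<le> 2 * pi \<Longrightarrow> kin a c = kin a b + kin b c"
  unfolding kin_def
  by (rule set_integral_Icc_combine) (auto intro: set_integrable_subset[OF velocityD(3)])

lemma kin_nonneg: "0 \<le> kin a b"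
  unfolding kin_def by (rule set_integral_nonneg_real) simp

lemma pot_combine:
  assumes "a \<le> b" "b \<le> c"
  shows "pot a b + pot b c = pot a c"
proof -
  have "pot a b + pot b c = (\<integral>\<^sup>+t. power_potential (2 * \<beta>) (norm (curve y t)) * indicator {a..b} t
      + power_potential (2 * \<beta>) (norm (curve y t)) * indicator {b..c} t \<partial>lborel)"
    unfolding pot_def by (rule nn_integral_add[symmetric]) measurable
  also have "\<dots> = pot a c"
    unfolding pot_def
  proof (rule nn_integral_cong_AE)
    show "AE t in lborel. power_potential (2 * \<beta>) (norm (curve y t)) * indicator {a..b} t
      + power_potential (2 * \<beta>) (norm (curve y t)) * indicator {b..c} t
      = power_potential (2 * \<beta>) (norm (curve y t)) * indicator {a..c} t"
      using AE_lborel_singleton[of b] by eventually_elim (use assms in \<open>auto simp: indicator_def\<close>)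
  qed
  finally show ?thesis .
qed

lemma pot_mono: "a \<le> a' \<Longrightarrow> b' \<le> b \<Longrightarrow> pot a' b' \<le> pot a b"
  unfolding pot_def by (intro nn_integral_mono mult_left_mono) (auto simp: indicator_def)

text \<open>The boundary term is paid for by the kinetic energy of the piece cut off at the
  collision: the squared radius is at most \<open>(a - c) * kin c a\<close>, and \<open>P\<close> is
  at most 1 / (a - c).\<close>

lemma P_left:
  assumes c: "0 \<le> c" "c < a" "a \<le> 2 * pi" "a < c + pi" and z: "curve y c = 0"
  shows "P (a - c) * (norm (curve y a))\<^sup>2 \<le> kin c a"
proof (cases "P (a - c) \<le> 0")
  case True
  then have "P (a - c) * (norm (curve y a))\<^sup>2 \<le> 0" by (intro mult_nonpos_nonneg) auto
  then show ?thesis using kin_nonneg[of c a] by linarith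
next
  case False
  have "(norm (curve y a))\<^sup>2 \<le> (a - c) * kin c a"
    using weak_derivative_holder[OF has_weak_derivative_velocity, of c a y] c z by (simp add: kin_def)
  then have "P (a - c) * (norm (curve y a))\<^sup>2 \<le> P (a - c) * ((a - c) * kin c a)"
    using False by (intro mult_left_mono) auto
  also have "\<dots> = ((a - c) * P (a - c)) * kin c a" by simp
  also have "\<dots> \<le> 1 * kin c a"
    by (intro mult_right_mono orbitD kin_nonneg) (use c in auto)
  finally show ?thesis by simp
qed

text \<open>The counterpart before a collision. An orbit that ends at \<open>c\<close> began at
  \<open>c - pi\<close>, which makes \<open>a - c + pi\<close> its time at \<open>a\<close>.\<close>

lemma P_right:
  assumes c: "0 \<le> a" "a < c" "c \<le> 2 * pi" "c < a + pi" and z: "curve y c = 0"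
  shows "- (P (a - c + pi) * (norm (curve y a))\<^sup>2) \<le> kin a c"
proof (cases "0 \<le> P (a - c + pi)")
  case True
  have "0 \<le> P (a - c + pi) * (norm (curve y a))\<^sup>2"
    using True by simp
  then show ?thesis using kin_nonneg[of a c] by linarith
next
  case False
  have "(norm (curve y a))\<^sup>2 \<le> (c - a) * kin a c"
    using weak_derivative_holder[OF has_weak_derivative_velocity, of a c y] c z
    by (simp add: kin_def)
  then have "- P (a - c + pi) * (norm (curve y a))\<^sup>2 \<le> - P (a - c + pi) * ((c - a) * kin a c)"
    using False by (intro mult_left_mono) auto
  also have "\<dots> = - ((pi - (a - c + pi)) * P (a - c + pi)) * kin a c" by simp
  also have "\<dots> \<le> 1 * kin a c"
    by (intro mult_right_mono orbitD kin_nonneg) (use c in auto)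
  finally show ?thesis by simp
qed

text \<open>The pointwise minorant is integrated with the comparison orbit started at
  \<open>c\<close>, and its term quadratic in the loop is exchanged for kinetic energy by the
  Riccati inequality. The interval keeps clear of the orbit's collisions at \<open>c\<close> and
  \<open>c + pi\<close>.\<close>

lemma pot_ge:
  assumes ab: "0 \<le> a" "a \<le> b" "b \<le> 2 * pi" and c: "c < a" "b < c + pi"
  shows "ennreal (level * ((1 - real n * \<beta>) * (b - a)
      + (real n + 1) * \<beta> * ((real n - 1) / real n) * (G (b - c) - G (a - c))
      - \<beta> / \<kappa>\<^sup>2 * (kin a b - P (b - c) * (norm (curve y b))\<^sup>2 + P (a - c) * (norm (curve y a))\<^sup>2)))
    \<le> pot a b"
proof -
  define h where "h t = collision_const n * q (t - c) ^ Suc n" for t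
  have tc: "t - c \<in> {0<..<pi}" if "t \<in> {a..b}" for t using that c by auto
  note o = orbitD
  have shift: "((\<lambda>t. F (t - c)) has_real_derivative D) (at t)"
    if "(F has_real_derivative D) (at (t - c))" for F D t
    using DERIV_shift[of F D t "- c"] that by simp
  have cq: "continuous_on {a..b} (\<lambda>t. q (t - c))"
  proof (rule continuous_at_imp_continuous_on, intro ballI)
    fix t assume "t \<in> {a..b}"
    then show "isCont (\<lambda>t. q (t - c)) t"
      using o(2)[OF tc] by (intro isCont_o2[where f = "\<lambda>t. t - c" and g = q]) (auto intro!: continuous_intros)
  qed
  have ch: "continuous_on {a..b} h"
    unfolding h_def by (intro continuous_intros cq)
  have cy: "continuous_on {a..b} (curve y)"
    using ab by (intro continuous_on_subset[OF continuous_on_curve]) auto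
  define A where "A = (real n + 1) * \<beta> * ((real n - 1) / real n)"
  define I where "I = (LINT t:{a..b}|lborel. h t * (norm (curve y t))\<^sup>2)"
  have i: "set_integrable lborel {a..b} (\<lambda>t. k)" "set_integrable lborel {a..b} (\<lambda>t. q (t - c))"
    "set_integrable lborel {a..b} (\<lambda>t. h t * (norm (curve y t))\<^sup>2)" for k :: real
    by (rule borel_integrable_atLeastAtMost', intro continuous_intros cq ch cy)+
  have Iq: "(LINT t:{a..b}|lborel. q (t - c)) = G (b - c) - G (a - c)"
  proof -
    have "(LINT t|lborel. indicator {a..b} t *\<^sub>R q (t - c)) = G (b - c) - G (a - c)"
    proof (rule integral_FTC_Icc[OF ab(2) _ cq])
      fix t assume "a \<le> t" "t \<le> b"
      then have "((\<lambda>t. G (t - c)) has_real_derivative q (t - c)) (at t)"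
        by (intro shift o(4) tc) auto
      then show "((\<lambda>t. G (t - c)) has_vector_derivative q (t - c)) (at t within {a..b})"
        by (simp add: has_real_derivative_iff_has_vector_derivative has_vector_derivative_at_within)
    qed
    then show ?thesis by (simp add: set_lebesgue_integral_def)
  qed
  have I: "P (b - c) * (norm (curve y b))\<^sup>2 - P (a - c) * (norm (curve y a))\<^sup>2 + I \<le> kin a b"
    unfolding I_def kin_def
  proof (rule riccati_inequality[OF has_weak_derivative_velocity ab _ ch, where P = "\<lambda>t. P (t - c)"])
    fix t assume "t \<in> {a..b}"
    then show "((\<lambda>t. P (t - c)) has_real_derivative - h t - (P (t - c))\<^sup>2) (at t)"
      unfolding h_def by (intro shift o(3) tc)
  qed
  define R where "R t = level * (1 - real n * \<beta> + A * q (t - c) - \<beta> / \<kappa>\<^sup>2 * (h t * (norm (curve y t))\<^sup>2))" for t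
  have lev: "0 \<le> level" by (simp add: level_def)
  have iR: "set_integrable lborel {a..b} R"
    unfolding R_def by (rule borel_integrable_atLeastAtMost') (intro continuous_intros cq ch cy)
  have "(LINT t:{a..b}|lborel. R t)
      = level * ((LINT t:{a..b}|lborel. (1 - real n * \<beta>) + A * q (t - c)) - \<beta> / \<kappa>\<^sup>2 * I)"
    unfolding R_def I_def using i
    by (simp add: set_integral_diff set_integral_add)
  also have "\<dots> = level * ((1 - real n * \<beta>) * (b - a) + A * (G (b - c) - G (a - c)) - \<beta> / \<kappa>\<^sup>2 * I)"
    using i ab by (subst set_integral_add(2)) (simp_all add: Iq set_integral_const algebra_simps)
  finally have IR: "(LINT t:{a..b}|lborel. R t)
      = level * ((1 - real n * \<beta>) * (b - a) + A * (G (b - c) - G (a - c)) - \<beta> / \<kappa>\<^sup>2 * I)" .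
  have "level * ((1 - real n * \<beta>) * (b - a) + A * (G (b - c) - G (a - c))
      - \<beta> / \<kappa>\<^sup>2 * (kin a b - P (b - c) * (norm (curve y b))\<^sup>2 + P (a - c) * (norm (curve y a))\<^sup>2))
      \<le> (LINT t:{a..b}|lborel. R t)"
    unfolding IR using I lev \<beta>_pos by (intro mult_left_mono diff_left_mono) auto
  then have "ennreal (level * ((1 - real n * \<beta>) * (b - a) + A * (G (b - c) - G (a - c))
      - \<beta> / \<kappa>\<^sup>2 * (kin a b - P (b - c) * (norm (curve y b))\<^sup>2 + P (a - c) * (norm (curve y a))\<^sup>2)))
      \<le> ennreal (LINT t:{a..b}|lborel. R t)"
    by (rule ennreal_leI)
  also have "\<dots> \<le> pot a b"
    unfolding pot_def
  proof (rule ennreal_integral_le_nn_integral[OF iR])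
    fix t assume t: "t \<in> {a..b}"
    show "ennreal (R t) \<le> power_potential (2 * \<beta>) (norm (curve y t))"
    proof (cases "curve y t = 0")
      case False
      then have "R t \<le> norm (curve y t) powr (- (2 * \<beta>))"
        using potential_ge_quadratic[OF _ o(1)[OF tc[OF t]] \<kappa> n \<beta>, of "norm (curve y t)"]
        by (simp add: R_def A_def h_def level_def)
      then show ?thesis using False by (simp add: power_potential_def ennreal_leI)
    qed (simp add: power_potential_def)
  qed
  finally show ?thesis by (simp add: A_def)
qed

text \<open>When the cuts reach the collisions the constants collapse: the coefficient of
  \<open>G\<close> times its increment is (n + 1) \<beta> pi, and adding (1 - n \<beta>) pi leaves
  pi + \<beta> pi.\<close>

lemma pot_ge_limit:
  assumes e0: "0 < e0" "e0 \<le> pi / 2"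
    and le: "\<And>e. 0 < e \<Longrightarrow> e < e0 \<Longrightarrow> ennreal (level * ((1 - real n * \<beta>) * (pi - 2 * e)
      + (real n + 1) * \<beta> * ((real n - 1) / real n) * (G (pi - e) - G e) - \<beta> / \<kappa>\<^sup>2 * W)) \<le> V"
  shows "ennreal (level * (pi + \<beta> * (pi - W / \<kappa>\<^sup>2))) \<le> V"
proof -
  define A where "A = (real n + 1) * \<beta> * ((real n - 1) / real n)"
  define L where "L e = level * ((1 - real n * \<beta>) * (pi - 2 * e) + A * (G (pi - e) - G e) - \<beta> / \<kappa>\<^sup>2 * W)" for e
  have cG: "continuous_on {0..pi} G" and Gd: "G pi - G 0 = pi * real n / (real n - 1)"
    using orbit unfolding collision_orbit_def by blast+
  have "continuous_on {0..pi/2} L"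
    unfolding L_def
    by (intro continuous_intros continuous_on_compose2[OF cG]) auto
  then have "(L \<longlongrightarrow> L 0) (at 0 within {0..pi/2})"
    by (simp add: continuous_on_def)
  then have "(L \<longlongrightarrow> L 0) (at_right 0)"
    using at_within_Icc_at_right[of 0 "pi / 2"] by simp
  then have lim: "((\<lambda>e. ennreal (L e)) \<longlongrightarrow> ennreal (L 0)) (at_right 0)"
    by (rule tendsto_ennrealI)
  have "\<forall>\<^sub>F e in at_right 0. ennreal (L e) \<le> V"
    unfolding eventually_at_right_field using le e0 by (auto simp: L_def A_def intro!: exI[of _ e0])
  then have "ennreal (L 0) \<le> V"
    by (rule tendsto_upperbound[OF lim]) simp
  moreover have "L 0 = level * (pi + \<beta> * (pi - W / \<kappa>\<^sup>2))"
  proof -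
    have "A * (G (pi - 0) - G 0) = (real n + 1) * \<beta> * pi"
      using n by (simp add: A_def Gd)
    then show ?thesis
      unfolding L_def by (simp add: algebra_simps)
  qed
  ultimately show ?thesis by simp
qed

text \<open>The energies of the two cut-off ends compensate the two boundary terms, so the full
  kinetic energy between the collisions appears for every \<open>e\<close>.\<close>

lemma pot_ge_half:
  assumes c: "0 \<le> c" "c \<le> pi" and z: "curve y c = 0" "curve y (c + pi) = 0"
  shows "ennreal (level * (pi + \<beta> * (pi - kin c (c + pi) / \<kappa>\<^sup>2))) \<le> pot c (c + pi)"
proof (rule pot_ge_limit[of "pi / 2"])
  fix e :: real assume e: "0 < e" "e < pi / 2"
  let ?a = "c + e" and ?b = "c + pi - e"
  let ?A = "(real n + 1) * \<beta> * ((real n - 1) / real n) * (G (pi - e) - G e)"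
  let ?W = "kin ?a ?b - P (pi - e) * (norm (curve y ?b))\<^sup>2 + P e * (norm (curve y ?a))\<^sup>2"
  have W: "?W \<le> kin c (c + pi)"
    using P_left[of c ?a] P_right[of ?b "c + pi"] z c e
      kin_combine[of c ?a "c + pi"] kin_combine[of ?a ?b "c + pi"] by (simp add: algebra_simps)
  have "level * ((1 - real n * \<beta>) * (pi - 2 * e) + ?A - \<beta> / \<kappa>\<^sup>2 * kin c (c + pi))
    \<le> level * ((1 - real n * \<beta>) * (?b - ?a) + ?A - \<beta> / \<kappa>\<^sup>2 * (?W))"
  proof (rule mult_left_mono)
    have "\<beta> / \<kappa>\<^sup>2 * (?W)
        \<le> \<beta> / \<kappa>\<^sup>2 * kin c (c + pi)"
      using W \<beta>_pos by (intro mult_left_mono) auto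
    note W' = this
    have eq: "?b - ?a = pi - 2 * e" by simp
    show "(1 - real n * \<beta>) * (pi - 2 * e) + ?A - \<beta> / \<kappa>\<^sup>2 * kin c (c + pi)
    \<le> (1 - real n * \<beta>) * (?b - ?a) + ?A - \<beta> / \<kappa>\<^sup>2 * (?W)"
      unfolding eq by (rule diff_left_mono[OF W'])
  qed (simp add: level_def)
  then have "ennreal (level * ((1 - real n * \<beta>) * (pi - 2 * e) + ?A - \<beta> / \<kappa>\<^sup>2 * kin c (c + pi)))
    \<le> ennreal (level * ((1 - real n * \<beta>) * (?b - ?a) + ?A - \<beta> / \<kappa>\<^sup>2 * (?W)))"
    by (rule ennreal_leI)
  also have "\<dots> \<le> pot ?a ?b"
    using pot_ge[of ?a ?b c] c e by (simp add: algebra_simps)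
  also have "\<dots> \<le> pot c (c + pi)"
    by (rule pot_mono) (use e in auto)
  finally show "ennreal (level * ((1 - real n * \<beta>) * (pi - 2 * e) + ?A - \<beta> / \<kappa>\<^sup>2 * kin c (c + pi)))
    \<le> pot c (c + pi)" .
qed auto

text \<open>The other interval between collisions passes through the end of the period. Its pieces
  use orbits started at \<open>s - pi\<close> and \<open>s + pi\<close>. At the times 0 and 2 pi
  both have reached the phase \<open>pi - s\<close>, and the loop has the same value, so the
  boundary terms there cancel and the increments of \<open>G\<close> add up.\<close>

lemma pot_ge_wrap:
  assumes s: "0 < s" "s < pi" and z: "curve y s = 0" "curve y (s + pi) = 0"
  shows "ennreal (level * (pi + \<beta> * (pi - (kin 0 s + kin (s + pi) (2 * pi)) / \<kappa>\<^sup>2)))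
    \<le> pot 0 s + pot (s + pi) (2 * pi)"
proof (rule pot_ge_limit[of "min s (pi - s) / 2"])
  fix e :: real assume e: "0 < e" "e < min s (pi - s) / 2"
  define N where "N = (norm (curve y 0))\<^sup>2"
  have N: "(norm (curve y (2 * pi)))\<^sup>2 = N" using curve_periodic[of y 0] by (simp add: N_def)
  let ?b = "s - e" and ?a = "s + pi + e"
  define A where "A = (real n + 1) * \<beta> * ((real n - 1) / real n)"
  define W1 where "W1 = kin 0 ?b - P (pi - e) * (norm (curve y ?b))\<^sup>2 + P (pi - s) * N"
  define W2 where "W2 = kin ?a (2 * pi) - P (pi - s) * N + P e * (norm (curve y ?a))\<^sup>2"
  have W: "W1 + W2 \<le> kin 0 s + kin (s + pi) (2 * pi)"
    using P_left[of "s + pi" ?a] P_right[of ?b s] z s e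
      kin_combine[of 0 ?b s] kin_combine[of "s + pi" ?a "2 * pi"] by (simp add: W1_def W2_def algebra_simps)
  let ?L = "level * ((1 - real n * \<beta>) * (pi - 2 * e) + A * (G (pi - e) - G e)
      - \<beta> / \<kappa>\<^sup>2 * (kin 0 s + kin (s + pi) (2 * pi)))"
  let ?L1 = "level * ((1 - real n * \<beta>) * (?b - 0) + A * (G (pi - e) - G (pi - s)) - \<beta> / \<kappa>\<^sup>2 * W1)"
  let ?L2 = "level * ((1 - real n * \<beta>) * (2 * pi - ?a) + A * (G (pi - s) - G e) - \<beta> / \<kappa>\<^sup>2 * W2)"
  have "?L \<le> level * ((1 - real n * \<beta>) * (pi - 2 * e) + A * (G (pi - e) - G e) - \<beta> / \<kappa>\<^sup>2 * (W1 + W2))"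
    using W \<beta>_pos by (intro mult_left_mono diff_left_mono) (auto simp: level_def)
  also have "\<dots> = ?L1 + ?L2"
  proof -
    have "level * (x * (pi - 2 * e) + A * (g1 - g2) - k * (u + v))
        = level * (x * (?b - 0) + A * (g1 - g) - k * u) + level * (x * (2 * pi - ?a) + A * (g - g2) - k * v)"
      for x g g1 g2 k u v
      by (simp add: algebra_simps)
    then show ?thesis .
  qed
  finally have "ennreal ?L \<le> ennreal (?L1 + ?L2)" by (rule ennreal_leI)
  also have "\<dots> \<le> ennreal ?L1 + ennreal ?L2" by (rule ennreal_add_le)
  also have "\<dots> \<le> pot 0 ?b + pot ?a (2 * pi)"
  proof (rule add_mono)
    have "?b - (s - pi) = pi - e" "0 - (s - pi) = pi - s" by auto
    then show "ennreal ?L1 \<le> pot 0 ?b"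
      using pot_ge[of 0 ?b "s - pi"] s e by (simp add: A_def W1_def N_def)
    have "2 * pi - (s + pi) = pi - s" "?a - (s + pi) = e" by auto
    then show "ennreal ?L2 \<le> pot ?a (2 * pi)"
      using pot_ge[of ?a "2 * pi" "s + pi"] s e by (simp add: A_def W2_def N)
  qed
  also have "\<dots> \<le> pot 0 s + pot (s + pi) (2 * pi)"
    by (rule add_mono; rule pot_mono) (use e in auto)
  finally show "ennreal (level * ((1 - real n * \<beta>) * (pi - 2 * e)
      + (real n + 1) * \<beta> * ((real n - 1) / real n) * (G (pi - e) - G e)
      - \<beta> / \<kappa>\<^sup>2 * (kin 0 s + kin (s + pi) (2 * pi)))) \<le> pot 0 s + pot (s + pi) (2 * pi)"
    by (simp add: A_def)
qed (use s pi_half_gt_zero in \<open>auto simp: min_def\<close>)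

lemma pot_ge_collision:
  assumes s: "0 \<le> s" "s < pi" and z: "curve y s = 0" "curve y (s + pi) = 0"
  shows "ennreal (level * (2 * pi + \<beta> * (2 * pi - energy y / \<kappa>\<^sup>2))) \<le> pot 0 (2 * pi)"
proof -
  obtain W1 W2 V1 V2 where W: "W1 + W2 = energy y" "V1 + V2 \<le> pot 0 (2 * pi)"
    "ennreal (level * (pi + \<beta> * (pi - W1 / \<kappa>\<^sup>2))) \<le> V1"
    "ennreal (level * (pi + \<beta> * (pi - W2 / \<kappa>\<^sup>2))) \<le> V2"
  proof (cases "s = 0")
    case True
    have z2: "curve y (2 * pi) = 0" using curve_periodic[of y 0] z True by simp
    show thesis
    proof (rule that)
      show "kin 0 (0 + pi) + kin pi (pi + pi) = energy y"
        using kin_combine[of 0 pi "2 * pi"] by (simp add: energy_def kin_def)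
      show "pot 0 (0 + pi) + pot pi (pi + pi) \<le> pot 0 (2 * pi)"
        using pot_combine[of 0 pi "2 * pi"] by simp
    qed (rule pot_ge_half; use z z2 True in simp)+
  next
    case False
    show thesis
    proof (rule that)
      show "kin s (s + pi) + (kin 0 s + kin (s + pi) (2 * pi)) = energy y"
        using kin_combine[of 0 s "2 * pi"] kin_combine[of s "s + pi" "2 * pi"] s
        by (simp add: energy_def kin_def)
      show "pot s (s + pi) + (pot 0 s + pot (s + pi) (2 * pi)) \<le> pot 0 (2 * pi)"
        using pot_combine[of 0 s "2 * pi"] pot_combine[of s "s + pi" "2 * pi"] s
        by (simp add: ac_simps)
      show "ennreal (level * (pi + \<beta> * (pi - kin s (s + pi) / \<kappa>\<^sup>2))) \<le> pot s (s + pi)"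
        by (rule pot_ge_half) (use s z in auto)
      show "ennreal (level * (pi + \<beta> * (pi - (kin 0 s + kin (s + pi) (2 * pi)) / \<kappa>\<^sup>2)))
          \<le> pot 0 s + pot (s + pi) (2 * pi)"
        by (rule pot_ge_wrap) (use s z False in auto)
    qed
  qed
  have split: "level * (2 * pi + \<beta> * (2 * pi - (A + B)))
      = level * (pi + \<beta> * (pi - A)) + level * (pi + \<beta> * (pi - B))" for A B
    by (simp add: algebra_simps)
  have "level * (2 * pi + \<beta> * (2 * pi - energy y / \<kappa>\<^sup>2))
      = level * (pi + \<beta> * (pi - W1 / \<kappa>\<^sup>2)) + level * (pi + \<beta> * (pi - W2 / \<kappa>\<^sup>2))"
    unfolding W(1)[symmetric] add_divide_distrib by (rule split)
  then have "ennreal (level * (2 * pi + \<beta> * (2 * pi - energy y / \<kappa>\<^sup>2)))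
      \<le> ennreal (level * (pi + \<beta> * (pi - W1 / \<kappa>\<^sup>2))) + ennreal (level * (pi + \<beta> * (pi - W2 / \<kappa>\<^sup>2)))"
    by (simp only: ennreal_add_le)
  also have "\<dots> \<le> V1 + V2" using W(3,4) by (rule add_mono)
  also have "\<dots> \<le> pot 0 (2 * pi)" by (rule W(2))
  finally show ?thesis .
qed

end

lemma potential_integral_ge_collision:
  fixes y :: "'a::euclidean_space h1loop"
  assumes n: "2 \<le> n" and \<beta>: "1 \<le> real n * \<beta>" and \<kappa>: "0 < \<kappa>"
    and s: "0 \<le> s" "s < pi" and z: "curve y s = 0" "curve y (s + pi) = 0"
  shows "ennreal ((collision_level n / \<kappa>\<^sup>2) powr \<beta> * (2 * pi + \<beta> * (2 * pi - energy y / \<kappa>\<^sup>2)))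
    \<le> loop_potential (2 * \<beta>) y"
proof -
  obtain P q G where "collision_orbit n P q G" using collision_orbit_exists[OF n] by blast
  then interpret collision_comparison n P q G \<kappa> \<beta> y
    by unfold_locales (use n \<beta> \<kappa> in auto)
  show ?thesis
    using pot_ge_collision[OF s z] by (simp add: level_def pot_def loop_potential_def)
qed

section \<open>An eight below the collision level\<close>

lemma ln_le_if_le_exp:
  fixes x c :: real
  shows "x \<le> exp c \<Longrightarrow> 0 < x \<Longrightarrow> ln x \<le> c"
  by (metis exp_gt_zero ln_exp ln_le_cancel_iff)

text \<open>At rational points the partial sums can be evaluated, which certifies numerical upper
  bounds for logarithms.\<close>

lemma exp_ge_partial_sum:
  fixes x :: real
  assumes "0 \<le> x"
  shows "(\<Sum>k<n. x ^ k / fact k) \<le> exp x"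
proof -
  have "(\<lambda>k. x ^ k / fact k) sums exp x"
    using exp_converges[of x] by (simp add: divide_inverse mult.commute)
  then show ?thesis
    using sum_le_suminf[of "\<lambda>k. x ^ k / fact k" "{..<n}"] assms
    by (simp add: sums_iff)
qed

text \<open>The derivative of the difference is y^2 / ((1 + y) (2 + y)^2).\<close>

lemma ln_one_plus_ge:
  fixes x :: real
  assumes "0 \<le> x"
  shows "2 * x / (2 + x) \<le> ln (1 + x)"
proof -
  have "ln (1 + 0) - 2 * 0 / (2 + 0) \<le> ln (1 + x) - 2 * x / (2 + x)"
  proof (rule DERIV_nonneg_imp_nondecreasing[OF assms, where f = "\<lambda>x. ln (1 + x) - 2 * x / (2 + x)"])
    fix y :: real assume y: "0 \<le> y"
    have "((\<lambda>x. ln (1 + x) - 2 * x / (2 + x)) has_real_derivative 1 / (1 + y) - 4 / (2 + y)\<^sup>2) (at y)"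
      using y by (auto intro!: derivative_eq_intros simp: power2_eq_square algebra_simps)
    moreover have "4 / (2 + y)\<^sup>2 \<le> 1 / (1 + y)"
    proof -
      have "4 * (1 + y) \<le> (2 + y)\<^sup>2"
        by (simp add: power2_eq_square algebra_simps)
      then have "4 \<le> (2 + y)\<^sup>2 / (1 + y)"
        using y by (subst pos_le_divide_eq) auto
      then show ?thesis
        using y by (subst pos_divide_le_eq) auto
    qed
    ultimately show "\<exists>z. ((\<lambda>x. ln (1 + x) - 2 * x / (2 + x)) has_real_derivative z) (at y) \<and> 0 \<le> z"
      by (intro exI[of _ "1 / (1 + y) - 4 / (2 + y)\<^sup>2"]) simp
  qed
  then show ?thesis by simp
qed

text \<open>The point b x is the convex combination of x and -x with weights (1 + b) / 2 and (1 - b)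
  / 2. Convexity of the exponential compares the second derivatives of the two sides; they agree to
  first order at 0. There is equality for b = 0 and b = 1, which keeps the bound sharp at both ends
  of the range of exponents.\<close>

lemma exp_interpolation:
  fixes x b :: real
  assumes b: "0 \<le> b" "b \<le> 1"
  shows "exp (b * x) \<le> 1 + b * x + b\<^sup>2 * ((1 + b) / 2 * (exp x - 1 - x) + (1 - b) / 2 * (exp (- x) - 1 + x))"
proof -
  define f where "f x = 1 + b * x + b\<^sup>2 * ((1 + b) / 2 * (exp x - 1 - x) + (1 - b) / 2 * (exp (- x) - 1 + x))
    - exp (b * x)" for x
  define f' where "f' x = b + b\<^sup>2 * ((1 + b) / 2 * (exp x - 1) + (1 - b) / 2 * (1 - exp (- x))) - b * exp (b * x)" for x
  define f'' where "f'' x = b\<^sup>2 * ((1 + b) / 2 * exp x + (1 - b) / 2 * exp (- x) - exp (b * x))" for x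
  have d1: "(f has_real_derivative f' x) (at x)" for x
    unfolding f_def f'_def by (auto intro!: derivative_eq_intros)
  have d2: "(f' has_real_derivative f'' x) (at x)" for x
    unfolding f'_def f''_def by (auto intro!: derivative_eq_intros simp: power2_eq_square field_simps)
  have "0 \<le> f'' x" for x
  proof -
    have "exp ((1 - (1 - b) / 2) *\<^sub>R x + ((1 - b) / 2) *\<^sub>R (- x))
        \<le> (1 - (1 - b) / 2) * exp x + (1 - b) / 2 * exp (- x)"
      by (rule convex_onD[OF exp_convex]) (use b in auto)
    moreover have "(1 - (1 - b) / 2) *\<^sub>R x + ((1 - b) / 2) *\<^sub>R (- x) = b * x"
      by (simp add: field_simps)
    moreover have "1 - (1 - b) / 2 = (1 + b) / 2"
      by (simp add: field_simps)
    ultimately show ?thesis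
      unfolding f''_def by (intro mult_nonneg_nonneg) auto
  qed
  then have "convex_on UNIV f"
    by (intro f''_ge0_imp_convex[of UNIV f f' f''] d1 d2) auto
  then have "f' 0 * (x - 0) \<le> f x - f 0"
    by (rule convex_on_imp_above_tangent) (use d1 in auto)
  then show ?thesis
    by (simp add: f_def f'_def)
qed

section \<open>Means of functions of the mutual distance of the test loop\<close>

lemma integral_periodic_shift:
  fixes f :: "real \<Rightarrow> real"
  assumes f: "continuous_on UNIV f" and per: "\<And>t. f (t + 2 * pi) = f t" and c: "0 \<le> c" "c \<le> 2 * pi"
  shows "integral {0..2 * pi} (\<lambda>t. f (t + c)) = integral {0..2 * pi} f"
proof -
  have i: "f integrable_on {a..b}" for a b
    by (rule integrable_continuous_real) (rule continuous_on_subset[OF f], simp)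
  have sh: "integral {a..b} (\<lambda>t. f (t + d)) = integral {a + d..b + d} f" for a b d
    using integral_shift_Icc_real[of a b f d] by (simp add: comp_def add.commute)
  have "integral {0..2 * pi} (\<lambda>t. f (t + c)) = integral {c..2 * pi + c} f"
    using sh[of 0 "2 * pi" c] by simp
  also have "\<dots> = integral {c..2 * pi} f + integral {2 * pi..2 * pi + c} f"
    using c i by (intro Henstock_Kurzweil_Integration.integral_combine[symmetric]) auto
  also have "integral {2 * pi..2 * pi + c} f = integral {0..c} (\<lambda>t. f (t + 2 * pi))"
    using sh[of 0 c "2 * pi"] by (simp add: add.commute)
  also have "integral {c..2 * pi} f + integral {0..c} (\<lambda>t. f (t + 2 * pi)) = integral {0..2 * pi} f"
    unfolding per using c i
    by (subst add.commute) (rule Henstock_Kurzweil_Integration.integral_combine, auto)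
  finally show ?thesis .
qed

text \<open>
  Averaging a function of \<open>cos\<^sup>2 t\<close> over the translates by multiples of \<open>\<pi>/4\<close> makes it nearly constant.
\<close>

lemma integral_cos_square_average:
  fixes \<phi> :: "real \<Rightarrow> real"
  assumes \<phi>: "continuous_on {0..1} \<phi>"
    and le: "\<And>C S. C\<^sup>2 + S\<^sup>2 = 1 \<Longrightarrow>
      \<phi> ((1 + C) / 2) + \<phi> ((1 - S) / 2) + \<phi> ((1 - C) / 2) + \<phi> ((1 + S) / 2) \<le> 4 * (A + B * (4 * C\<^sup>2 * S\<^sup>2))"
  shows "integral {0..2 * pi} (\<lambda>t. \<phi> ((cos t)\<^sup>2)) \<le> 2 * pi * (A + B / 2)"
proof -
  define f where "f t = \<phi> ((cos t)\<^sup>2)" for t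
  have cf: "continuous_on X f" for X
    unfolding f_def
    by (rule continuous_on_compose2[OF \<phi>]) (auto intro!: continuous_intros simp: abs_square_le_1)
  have per: "f (t + 2 * pi) = f t" for t by (simp add: f_def)
  have i: "(\<lambda>t. f (t + c)) integrable_on {0..2 * pi}" for c
    by (rule integrable_continuous_real) (rule continuous_on_compose2[OF cf[of UNIV]], auto intro!: continuous_intros)
  have sh: "integral {0..2 * pi} (\<lambda>t. f (t + c)) = integral {0..2 * pi} f" if "0 \<le> c" "c \<le> 2 * pi" for c
    by (rule integral_periodic_shift[OF cf per that])
  have "4 * integral {0..2 * pi} f = integral {0..2 * pi} (\<lambda>t. f (t + 0)) + integral {0..2 * pi} (\<lambda>t. f (t + pi / 4))
      + integral {0..2 * pi} (\<lambda>t. f (t + pi / 2)) + integral {0..2 * pi} (\<lambda>t. f (t + 3 * pi / 4))"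
    by (subst sh sh sh sh, simp, simp)+ simp
  also have "\<dots> = integral {0..2 * pi} (\<lambda>t. f (t + 0) + f (t + pi / 4) + f (t + pi / 2) + f (t + 3 * pi / 4))"
    using i[of 0] i[of "pi / 4"] i[of "pi / 2"] i[of "3 * pi / 4"]
    by (simp add: integral_add integrable_add)
  also have "\<dots> \<le> integral {0..2 * pi} (\<lambda>t. 4 * A + 2 * B - 2 * B * cos (8 * t))"
  proof (rule integral_le)
    show "(\<lambda>t. f (t + 0) + f (t + pi / 4) + f (t + pi / 2) + f (t + 3 * pi / 4)) integrable_on {0..2 * pi}"
      by (intro integrable_add i)
    show "(\<lambda>t. 4 * A + 2 * B - 2 * B * cos (8 * t)) integrable_on {0..2 * pi}"
      by (intro integrable_continuous_real continuous_intros)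
    fix t :: real
    define C S where "C = cos (2 * t)" and "S = sin (2 * t)"
    have sq: "(cos x)\<^sup>2 = (1 + cos (2 * x)) / 2" for x :: real
      by (simp add: cos_double_cos)
    have "f (t + 0) = \<phi> ((1 + C) / 2)" "f (t + pi / 4) = \<phi> ((1 - S) / 2)"
      "f (t + pi / 2) = \<phi> ((1 - C) / 2)" "f (t + 3 * pi / 4) = \<phi> ((1 + S) / 2)"
    proof -
      have "2 * (t + pi / 4) = 2 * t + pi / 2" "2 * (t + pi / 2) = 2 * t + pi"
        "2 * (t + 3 * pi / 4) = (2 * t + pi / 2) + pi" by (simp_all add: algebra_simps)
      then have "cos (2 * (t + pi / 4)) = - S" "cos (2 * (t + pi / 2)) = - C" "cos (2 * (t + 3 * pi / 4)) = S"
        by (simp_all only: C_def S_def cos_add sin_add) simp_all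
      then show "f (t + 0) = \<phi> ((1 + C) / 2)" "f (t + pi / 4) = \<phi> ((1 - S) / 2)"
        "f (t + pi / 2) = \<phi> ((1 - C) / 2)" "f (t + 3 * pi / 4) = \<phi> ((1 + S) / 2)"
        unfolding f_def sq by (simp_all add: C_def)
    qed
    note f4 = this
    \<comment> \<open>This is the square of sin (4 t). Only its mean 1/2 survives the integration,
      whence \<open>B / 2\<close>.\<close>
    have "4 * C\<^sup>2 * S\<^sup>2 = (1 - cos (8 * t)) / 2"
    proof -
      have "sin (4 * t) = 2 * S * C"
        using sin_double[of "2 * t"] by (simp add: C_def S_def)
      moreover have "cos (8 * t) = 1 - 2 * (sin (4 * t))\<^sup>2"
        using cos_double_sin[of "4 * t"] by simp
      ultimately show ?thesis by (simp add: power_mult_distrib)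
    qed
    then have "4 * (A + B * (4 * C\<^sup>2 * S\<^sup>2)) = 4 * A + 2 * B - 2 * B * cos (8 * t)"
      by (simp only:) (simp add: field_simps)
    moreover have "C\<^sup>2 + S\<^sup>2 = 1" by (simp add: C_def S_def)
    ultimately show "f (t + 0) + f (t + pi / 4) + f (t + pi / 2) + f (t + 3 * pi / 4) \<le> 4 * A + 2 * B - 2 * B * cos (8 * t)"
      using le[of C S] f4 by simp
  qed
  also have "\<dots> = 2 * pi * (4 * A + 2 * B)"
  proof (rule integral_unique)
    have "((\<lambda>t. 4 * A + 2 * B - 2 * B * cos (8 * t)) has_integral
        ((4 * A + 2 * B) * (2 * pi) - 2 * B * (sin (8 * (2 * pi)) / 8)) - ((4 * A + 2 * B) * 0 - 2 * B * (sin (8 * 0) / 8))) {0..2 * pi}"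
      by (rule fundamental_theorem_of_calculus)
        (auto intro!: derivative_eq_intros simp: has_real_derivative_iff_has_vector_derivative[symmetric])
    moreover have "sin (8 * (2 * pi)) = 0"
      using sin_npi[of 16] by (simp add: mult.assoc)
    ultimately show "((\<lambda>t. 4 * A + 2 * B - 2 * B * cos (8 * t)) has_integral 2 * pi * (4 * A + 2 * B)) {0..2 * pi}"
      by (simp add: algebra_simps)
  qed
  finally have "4 * integral {0..2 * pi} f \<le> 2 * pi * (4 * A + 2 * B)" .
  moreover have "2 * pi * (4 * A + 2 * B) = 4 * (2 * pi * (A + B / 2))" by (simp add: algebra_simps)
  ultimately show ?thesis unfolding f_def by linarith
qed

text \<open>
  For the test loop \<open>(A sin 2t, B sin t)\<close> with \<open>B\<^sup>2 = 16 A\<^sup>2\<close> the squared mutual distance is, up to a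
  translation in time, a constant multiple of this polynomial in \<open>cos\<^sup>2 t\<close>.
\<close>

definition eight_dist :: "real \<Rightarrow> real" where
  "eight_dist u = 1 / 10 + 6 / 5 * u + 2 / 5 * u\<^sup>2"

lemma eight_dist_pos: "0 \<le> u \<Longrightarrow> 0 < eight_dist u"
  by (simp add: eight_dist_def add_pos_nonneg)

lemma eight_dist_mult:
  "eight_dist ((1 + C) / 2) * eight_dist ((1 - C) / 2)
    = 4 / 25 * (((1 - C\<^sup>2) / 4)\<^sup>2 + 23 / 2 * ((1 - C\<^sup>2) / 4) + 17 / 16)"
  unfolding eight_dist_def by (simp add: power2_eq_square field_simps)

lemma eight_dist_add:
  "eight_dist ((1 + C) / 2) + eight_dist ((1 - C) / 2) = 9 / 5 - 4 / 5 * ((1 - C\<^sup>2) / 4)"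
  unfolding eight_dist_def by (simp add: power2_eq_square field_simps)

text \<open>Pairing translates by pi / 2 makes each pair a polynomial in C^2 or S^2. Multiplying the
  pairs leaves a function of C^2 S^2 / 16 alone, which varies only between 0 and 1/64.\<close>

lemma eight_dist_prod:
  assumes "C\<^sup>2 + S\<^sup>2 = 1"
  shows "eight_dist ((1 + C) / 2) * eight_dist ((1 - C) / 2) * (eight_dist ((1 + S) / 2) * eight_dist ((1 - S) / 2))
    = 16 / 625 * ((C\<^sup>2 * S\<^sup>2 / 16)\<^sup>2 + 133 * (C\<^sup>2 * S\<^sup>2 / 16) + 17 / 4)"
proof -
  have S: "S\<^sup>2 = 1 - C\<^sup>2" using assms by simp
  show ?thesis
    unfolding eight_dist_mult S by (simp add: power2_eq_square field_simps)
qed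

lemma circle_bounds:
  fixes C S :: real
  assumes "C\<^sup>2 + S\<^sup>2 = 1"
  shows "0 \<le> (1 + C) / 2" "0 \<le> (1 - C) / 2" "0 \<le> (1 + S) / 2" "0 \<le> (1 - S) / 2"
    "0 \<le> C\<^sup>2 * S\<^sup>2 / 16" "C\<^sup>2 * S\<^sup>2 / 16 \<le> 1 / 64"
proof -
  have "C\<^sup>2 \<le> 1" "S\<^sup>2 \<le> 1" using assms zero_le_power2[of C] zero_le_power2[of S] by linarith+
  then have "\<bar>C\<bar> \<le> 1" "\<bar>S\<bar> \<le> 1" by (simp_all add: abs_square_le_1)
  then show "0 \<le> (1 + C) / 2" "0 \<le> (1 - C) / 2" "0 \<le> (1 + S) / 2" "0 \<le> (1 - S) / 2" by auto
  show "0 \<le> C\<^sup>2 * S\<^sup>2 / 16" by simp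
  have "4 * (C\<^sup>2 * S\<^sup>2) \<le> (C\<^sup>2 + S\<^sup>2)\<^sup>2"
    using sum_squares_bound[of "C\<^sup>2" "S\<^sup>2"] by (simp add: power2_sum)
  then show "C\<^sup>2 * S\<^sup>2 / 16 \<le> 1 / 64" using assms by simp
qed

text \<open>The four logarithms add up to that of a product. The values 68/625 and 81/500 are those
  of the product at \<open>w = 0\<close> and \<open>w = 1\<close> after dropping a nonnegative
  square, and the concave logarithm lies above its chord.\<close>

lemma integral_ln_eight_dist:
  "integral {0..2 * pi} (\<lambda>t. - ln (eight_dist ((cos t)\<^sup>2))) \<le> 2 * pi * (- (ln (68 / 625) + ln (81 / 500)) / 8)"
proof -
  define A :: real where "A = - ln (68 / 625) / 4"
  define B :: real where "B = (ln (68 / 625) - ln (81 / 500)) / 4"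
  have "integral {0..2 * pi} (\<lambda>t. - ln (eight_dist ((cos t)\<^sup>2))) \<le> 2 * pi * (A + B / 2)"
  proof (rule integral_cos_square_average)
    show "continuous_on {0..1} (\<lambda>u. - ln (eight_dist u))"
      using eight_dist_pos unfolding eight_dist_def
      by (intro continuous_intros) (metis atLeastAtMost_iff less_irrefl)
    fix C S :: real assume CS: "C\<^sup>2 + S\<^sup>2 = 1"
    note b = circle_bounds[OF CS]
    define w where "w = 4 * C\<^sup>2 * S\<^sup>2"
    have w: "0 \<le> w" "w \<le> 1" using b(5,6) by (auto simp: w_def)
    let ?p = "eight_dist ((1 + C) / 2) * eight_dist ((1 - C) / 2) * (eight_dist ((1 + S) / 2) * eight_dist ((1 - S) / 2))"
    have "(1 - w) * (68 / 625) + w * (81 / 500) \<le> ?p"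
    proof -
      have zw: "C\<^sup>2 * S\<^sup>2 / 16 = w / 64" by (simp add: w_def)
      have "(1 - w) * (68 / 625) + w * (81 / 500) \<le> 16 / 625 * (Y + 133 * (w / 64) + 17 / 4)" if "0 \<le> Y" for Y
        using that by (simp add: field_simps)
      then show ?thesis unfolding eight_dist_prod[OF CS] zw by simp
    qed
    moreover have "(1 - w) * ln (68 / 625) + w * ln (81 / 500) \<le> ln ((1 - w) * (68 / 625) + w * (81 / 500))"
      using concave_onD[OF ln_concave, of w "68 / 625" "81 / 500"] w by simp
    moreover have "0 < (1 - w) * (68 / 625) + w * (81 / 500)"
      using w by (cases "w = 0") (auto intro!: add_nonneg_pos mult_pos_pos)
    ultimately have "(1 - w) * ln (68 / 625) + w * ln (81 / 500) \<le> ln ?p"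
      by (smt (verit) ln_le_cancel_iff)
    moreover have "ln ?p = ln (eight_dist ((1 + C) / 2)) + ln (eight_dist ((1 - C) / 2))
        + ln (eight_dist ((1 + S) / 2)) + ln (eight_dist ((1 - S) / 2))"
      using b(1-4)[THEN eight_dist_pos] by (simp add: ln_mult)
    ultimately show "- ln (eight_dist ((1 + C) / 2)) + - ln (eight_dist ((1 - S) / 2))
        + - ln (eight_dist ((1 - C) / 2)) + - ln (eight_dist ((1 + S) / 2)) \<le> 4 * (A + B * (4 * C\<^sup>2 * S\<^sup>2))"
      unfolding w_def[symmetric] by (simp add: A_def B_def algebra_simps)
  qed
  then show ?thesis by (simp add: A_def B_def field_simps)
qed

text \<open>The sum of the four reciprocals is a rational function of \<open>z\<close>. It is
  bounded by an affine function whose values at the ends of the range, 4 * 82/25 and 4 * 53/25, are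
  slightly rounded up; 27/10 is the mean 82/25 - 29/50.\<close>

lemma integral_inverse_eight_dist:
  "integral {0..2 * pi} (\<lambda>t. 1 / eight_dist ((cos t)\<^sup>2)) \<le> 2 * pi * (27 / 10)"
proof -
  have "integral {0..2 * pi} (\<lambda>t. 1 / eight_dist ((cos t)\<^sup>2)) \<le> 2 * pi * (82 / 25 + (- (29 / 25)) / 2)"
  proof (rule integral_cos_square_average)
    show "continuous_on {0..1} (\<lambda>u. 1 / eight_dist u)"
      using eight_dist_pos unfolding eight_dist_def
      by (intro continuous_intros) (metis atLeastAtMost_iff less_irrefl)
    fix C S :: real assume CS: "C\<^sup>2 + S\<^sup>2 = 1"
    note b = circle_bounds[OF CS]
    note pos = b(1-4)[THEN eight_dist_pos]
    define z where "z = C\<^sup>2 * S\<^sup>2 / 16"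
    have z: "0 \<le> z" "z \<le> 1 / 64" using b(5,6) by (auto simp: z_def)
    define p where "p = eight_dist ((1 + C) / 2)"
    define q where "q = eight_dist ((1 - C) / 2)"
    define r where "r = eight_dist ((1 + S) / 2)"
    define s where "s = eight_dist ((1 - S) / 2)"
    have pos: "0 < p" "0 < q" "0 < r" "0 < s" using pos by (simp_all add: p_def q_def r_def s_def)
    have S: "S\<^sup>2 = 1 - C\<^sup>2" using CS by simp
    have prod: "p * q * (r * s) = 16 / 625 * (z\<^sup>2 + 133 * z + 17 / 4)"
      unfolding p_def q_def r_def s_def z_def by (rule eight_dist_prod[OF CS])
    have num: "(p + q) * (r * s) + (r + s) * (p * q) = 4 / 25 * (89 / 10 - 111 / 5 * z)"
      unfolding p_def q_def r_def s_def z_def eight_dist_mult eight_dist_add S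
      by (simp add: power2_eq_square field_simps)
    have "1 / p + 1 / s + 1 / q + 1 / r = ((p + q) * (r * s) + (r + s) * (p * q)) / (p * q * (r * s))"
      using pos by (simp add: field_simps)
    also have "\<dots> \<le> 4 * (82 / 25 - 29 / 25 * (64 * z))"
    proof -
      have "4 / 25 * (89 / 10 - 111 / 5 * z) \<le> 4 * (82 / 25 - 29 / 25 * (64 * z)) * (16 / 625 * (z\<^sup>2 + 133 * z + 17 / 4))"
      proof -
        have "z * z \<le> z / 64" "z * (z * z) \<le> z / 64"
          using z mult_left_mono[of z "1 / 64" z] mult_left_mono[of "z * z" "1 / 64" z] mult_mono[of z "1 / 64" z 1]
          by auto
        then show ?thesis using z by (simp add: power2_eq_square algebra_simps)
      qed
      then show ?thesis
        unfolding num prod using z by (subst pos_divide_le_eq) (auto intro!: add_nonneg_pos)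
    qed
    finally show "1 / eight_dist ((1 + C) / 2) + 1 / eight_dist ((1 - S) / 2) + 1 / eight_dist ((1 - C) / 2)
        + 1 / eight_dist ((1 + S) / 2) \<le> 4 * (82 / 25 + - (29 / 25) * (4 * C\<^sup>2 * S\<^sup>2))"
      by (simp add: p_def q_def r_def s_def z_def)
  qed
  then show ?thesis by simp
qed

text \<open>The four translates add up to the constant 17/5.\<close>

lemma integral_eight_dist:
  "integral {0..2 * pi} (\<lambda>t. eight_dist ((cos t)\<^sup>2)) \<le> 2 * pi * (17 / 20)"
proof -
  have "integral {0..2 * pi} (\<lambda>t. eight_dist ((cos t)\<^sup>2)) \<le> 2 * pi * (17 / 20 + 0 / 2)"
  proof (rule integral_cos_square_average)
    show "continuous_on {0..1} eight_dist"
      unfolding eight_dist_def by (intro continuous_intros)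
    fix C S :: real assume CS: "C\<^sup>2 + S\<^sup>2 = 1"
    have S: "S\<^sup>2 = 1 - C\<^sup>2" using CS by simp
    show "eight_dist ((1 + C) / 2) + eight_dist ((1 - S) / 2) + eight_dist ((1 - C) / 2)
        + eight_dist ((1 + S) / 2) \<le> 4 * (17 / 20 + 0 * (4 * C\<^sup>2 * S\<^sup>2))"
    proof -
      have "eight_dist ((1 + C) / 2) + eight_dist ((1 - S) / 2) + eight_dist ((1 - C) / 2)
          + eight_dist ((1 + S) / 2) \<le> 17 / 5"
      proof -
        have "eight_dist ((1 + C) / 2) + eight_dist ((1 - S) / 2) + eight_dist ((1 - C) / 2)
            + eight_dist ((1 + S) / 2) = (eight_dist ((1 + C) / 2) + eight_dist ((1 - C) / 2))
            + (eight_dist ((1 + S) / 2) + eight_dist ((1 - S) / 2))" by simp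
        also have "\<dots> = 17 / 5"
          unfolding eight_dist_add S by (simp add: field_simps)
        finally show ?thesis by simp
      qed
      then show ?thesis by simp
    qed
  qed
  then show ?thesis by simp
qed

text \<open>The integrand is interpolated in \<beta>, and the bound for its mean takes the form
  M^\<beta> (1 + \<beta> w), which is at most exp (\<beta> (ln M + w)). The power \<beta> then drops
  out, and ln M + w has to stay below the logarithm of the collision level.\<close>

lemma eight_level_bound:
  fixes \<beta> :: real
  assumes n: "2 \<le> n" and \<beta>: "0 < \<beta>" "(real n - 1) * \<beta> \<le> 1"
  shows "integral {0..2 * pi} (\<lambda>t. eight_dist ((cos t)\<^sup>2) powr (- \<beta>)) < 2 * pi * collision_level n powr \<beta>"
proof -
  let ?I = "integral {0..2 * pi}" and ?Q = "\<lambda>t. eight_dist ((cos t)\<^sup>2)"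
  \<comment> \<open>A normalization of Q that roughly balances the two outer means: those of 1 / (Q
    M) and Q M are at most 54/35 and 119/80.\<close>
  define M where "M = (7 / 4 :: real)"
  define l where "l = - (ln (68 / 625) + ln (81 / 500)) / (8 :: real)"
  have \<beta>1: "\<beta> \<le> 1"
  proof -
    have "1 * \<beta> \<le> (real n - 1) * \<beta>" using n \<beta> by (intro mult_right_mono) auto
    then show ?thesis using \<beta>(2) by linarith
  qed
  have pos: "0 < eight_dist ((cos t)\<^sup>2)" for t by (rule eight_dist_pos) simp
  have cQ: "continuous_on {0..2 * pi} (\<lambda>t. eight_dist ((cos t)\<^sup>2))"
    unfolding eight_dist_def by (intro continuous_intros)
  \<comment> \<open>The excesses of these means over 1 are 19/35 and 39/80; \<open>w\<close> uses
    the larger one for both.\<close>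
  define w where "w = (1 - \<beta>\<^sup>2) * (l - ln M) + \<beta> * (19 / 35 :: real)"
  have "?I (\<lambda>t. ?Q t powr (- \<beta>))
      \<le> ?I (\<lambda>t. M powr \<beta> * (1 - \<beta> * (1 - \<beta>\<^sup>2) * ln M - \<beta>\<^sup>2 + \<beta> * (1 - \<beta>\<^sup>2) * (- ln (?Q t))
          + \<beta>\<^sup>2 * ((1 + \<beta>) / 2) / M * (1 / ?Q t) + \<beta>\<^sup>2 * ((1 - \<beta>) / 2) * M * ?Q t))"
  proof (rule integral_le)
    fix t
    define Q where "Q = eight_dist ((cos t)\<^sup>2)"
    have Q: "0 < Q" using pos by (simp add: Q_def)
    define x where "x = - ln Q - ln M"
    have ex: "exp x = 1 / (Q * M)" "exp (- x) = Q * M"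
    proof -
      have QM: "0 < Q * M" using Q by (simp add: M_def)
      have "ln (Q * M) = ln Q + ln M" using Q by (intro ln_mult_pos) (auto simp: M_def)
      then have "x = - ln (Q * M)" by (simp add: x_def)
      then show "exp x = 1 / (Q * M)" "exp (- x) = Q * M"
        using QM by (simp_all only: exp_minus exp_ln minus_minus inverse_eq_divide)
    qed
    have "Q powr (- \<beta>) = exp (\<beta> * ln M + \<beta> * x)"
      using Q by (simp add: powr_def x_def algebra_simps)
    also have "\<dots> = M powr \<beta> * exp (\<beta> * x)"
      unfolding exp_add by (simp add: powr_def M_def)
    also have "\<dots> \<le> M powr \<beta> * (1 + \<beta> * x + \<beta>\<^sup>2 * ((1 + \<beta>) / 2 * (exp x - 1 - x) + (1 - \<beta>) / 2 * (exp (- x) - 1 + x)))"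
      using \<beta> \<beta>1 by (intro mult_left_mono exp_interpolation) auto
    also have "1 + \<beta> * x + \<beta>\<^sup>2 * ((1 + \<beta>) / 2 * (exp x - 1 - x) + (1 - \<beta>) / 2 * (exp (- x) - 1 + x))
        = 1 - \<beta>\<^sup>2 + \<beta> * (1 - \<beta>\<^sup>2) * x + \<beta>\<^sup>2 * ((1 + \<beta>) / 2) * exp x + \<beta>\<^sup>2 * ((1 - \<beta>) / 2) * exp (- x)"
      by (simp add: power2_eq_square field_simps)
    also have "\<dots> = 1 - \<beta> * (1 - \<beta>\<^sup>2) * ln M - \<beta>\<^sup>2 + \<beta> * (1 - \<beta>\<^sup>2) * (- ln Q)
          + \<beta>\<^sup>2 * ((1 + \<beta>) / 2) / M * (1 / Q) + \<beta>\<^sup>2 * ((1 - \<beta>) / 2) * M * Q"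
    proof -
      have "\<beta>\<^sup>2 * ((1 + \<beta>) / 2) * (1 / (Q * M)) = \<beta>\<^sup>2 * ((1 + \<beta>) / 2) / M * (1 / Q)"
        "\<beta>\<^sup>2 * ((1 - \<beta>) / 2) * (Q * M) = \<beta>\<^sup>2 * ((1 - \<beta>) / 2) * M * Q"
        by simp_all
      moreover have "\<beta> * (1 - \<beta>\<^sup>2) * x = \<beta> * (1 - \<beta>\<^sup>2) * (- ln Q) - \<beta> * (1 - \<beta>\<^sup>2) * ln M"
        unfolding x_def by (rule right_diff_distrib)
      ultimately show ?thesis unfolding ex by linarith
    qed
    finally show "Q powr (- \<beta>) \<le> M powr \<beta> * (1 - \<beta> * (1 - \<beta>\<^sup>2) * ln M - \<beta>\<^sup>2 + \<beta> * (1 - \<beta>\<^sup>2) * (- ln Q)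
          + \<beta>\<^sup>2 * ((1 + \<beta>) / 2) / M * (1 / Q) + \<beta>\<^sup>2 * ((1 - \<beta>) / 2) * M * Q)" .
  qed (use pos in \<open>auto intro!: integrable_continuous_real continuous_intros cQ simp: M_def less_imp_neq[symmetric]\<close>)
  also have "\<dots> = M powr \<beta> * (2 * pi * (1 - \<beta> * (1 - \<beta>\<^sup>2) * ln M - \<beta>\<^sup>2)
      + \<beta> * (1 - \<beta>\<^sup>2) * ?I (\<lambda>t. - ln (?Q t))
      + \<beta>\<^sup>2 * ((1 + \<beta>) / 2) / M * ?I (\<lambda>t. 1 / ?Q t)
      + \<beta>\<^sup>2 * ((1 - \<beta>) / 2) * M * ?I ?Q)"
  proof -
    have i: "(\<lambda>t. - ln (?Q t)) integrable_on {0..2 * pi}"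
      "(\<lambda>t. 1 / ?Q t) integrable_on {0..2 * pi}"
      "?Q integrable_on {0..2 * pi}"
      using pos by (auto intro!: integrable_continuous_real continuous_intros cQ simp: less_imp_neq[symmetric])
    have "((\<lambda>t. M powr \<beta> * (k + a * (- ln (?Q t)) + b * (1 / ?Q t)
        + c * ?Q t)) has_integral
        M powr \<beta> * (2 * pi * k + a * ?I (\<lambda>t. - ln (?Q t)) + b * ?I (\<lambda>t. 1 / ?Q t)
        + c * ?I ?Q)) {0..2 * pi}" for k a b c
      using has_integral_const_real[of k 0 "2 * pi"]
      by (intro has_integral_mult_right has_integral_add integrable_integral i) auto
    then show ?thesis by (rule integral_unique)
  qed
  also have "\<dots> \<le> M powr \<beta> * (2 * pi * (1 - \<beta> * (1 - \<beta>\<^sup>2) * ln M - \<beta>\<^sup>2)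
      + \<beta> * (1 - \<beta>\<^sup>2) * (2 * pi * l)
      + \<beta>\<^sup>2 * ((1 + \<beta>) / 2) / M * (2 * pi * (27 / 10))
      + \<beta>\<^sup>2 * ((1 - \<beta>) / 2) * M * (2 * pi * (17 / 20)))"
  proof -
    have "\<beta>\<^sup>2 \<le> 1" using \<beta> \<beta>1 by (simp add: abs_square_le_1)
    then show ?thesis
      using integral_ln_eight_dist integral_inverse_eight_dist integral_eight_dist \<beta> \<beta>1
      by (intro mult_left_mono add_mono order_refl) (auto simp: l_def M_def)
  qed
  also have "\<dots> \<le> 2 * pi * (M powr \<beta> * (1 + \<beta> * w))"
  proof -
    have eq: "M powr \<beta> * (2 * pi * (1 - \<beta> * (1 - \<beta>\<^sup>2) * ln M - \<beta>\<^sup>2)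
      + \<beta> * (1 - \<beta>\<^sup>2) * (2 * pi * l)
      + \<beta>\<^sup>2 * ((1 + \<beta>) / 2) / M * (2 * pi * (27 / 10))
      + \<beta>\<^sup>2 * ((1 - \<beta>) / 2) * M * (2 * pi * (17 / 20)))
      = 2 * pi * (M powr \<beta> * (1 + \<beta> * ((1 - \<beta>\<^sup>2) * (l - ln M)
          + \<beta> * ((1 + \<beta>) / 2 * (19 / 35) + (1 - \<beta>) / 2 * (39 / 80)))))"
      by (simp add: M_def power2_eq_square field_simps)
    have "(1 + \<beta>) / 2 * (19 / 35) + (1 - \<beta>) / 2 * (39 / 80) \<le> 19 / 35"
      using \<beta>1 by (simp add: field_simps)
    then show ?thesis
      unfolding eq w_def using \<beta> by (intro mult_left_mono add_left_mono) auto
  qed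
  also have "\<dots> \<le> 2 * pi * (M powr \<beta> * exp (\<beta> * w))"
    by (intro mult_left_mono exp_ge_add_one_self) auto
  also have "M powr \<beta> * exp (\<beta> * w) = exp (\<beta> * (ln M + w))"
    by (simp add: powr_def M_def distrib_left exp_add)
  also have "2 * pi * exp (\<beta> * (ln M + w)) < 2 * pi * collision_level n powr \<beta>"
  proof -
    have lnM: "ln M \<le> 14 / 25"
    proof -
      have "M \<le> (\<Sum>k<5. (14 / 25) ^ k / fact k)"
        by (simp add: M_def eval_nat_numeral)
      also have "\<dots> \<le> exp (14 / 25)" by (rule exp_ge_partial_sum) simp
      finally show ?thesis by (rule ln_le_if_le_exp) (simp add: M_def)
    qed
    \<comment> \<open>Eight times the bound is 101/25, which is 4 * 101/100. Raising a partial sum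
      at 101/100 to the fourth power needs fewer terms than one at 101/25.\<close>
    have l: "l \<le> 101 / 200"
    proof -
      have "(1 / ((68 / 625) * (81 / 500)) :: real) \<le> (\<Sum>k<7. (101 / 100) ^ k / fact k) ^ 4"
        by (simp add: eval_nat_numeral)
      also have "\<dots> \<le> exp (101 / 100) ^ 4"
        by (intro power_mono exp_ge_partial_sum sum_nonneg) auto
      also have "\<dots> = exp (101 / 25)" by (simp flip: exp_of_nat_mult)
      finally have "ln (1 / ((68 / 625) * (81 / 500))) \<le> (101 / 25 :: real)"
        by (rule ln_le_if_le_exp) simp
      moreover have "ln (1 / (a * b)) = - (ln a + ln b)" if "0 < a" "0 < b" for a b :: real
        using that by (simp add: ln_div ln_mult)
      from this[of "68 / 625" "81 / 500"]
      have "ln (1 / ((68 / 625) * (81 / 500))) = - (ln (68 / 625) + ln (81 / 500 :: real))"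
        by (simp only: zero_less_divide_iff zero_less_numeral simp_thms)
      ultimately have "- (ln (68 / 625) + ln (81 / 500)) \<le> (101 / 25 :: real)"
        by (simp only:)
      from divide_right_mono[OF this, of 8] show ?thesis
        unfolding l_def by simp
    qed
    have lnpi: "ln (pi / 2) \<le> 4517 / 10000"
    proof -
      have "pi / 2 \<le> 15708 / 10000" using pi_approx(2) by simp
      also have "\<dots> \<le> (\<Sum>k<6. (4517 / 10000) ^ k / fact k)"
        by (simp add: eval_nat_numeral)
      also have "\<dots> \<le> exp (4517 / 10000)" by (rule exp_ge_partial_sum) simp
      finally show ?thesis by (rule ln_le_if_le_exp) simp
    qed
    have "ln M + w = \<beta>\<^sup>2 * ln M + (1 - \<beta>\<^sup>2) * l + \<beta> * (19 / 35)"
      by (simp add: w_def algebra_simps)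
    also have "\<dots> \<le> \<beta>\<^sup>2 * (14 / 25) + (1 - \<beta>\<^sup>2) * (101 / 200) + \<beta> * (19 / 35)"
      using lnM l \<beta> \<beta>1 by (intro add_mono mult_left_mono) (auto simp: abs_square_le_1)
    also have "\<dots> = 101 / 200 + \<beta>\<^sup>2 * (11 / 200) + \<beta> * (19 / 35)"
      by (simp add: field_simps)
    finally have up: "ln M + w \<le> 101 / 200 + \<beta>\<^sup>2 * (11 / 200) + \<beta> * (19 / 35)" .
    \<comment> \<open>The Wallis bound replaces \<open>collision_const n\<close> by 2 n / (pi (n +
      1)); what is left is explicit in \<open>n\<close>.\<close>
    have "- (4517 / 10000) + ln (real n / (real n + 1)) + (real n + 1) * ln (real n / (real n - 1)) \<le> ln (collision_level n)"
    proof -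
      have "2 / pi * (real n / (real n + 1)) \<le> collision_const n"
      proof -
        have "real n * (2 * pi / real (Suc n)) / pi\<^sup>2 \<le> collision_const n"
          unfolding collision_const_def
          by (intro divide_right_mono mult_left_mono sin_integral_square_ge) auto
        then show ?thesis by (simp add: power2_eq_square ac_simps)
      qed
      then have "2 / pi * (real n / (real n + 1)) * (real n / (real n - 1)) ^ Suc n \<le> collision_level n"
        unfolding collision_level_def using n by (intro mult_right_mono) auto
      moreover have "0 < 2 / pi * (real n / (real n + 1)) * (real n / (real n - 1)) ^ Suc n"
        using n by (intro mult_pos_pos zero_less_power) auto
      ultimately have "ln (2 / pi * (real n / (real n + 1)) * (real n / (real n - 1)) ^ Suc n) \<le> ln (collision_level n)"
        by simp
      moreover have "ln (2 / pi * (real n / (real n + 1)) * (real n / (real n - 1)) ^ Suc n)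
          = ln (2 / pi) + ln (real n / (real n + 1)) + (real n + 1) * ln (real n / (real n - 1))"
      proof -
        have "ln (x * y * z ^ Suc n) = ln x + ln y + (real n + 1) * ln z"
          if "0 < x" "0 < y" "0 < z" for x y z :: real
        proof -
          have "ln (x * y * z ^ Suc n) = ln x + ln y + ln (z ^ Suc n)"
            using that by (simp add: ln_mult del: power_Suc)
          then show ?thesis
            using that by (simp add: ln_realpow del: power_Suc)
        qed
        from this[of "2 / pi" "real n / (real n + 1)" "real n / (real n - 1)"]
        show ?thesis using n by (auto simp del: power_Suc times_divide_eq_left times_divide_eq_right times_divide_times_eq)
      qed
      moreover have "ln (2 / pi) = - ln (pi / 2)" by (simp add: ln_div)
      ultimately show ?thesis using lnpi by linarith
    qed
    note low = this
    have "ln M + w < ln (collision_level n)"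
    \<comment> \<open>Here \<beta> ranges up to 1 and the margin is small: the rational estimate for
      larger \<open>n\<close> would fail. The logarithms of 2 and 3 are estimated directly
      instead.\<close>
    proof (cases "n = 2")
      case True
      have "ln (3::real) \<le> 11 / 10"
      proof -
        have "(3::real) \<le> (\<Sum>k<6. (11 / 10) ^ k / fact k)"
          by (simp add: eval_nat_numeral)
        also have "\<dots> \<le> exp (11 / 10)" by (rule exp_ge_partial_sum) simp
        finally show ?thesis by (rule ln_le_if_le_exp) simp
      qed
      moreover have "ln (2 / 3 :: real) = ln 2 - ln 3" by (simp add: ln_div)
      moreover have "\<beta>\<^sup>2 \<le> 1" using \<beta> \<beta>1 by (simp add: abs_square_le_1)
      ultimately show ?thesis
        using up low True ln2_ge_two_thirds \<beta>1 by simp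
    next
      case False
      \<comment> \<open>In this variable the lower bound becomes a rational function on the interval
        from 0 to 1/2, and \<open>b\<close> is also the largest admissible \<beta>.\<close>
      define b where "b = 1 / (real n - 1)"
      have n3: "3 \<le> n" using n False by simp
      have b: "0 < b" "b \<le> 1 / 2" using n3 by (simp_all add: b_def field_simps)
      have \<beta>b: "\<beta> \<le> b" using \<beta>(2) n3 by (simp add: b_def field_simps)
      have nb: "real n = 1 + 1 / b" using n3 by (simp add: b_def)
      have rn: "real n / (real n - 1) = 1 + b" "real n / (real n + 1) = 1 / (1 + b / (1 + b))"
        "real n + 1 = 1 / b + 2"
      proof -
        have "1 + 1 / b = (1 + b) / b" "1 + 1 / b + 1 = (1 + 2 * b) / b" "1 + b / (1 + b) = (1 + 2 * b) / (1 + b)"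
          "(1 + b) / b - 1 = 1 / b"
          using b by (simp_all add: field_simps)
        then show "real n / (real n - 1) = 1 + b" "real n / (real n + 1) = 1 / (1 + b / (1 + b))"
          "real n + 1 = 1 / b + 2"
          unfolding nb using b by (simp_all add: distrib_right)
      qed
      note low' = low[unfolded rn(1,2), unfolded rn(3)]
      have "2 * b / (2 + b) \<le> ln (1 + b)"
        using b by (intro ln_one_plus_ge) auto
      then have "(1 / b + 2) * (2 * b / (2 + b)) \<le> (1 / b + 2) * ln (1 + b)"
        using b by (intro mult_left_mono) auto
      moreover have "(1 / b + 2) * (2 * b / (2 + b)) = 1 + 3 * b / (2 + b)"
      proof -
        have "1 / b + 2 = (1 + 2 * b) / b" "1 + 3 * b / (2 + b) = 2 * (1 + 2 * b) / (2 + b)"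
          using b by (simp_all add: field_simps)
        then show ?thesis using b by simp
      qed
      moreover have "- (b / (1 + b)) \<le> ln (1 / (1 + b / (1 + b)))"
      proof -
        have "ln (1 + b / (1 + b)) \<le> b / (1 + b)"
          using b by (intro ln_add_one_self_le_self) auto
        moreover have "ln (1 / (1 + b / (1 + b))) = - ln (1 + b / (1 + b))"
        proof -
          have "ln (1 / c) = - ln c" if "0 < c" for c :: real
            using that by (simp add: ln_div)
          moreover have "0 < 1 + b / (1 + b)" using b by (intro add_pos_pos) auto
          ultimately show ?thesis by blast
        qed
        ultimately show ?thesis by simp
      qed
      ultimately have low2: "- (4517 / 10000) - b / (1 + b) + 1 + 3 * b / (2 + b) \<le> ln (collision_level n)"
        using low' by linarith
      have "101 / 200 + \<beta>\<^sup>2 * (11 / 200) + \<beta> * (19 / 35) \<le> 101 / 200 + b\<^sup>2 * (11 / 200) + b * (19 / 35)"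
        using \<beta>b \<beta> by (intro add_mono mult_right_mono power_mono) auto
      also have "\<dots> < - (4517 / 10000) - b / (1 + b) + 1 + 3 * b / (2 + b)"
      proof -
        have e: "- (b / (1 + b)) + 3 * b / (2 + b) = b * (1 + 2 * b) / ((1 + b) * (2 + b))"
        proof -
          have "b / (1 + b) = b * (2 + b) / ((1 + b) * (2 + b))"
            "3 * b / (2 + b) = 3 * b * (1 + b) / ((1 + b) * (2 + b))"
            using b by simp_all
          moreover have "b * (1 + 2 * b) = 3 * b * (1 + b) - b * (2 + b)"
            by (simp add: algebra_simps)
          ultimately show ?thesis by (simp add: diff_divide_distrib)
        qed
        \<comment> \<open>433/10000 is 1 - 4517/10000 - 101/200, the sum of the constants on both
          sides. After clearing denominators the powers of \<open>b\<close> are bounded by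
          \<open>b * b\<close>.\<close>
        have "(b * (19 / 35) + b\<^sup>2 * (11 / 200) - 433 / 10000) * ((1 + b) * (2 + b)) < b * (1 + 2 * b)"
        proof -
          define x y z where "x = b * b" and "y = x * b" and "z = y * b"
          have x: "x \<le> 1 / 4" "0 \<le> x"
            using b mult_mono[of b "1 / 2" b "1 / 2"] by (auto simp: x_def)
          moreover have y: "y \<le> x / 2" "0 \<le> y"
            using b x mult_left_mono[of b "1 / 2" x] by (auto simp: y_def)
          moreover have "z \<le> x / 2"
            using b x y mult_left_mono[of b 1 y] by (auto simp: z_def)
          moreover have e1: "(b * (19 / 35) + b\<^sup>2 * (11 / 200) - 433 / 10000) * ((1 + b) * (2 + b))
              = - 866 / 10000 + 66907 / 70000 * b + 118669 / 70000 * x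
                + 991 / 1400 * y + 11 / 200 * z"
            by (simp add: x_def y_def z_def power2_eq_square field_simps)
          moreover have e2: "b * (1 + 2 * b) = b + 2 * x"
            by (simp add: x_def algebra_simps)
          ultimately show ?thesis
            unfolding e1 e2 using b by linarith
        qed
        then have "b * (19 / 35) + b\<^sup>2 * (11 / 200) - 433 / 10000 < b * (1 + 2 * b) / ((1 + b) * (2 + b))"
          using b by (subst pos_less_divide_eq) auto
        then show ?thesis using e by linarith
      qed
      finally show ?thesis using up low2 by linarith
    qed
    then have "\<beta> * (ln M + w) < \<beta> * ln (collision_level n)"
      using \<beta> by (intro mult_strict_left_mono)
    then show ?thesis
      using collision_level_pos[OF n] by (simp add: powr_def)
  qed
  finally show ?thesis .
qed

section \<open>Collisions in the symmetry class\<close>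

lemma has_weak_derivative_bounded_linear:
  fixes L :: "'a::euclidean_space \<Rightarrow> 'b::euclidean_space"
  assumes L: "bounded_linear L" and x: "has_weak_derivative x g"
  shows "has_weak_derivative (\<lambda>t. L (x t)) (\<lambda>t. L (g t))"
  unfolding has_weak_derivative_def
proof (intro conjI allI ballI)
  interpret L: bounded_linear L by fact
  note dx = has_weak_derivativeD[OF x]
  show "L (x (t + 2 * pi)) = L (x t)" for t by (simp only: dx(1))
  show m: "(\<lambda>t. L (g t)) \<in> borel_measurable borel"
    by (rule measurable_compose[OF dx(2)])
      (intro borel_measurable_continuous_onI linear_continuous_on L)
  obtain B where B: "\<And>u. norm (L u) \<le> norm u * B" "0 \<le> B"
    using L.nonneg_bounded by blast
  show "set_integrable lborel {0..2 * pi} (\<lambda>t. (norm (L (g t)))\<^sup>2)"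
  proof (rule set_integrable_bound)
    show "set_integrable lborel {0..2 * pi} (\<lambda>t. B\<^sup>2 * (norm (g t))\<^sup>2)"
      using dx(3) by simp
    show "set_borel_measurable lborel {0..2 * pi} (\<lambda>t. (norm (L (g t)))\<^sup>2)"
      using m by (auto simp: set_borel_measurable_def)
    have "(norm (L u))\<^sup>2 \<le> B\<^sup>2 * (norm u)\<^sup>2" for u
      using power_mono[OF B(1)[of u], of 2] by (simp add: power_mult_distrib mult.commute)
    then show "AE t in lborel. t \<in> {0..2 * pi} \<longrightarrow> norm ((norm (L (g t)))\<^sup>2) \<le> norm (B\<^sup>2 * (norm (g t))\<^sup>2)"
      by simp
  qed
  fix t assume t: "t \<in> {0..2 * pi}"
  have "integrable lborel (\<lambda>s. indicator {0..t} s *\<^sub>R g s)"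
    using set_integrable_subset[OF dx(4), of "{0..t}"] t by (simp add: set_integrable_def)
  from integral_bounded_linear[OF L this]
  have "(LINT s:{0..t}|lborel. L (g s)) = L (LINT s:{0..t}|lborel. g s)"
    by (simp add: set_lebesgue_integral_def L.scaleR)
  moreover have "L (x t) = L (x 0) + L (LINT s:{0..t}|lborel. g s)"
    using arg_cong[OF dx(5)[OF t], of L] by (simp only: L.add)
  ultimately show "L (x t) = L (x 0) + (LINT s:{0..t}|lborel. L (g s))"
    by simp
qed

section \<open>Configurations and mutual positions\<close>

lemma three_eq_zero [simp]: "(3 :: 3) = 0"
  by simp

lemma sum_UNIV_3: "sum f (UNIV :: 3 set) = f 0 + f 1 + f 2"
  by (simp add: sum_3 ac_simps)

lemma norm_configuration_square:
  "(norm z)\<^sup>2 = (norm (z $ 0))\<^sup>2 + (norm (z $ 1))\<^sup>2 + (norm (z $ 2))\<^sup>2" for z :: configuration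
  by (simp add: power2_norm_eq_inner inner_vec_def[of z] sum_UNIV_3)

lemma norm_plane_square: "(norm v)\<^sup>2 = (v $ 1)\<^sup>2 + (v $ 2)\<^sup>2" for v :: "real ^ 2"
  unfolding power2_norm_eq_inner inner_vec_def sum_2 by (simp add: power2_eq_square)

lemma kinetic_eq: "kinetic m x = m / 2 * energy x"
proof -
  have "(\<Sum>i\<in>UNIV. m * (norm (velocity x t $ i))\<^sup>2) = m * (norm (velocity x t))\<^sup>2" for t
    unfolding norm_configuration_square sum_UNIV_3 by (simp add: algebra_simps)
  then show ?thesis
    by (simp add: kinetic_def energy_def)
qed

lemma collision_iff: "collision z \<longleftrightarrow> z $ 0 = z $ 1 \<or> z $ 1 = z $ 2 \<or> z $ 0 = z $ 2"
proof -
  have c: "i = 0 \<or> i = 1 \<or> i = 2" for i :: 3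
    using exhaust_3[of i] by auto
  have d: "(0 :: 3) \<noteq> 1" "(1 :: 3) \<noteq> 2" "(0 :: 3) \<noteq> 2" by simp_all
  show ?thesis
  proof
    assume "collision z"
    then obtain i j where "i \<noteq> j" "z $ i = z $ j" unfolding collision_def by blast
    then show "z $ 0 = z $ 1 \<or> z $ 1 = z $ 2 \<or> z $ 0 = z $ 2"
      using c[of i] c[of j] by auto
  next
    assume "z $ 0 = z $ 1 \<or> z $ 1 = z $ 2 \<or> z $ 0 = z $ 2"
    then show "collision z" unfolding collision_def using d by blast
  qed
qed

lemma potential_eq:
  "potential \<alpha> m z = (if collision z then \<infinity> else ennreal (m\<^sup>2 * (norm (z $ 0 - z $ 1) powr (- \<alpha>)
      + norm (z $ 1 - z $ 2) powr (- \<alpha>) + norm (z $ 0 - z $ 2) powr (- \<alpha>))))"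
  unfolding potential_def
  by (simp add: numeral_3_eq_3 lessThan_Suc algebra_simps)

text \<open>In \<open>ennreal\<close> the infinite summand of a colliding pair yields the infinite
  total by itself, so that the integral can be split into pairs without a case distinction.\<close>

lemma potential_eq_sum:
  assumes "0 < m"
  shows "potential \<alpha> m z = ennreal (m\<^sup>2) * (power_potential \<alpha> (norm (z $ 0 - z $ 1))
      + power_potential \<alpha> (norm (z $ 1 - z $ 2)) + power_potential \<alpha> (norm (z $ 0 - z $ 2)))"
proof (cases "collision z")
  case True
  have "ennreal (m\<^sup>2) * \<infinity> = \<infinity>" using assms by (simp add: ennreal_mult_top)
  then show ?thesis
    using True unfolding potential_eq collision_iff by (auto simp: power_potential_def)
next
  case False
  then have "z $ 0 \<noteq> z $ 1" "z $ 1 \<noteq> z $ 2" "z $ 0 \<noteq> z $ 2" by (auto simp: collision_iff)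
  then show ?thesis
    using False by (simp add: potential_eq power_potential_def ennreal_mult ennreal_plus[symmetric] del: ennreal_plus)
qed

lift_definition pair_loop :: "3 \<Rightarrow> 3 \<Rightarrow> configuration h1loop \<Rightarrow> (real ^ 2) h1loop" is
  "\<lambda>i j x t. x t $ i - x t $ j"
proof -
  fix i j :: 3 and x :: "real \<Rightarrow> configuration" assume "\<exists>g. has_weak_derivative x g"
  then obtain g where "has_weak_derivative x g" by blast
  from has_weak_derivative_bounded_linear[OF bounded_linear_sub[OF bounded_linear_vec_nth bounded_linear_vec_nth] this]
  show "\<exists>g. has_weak_derivative (\<lambda>t. x t $ i - x t $ j) g"
    by blast
qed

text \<open>Lagrange's identity: the squared differences of three vectors and the square of their
  sum add up to three times the sum of the squares. Dropping the velocity of the centre of mass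
  gives the inequality.\<close>

lemma energy_pair_loop_sum:
  "energy (pair_loop 0 1 x) + energy (pair_loop 1 2 x) + energy (pair_loop 0 2 x) \<le> 3 * energy x"
proof -
  let ?v = "velocity x"
  have d: "has_weak_derivative (curve (pair_loop i j x)) (\<lambda>t. ?v t $ i - ?v t $ j)" for i j
    unfolding pair_loop.rep_eq
    by (rule has_weak_derivative_bounded_linear[OF _ has_weak_derivative_velocity, of "\<lambda>z. z $ i - z $ j"])
      (intro bounded_linear_sub bounded_linear_vec_nth)
  note i = has_weak_derivativeD(3)[OF d]
  have "energy (pair_loop 0 1 x) + energy (pair_loop 1 2 x) + energy (pair_loop 0 2 x)
      = (LINT t:{0..2 * pi}|lborel. (norm (?v t $ 0 - ?v t $ 1))\<^sup>2 + (norm (?v t $ 1 - ?v t $ 2))\<^sup>2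
          + (norm (?v t $ 0 - ?v t $ 2))\<^sup>2)"
    unfolding energy_eq[OF d]
    using set_integral_add(2)[OF set_integral_add(1)[OF i i] i] set_integral_add(2)[OF i i] by simp
  also have "\<dots> \<le> (LINT t:{0..2 * pi}|lborel. 3 * (norm (?v t))\<^sup>2)"
  proof (rule set_integral_mono)
    show "set_integrable lborel {0..2 * pi} (\<lambda>t. (norm (?v t $ 0 - ?v t $ 1))\<^sup>2 + (norm (?v t $ 1 - ?v t $ 2))\<^sup>2
          + (norm (?v t $ 0 - ?v t $ 2))\<^sup>2)"
      by (intro set_integral_add(1) i)
    show "set_integrable lborel {0..2 * pi} (\<lambda>t. 3 * (norm (?v t))\<^sup>2)"
      using velocityD(3) by simp
    show "(norm (?v t $ 0 - ?v t $ 1))\<^sup>2 + (norm (?v t $ 1 - ?v t $ 2))\<^sup>2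
          + (norm (?v t $ 0 - ?v t $ 2))\<^sup>2 \<le> 3 * (norm (?v t))\<^sup>2" for t
    proof -
      have "(norm (a - b))\<^sup>2 + (norm (b - c))\<^sup>2 + (norm (a - c))\<^sup>2 + (norm (a + b + c))\<^sup>2
          = 3 * ((norm a)\<^sup>2 + (norm b)\<^sup>2 + (norm c)\<^sup>2)" for a b c :: "real ^ 2"
        by (simp add: power2_norm_eq_inner inner_diff inner_add inner_commute)
      from this[of "?v t $ 0" "?v t $ 1" "?v t $ 2"] show ?thesis
        unfolding norm_configuration_square using zero_le_power2[of "norm (?v t $ 0 + ?v t $ 1 + ?v t $ 2)"]
        by linarith
    qed
  qed
  also have "\<dots> = 3 * energy x" by (simp add: energy_def)
  finally show ?thesis .
qed

lemma potential_integral_eq: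
  assumes "0 < m"
  shows "potential_integral \<alpha> m x = ennreal (m\<^sup>2) *
    (loop_potential \<alpha> (pair_loop 0 1 x)
    + loop_potential \<alpha> (pair_loop 1 2 x)
    + loop_potential \<alpha> (pair_loop 0 2 x))"
proof -
  let ?p = "\<lambda>i j t. power_potential \<alpha> (norm (curve (pair_loop i j x) t)) * indicator {0..2 * pi} t"
  have "potential_integral \<alpha> m x = (\<integral>\<^sup>+t. ennreal (m\<^sup>2) * (?p 0 1 t + ?p 1 2 t + ?p 0 2 t) \<partial>lborel)"
    unfolding potential_integral_def
    by (intro nn_integral_cong) (auto simp: potential_eq_sum[OF assms] pair_loop.rep_eq indicator_def)
  also have "\<dots> = ennreal (m\<^sup>2) * (\<integral>\<^sup>+t. ?p 0 1 t + ?p 1 2 t + ?p 0 2 t \<partial>lborel)"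
    by (rule nn_integral_cmult) measurable
  also have "(\<integral>\<^sup>+t. ?p 0 1 t + ?p 1 2 t + ?p 0 2 t \<partial>lborel)
      = (\<integral>\<^sup>+t. ?p 0 1 t \<partial>lborel) + (\<integral>\<^sup>+t. ?p 1 2 t \<partial>lborel) + (\<integral>\<^sup>+t. ?p 0 2 t \<partial>lborel)"
    by (simp add: nn_integral_add)
  finally show ?thesis unfolding loop_potential_def .
qed

section \<open>Collisions of symmetric loops\<close>

lemma antiperiodic_zero_reduce:
  fixes Z :: "real \<Rightarrow> bool"
  assumes Z: "\<And>t. Z (t + pi) \<longleftrightarrow> Z t" and t: "Z t"
  obtains s where "0 \<le> s" "s < pi" "Z s" "Z (s + pi)"
proof -
  have n: "Z (t + pi * real n) \<longleftrightarrow> Z t" for n t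
  proof (induction n)
    case (Suc n)
    have "t + pi * real (Suc n) = (t + pi * real n) + pi" by (simp add: algebra_simps)
    then show ?case using Suc by (simp only: Z)
  qed simp
  define k where "k = \<lfloor>t / pi\<rfloor>"
  define s where "s = t - pi * of_int k"
  have "of_int k * pi \<le> t" "t < (of_int k + 1) * pi"
    unfolding k_def by (simp_all flip: pos_le_divide_eq pos_divide_less_eq)
  then have "0 \<le> s" "s < pi" by (simp_all add: s_def algebra_simps)
  moreover have "Z s"
  proof (cases "0 \<le> k")
    case True
    then show ?thesis using n[of s "nat k"] t by (simp add: s_def)
  next
    case False
    then show ?thesis using n[of t "nat (- k)"] t by (simp add: s_def)
  qed
  ultimately show thesis using Z that by blast
qed

lemma H_eightE:
  assumes "x \<in> H_eight"
  obtains \<gamma> where "eight_generator \<gamma>" "\<And>t. curve x t $ 0 = curve \<gamma> t"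
    "\<And>t. curve x t $ 1 = curve \<gamma> (t + 2 * pi / 3)" "\<And>t. curve x t $ 2 = curve \<gamma> (t + 4 * pi / 3)"
proof -
  obtain \<gamma> where \<gamma>: "eight_generator \<gamma>"
    "\<And>i t. i < (3::nat) \<Longrightarrow> curve x t $ of_nat i = curve \<gamma> (t + 2 * pi * real i / 3)"
    using assms unfolding H_eight_def by blast
  show thesis
    using that[OF \<gamma>(1)] \<gamma>(2)[of 0] \<gamma>(2)[of 1] \<gamma>(2)[of 2] by (simp add: mult.commute)
qed

text \<open>
  Up to sign the three mutual positions are translates in time of one loop, whose zeros are
  \<open>\<pi>\<close>-periodic by (A\<open>\<^sub>x\<close>); hence a single collision makes every pair collide after every time \<open>\<pi>\<close>.
\<close>

lemma H_eight_collision_zeros: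
  assumes x: "x \<in> H_eight" and col: "\<not> collision_free x" and ij: "(i, j) \<in> {(0, 1), (1, 2), (0, 2)}"
  obtains s where "0 \<le> s" "s < pi" "curve (pair_loop i j x) s = 0" "curve (pair_loop i j x) (s + pi) = 0"
proof -
  obtain \<gamma> where \<gamma>: "eight_generator \<gamma>" and x012: "\<And>t. curve x t $ 0 = curve \<gamma> t"
    "\<And>t. curve x t $ 1 = curve \<gamma> (t + 2 * pi / 3)" "\<And>t. curve x t $ 2 = curve \<gamma> (t + 4 * pi / 3)"
    using H_eightE[OF x] by metis
  define Z where "Z t \<longleftrightarrow> curve \<gamma> (t + 2 * pi / 3) = curve \<gamma> t" for t
  have Zpi: "Z (t + pi) \<longleftrightarrow> Z t" for t
  proof -
    have r: "curve \<gamma> (t + pi) = vector [curve \<gamma> t $ 1, - (curve \<gamma> t $ 2)]" for t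
      using \<gamma> unfolding eight_generator_def by blast
    have e: "t + pi + 2 * pi / 3 = (t + 2 * pi / 3) + pi" by simp
    show ?thesis
      unfolding Z_def e r by (auto simp: vec_eq_iff forall_2)
  qed
  have pair: "curve (pair_loop 0 1 x) t = 0 \<longleftrightarrow> Z t" "curve (pair_loop 1 2 x) t = 0 \<longleftrightarrow> Z (t + 2 * pi / 3)"
    "curve (pair_loop 0 2 x) t = 0 \<longleftrightarrow> Z (t + 4 * pi / 3)" for t
  proof -
    show "curve (pair_loop 0 1 x) t = 0 \<longleftrightarrow> Z t"
      by (auto simp: pair_loop.rep_eq x012 Z_def)
    have e: "t + 2 * pi / 3 + 2 * pi / 3 = t + 4 * pi / 3" by simp
    show "curve (pair_loop 1 2 x) t = 0 \<longleftrightarrow> Z (t + 2 * pi / 3)"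
      unfolding pair_loop.rep_eq x012 Z_def e right_minus_eq by (rule eq_commute)
    have "t + 4 * pi / 3 + 2 * pi / 3 = t + 2 * pi" by simp
    then have "curve \<gamma> (t + 4 * pi / 3 + 2 * pi / 3) = curve \<gamma> t"
      by (simp only: curve_periodic)
    then show "curve (pair_loop 0 2 x) t = 0 \<longleftrightarrow> Z (t + 4 * pi / 3)"
      by (auto simp: pair_loop.rep_eq x012 Z_def)
  qed
  obtain t where "collision (curve x t)" using col unfolding collision_free_def by blast
  then have "curve (pair_loop 0 1 x) t = 0 \<or> curve (pair_loop 1 2 x) t = 0 \<or> curve (pair_loop 0 2 x) t = 0"
    by (auto simp: collision_iff pair_loop.rep_eq)
  then obtain t0 where t0: "Z t0" using pair by blast
  obtain c where c: "\<And>t. curve (pair_loop i j x) t = 0 \<longleftrightarrow> Z (t + c)"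
  proof -
    have "\<exists>c. \<forall>t. curve (pair_loop i j x) t = 0 \<longleftrightarrow> Z (t + c)"
    proof -
      consider "i = 0 \<and> j = 1" | "i = 1 \<and> j = 2" | "i = 0 \<and> j = 2" using ij by auto
      then show ?thesis
      proof cases
        case 1
        then show ?thesis using pair(1) by (intro exI[of _ 0]) simp
      next
        case 2
        then show ?thesis using pair(2) by (intro exI[of _ "2 * pi / 3"]) simp
      next
        case 3
        then show ?thesis using pair(3) by (intro exI[of _ "4 * pi / 3"]) simp
      qed
    qed
    then show thesis using that by blast
  qed
  define Y where "Y t \<longleftrightarrow> Z (t + c)" for t
  have "Y (t + pi) \<longleftrightarrow> Y t" for t
    unfolding Y_def using Zpi[of "t + c"] by (simp add: ac_simps)
  moreover have "Y (t0 - c)" using t0 by (simp add: Y_def)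
  ultimately obtain s where "0 \<le> s" "s < pi" "Y s" "Y (s + pi)"
    by (rule antiperiodic_zero_reduce)
  then show thesis using that c by (simp add: Y_def)
qed

text \<open>The bound of each pair is affine in its own energy and has the same slope for all pairs,
  so it is enough that the three energies together are at most 6 / m.\<close>

lemma potential_integral_collision_ge:
  assumes m: "0 < m" and \<beta>: "0 < \<beta>" and n: "2 \<le> n" "1 \<le> real n * \<beta>"
    and x: "x \<in> M_eight m" and col: "\<not> collision_free x"
  shows "ennreal (m\<^sup>2 * (6 * pi * (pi * m * collision_level n) powr \<beta>)) \<le> potential_integral (2 * \<beta>) m x"
proof -
  \<comment> \<open>Chosen such that the mean energy of a pair, at most 2 / m, is measured against
    \<open>2 * pi * \<kappa>\<^sup>2\<close>; the sum of the three corrections is then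
    nonnegative.\<close>
  define \<kappa> where "\<kappa> = 1 / sqrt (pi * m)"
  have \<kappa>: "0 < \<kappa>" "\<kappa>\<^sup>2 = 1 / (pi * m)" using m by (simp_all add: \<kappa>_def power_divide)
  define Z where "Z = (pi * m * collision_level n) powr \<beta>"
  have Z: "(collision_level n / \<kappa>\<^sup>2) powr \<beta> = Z" by (simp add: Z_def \<kappa> ac_simps)
  have xH: "x \<in> H_eight" and en: "energy x = 2 / m"
    using x m by (simp_all add: M_eight_def kinetic_eq field_simps)
  let ?R = "\<lambda>i j. Z * (2 * pi + \<beta> * (2 * pi - energy (pair_loop i j x) * (pi * m)))"
  let ?V = "\<lambda>i j. loop_potential (2 * \<beta>) (pair_loop i j x)"
  have V: "ennreal (?R i j) \<le> ?V i j" if ij: "(i, j) \<in> {(0, 1), (1, 2), (0, 2)}" for i j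
  proof -
    obtain s where "0 \<le> s" "s < pi" "curve (pair_loop i j x) s = 0" "curve (pair_loop i j x) (s + pi) = 0"
      using H_eight_collision_zeros[OF xH col ij] by blast
    from potential_integral_ge_collision[OF n \<kappa>(1) this] show ?thesis
      by (simp add: Z) (simp add: \<kappa>)
  qed
  have "energy (pair_loop 0 1 x) + energy (pair_loop 1 2 x) + energy (pair_loop 0 2 x) \<le> 6 / m"
    using energy_pair_loop_sum[of x] en by simp
  then have "(energy (pair_loop 0 1 x) + energy (pair_loop 1 2 x) + energy (pair_loop 0 2 x)) * (pi * m) \<le> 6 / m * (pi * m)"
    using m by (intro mult_right_mono) auto
  then have e: "0 \<le> \<beta> * (6 * pi - (energy (pair_loop 0 1 x) + energy (pair_loop 1 2 x) + energy (pair_loop 0 2 x)) * (pi * m))"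
    using m \<beta> by simp
  have "Z * (6 * pi) \<le> Z * (6 * pi + \<beta> * (6 * pi - (energy (pair_loop 0 1 x) + energy (pair_loop 1 2 x) + energy (pair_loop 0 2 x)) * (pi * m)))"
    using e by (intro mult_left_mono) (auto simp: Z_def)
  also have "\<dots> = ?R 0 1 + ?R 1 2 + ?R 0 2" by (simp add: algebra_simps)
  finally have "ennreal (Z * (6 * pi)) \<le> ennreal (?R 0 1 + ?R 1 2 + ?R 0 2)" by (rule ennreal_leI)
  also have "\<dots> \<le> ennreal (?R 0 1) + ennreal (?R 1 2) + ennreal (?R 0 2)"
    by (rule order_trans[OF ennreal_add_le add_right_mono[OF ennreal_add_le]])
  also have "\<dots> \<le> ?V 0 1 + ?V 1 2 + ?V 0 2"
    by (intro add_mono V) auto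
  finally have "ennreal (m\<^sup>2) * ennreal (Z * (6 * pi)) \<le> ennreal (m\<^sup>2) * (?V 0 1 + ?V 1 2 + ?V 0 2)"
    by (rule mult_left_mono) simp
  then show ?thesis
    unfolding potential_integral_eq[OF m] by (simp add: ennreal_mult'[symmetric] Z_def ac_simps)
qed

section \<open>The test loop\<close>

lemma has_weak_derivative_C1:
  fixes x x' :: "real \<Rightarrow> 'a::euclidean_space"
  assumes d: "\<And>t. (x has_vector_derivative x' t) (at t)" and c: "continuous_on UNIV x'"
    and per: "\<And>t. x (t + 2 * pi) = x t"
  shows "has_weak_derivative x x'"
  unfolding has_weak_derivative_def
proof (intro conjI allI ballI)
  have c': "continuous_on A x'" for A using c by (rule continuous_on_subset) simp
  show "x' \<in> borel_measurable borel" using c by (rule borel_measurable_continuous_onI)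
  show "set_integrable lborel {0..2 * pi} (\<lambda>t. (norm (x' t))\<^sup>2)"
    by (rule borel_integrable_atLeastAtMost') (intro continuous_intros c')
  fix t :: real assume t: "t \<in> {0..2 * pi}"
  have "(LINT s|lborel. indicator {0..t} s *\<^sub>R x' s) = x t - x 0"
    by (rule integral_FTC_Icc) (use t d c' in \<open>auto intro: has_vector_derivative_at_within\<close>)
  then show "x t = x 0 + (LINT s:{0..t}|lborel. x' s)"
    by (simp add: set_lebesgue_integral_def)
qed (rule per)

lemma has_vector_derivative_vec_vec:
  fixes x :: "real \<Rightarrow> real ^ 'm ^ 'n"
  assumes "\<And>i j. ((\<lambda>t. x t $ i $ j) has_real_derivative x' $ i $ j) (at t)"
  shows "(x has_vector_derivative x') (at t)"
proof -
  have "((\<lambda>t. inner (x t) b) has_derivative (\<lambda>s. inner (s *\<^sub>R x') b)) (at t)" if b': "b \<in> Basis" for b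
  proof -
    obtain i j where b: "b = axis i (axis j 1)"
      using b' unfolding Basis_vec_def Basis_real_def by blast
    have "inner z b = z $ i $ j" for z :: "real ^ 'm ^ 'n" by (simp add: b inner_axis)
    then show ?thesis
      using assms[of i j] by (simp add: has_field_derivative_def mult_commute_abs)
  qed
  then show ?thesis
    unfolding has_vector_derivative_def has_derivative_componentwise_within[of x] by blast
qed

definition eight_shift :: "3 \<Rightarrow> real" where
  "eight_shift i = (if i = 0 then 0 else if i = 1 then 2 * pi / 3 else 4 * pi / 3)"

definition eight_curve :: "real \<Rightarrow> real \<Rightarrow> real \<Rightarrow> real ^ 2" where
  "eight_curve A B t = vector [A * sin (2 * t), B * sin t]"

lemma cos_sum_thirds: "cos s + cos (s + 2 * pi / 3) + cos (s + 4 * pi / 3) = 0"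
proof -
  have "s + 2 * pi / 3 = (s + pi) - pi / 3" "s + 4 * pi / 3 = (s + pi) + pi / 3" by simp_all
  then show ?thesis by (simp only: cos_add cos_diff) (simp add: cos_60)
qed

lemma cos_square_sum_thirds: "(cos s)\<^sup>2 + (cos (s + 2 * pi / 3))\<^sup>2 + (cos (s + 4 * pi / 3))\<^sup>2 = 3 / 2"
proof -
  have sq: "(cos x)\<^sup>2 = (1 + cos (2 * x)) / 2" for x :: real by (simp add: cos_double_cos)
  have "cos (2 * (s + 2 * pi / 3)) = cos (2 * s + 4 * pi / 3)" by (simp add: algebra_simps)
  moreover have "cos (2 * (s + 4 * pi / 3)) = cos ((2 * s + 2 * pi / 3) + 2 * pi)" by (simp add: algebra_simps)
  ultimately show ?thesis
    using cos_sum_thirds[of "2 * s"] unfolding sq by (simp only: cos_periodic) (simp add: field_simps)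
qed

lemma eight_curve_periodic: "eight_curve A B (t + 2 * pi) = eight_curve A B t"
proof -
  have "sin (2 * (t + 2 * pi)) = sin (2 * t)"
    using sin_periodic[of "2 * t + 2 * pi"] sin_periodic[of "2 * t"] by (simp add: algebra_simps)
  then show ?thesis by (simp add: eight_curve_def)
qed

text \<open>Around the midpoint \<open>u\<close> of the two times, sum-to-product turns both
  coordinate differences into multiples of a cosine, with the same factor sqrt 3.\<close>

lemma eight_curve_dist:
  "(norm (eight_curve A B (s + 2 * pi / 3) - eight_curve A B s))\<^sup>2
    = 3 * A\<^sup>2 * (cos (2 * (s + pi / 3)))\<^sup>2 + 3 * B\<^sup>2 * (cos (s + pi / 3))\<^sup>2"
proof -
  define u where "u = s + pi / 3"
  have s23: "sin (2 * pi / 3) = sqrt 3 / 2"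
  proof -
    have "2 * pi / 3 = pi - pi / 3" by simp
    then show ?thesis by (simp only: sin_pi_minus sin_60)
  qed
  have e: "2 * (s + 2 * pi / 3) = 2 * u + 2 * pi / 3" "2 * s = 2 * u - 2 * pi / 3"
    "s + 2 * pi / 3 = u + pi / 3" "s = u - pi / 3" by (simp_all add: u_def)
  have "sin (2 * (s + 2 * pi / 3)) - sin (2 * s) = sqrt 3 * cos (2 * u)"
    unfolding e(1,2) sin_add sin_diff s23 by simp
  moreover have "sin (s + 2 * pi / 3) - sin s = sqrt 3 * cos u"
    unfolding e(3) by (subst e(4)) (simp add: sin_add sin_diff sin_60)
  ultimately have "A * sin (2 * (s + 2 * pi / 3)) - A * sin (2 * s) = A * (sqrt 3 * cos (2 * u))"
    "B * sin (s + 2 * pi / 3) - B * sin s = B * (sqrt 3 * cos u)"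
    by (simp_all only: right_diff_distrib[symmetric])
  then show ?thesis
    unfolding norm_plane_square eight_curve_def u_def[symmetric]
    by (simp add: power_mult_distrib)
qed

lemma test_loop_exists:
  assumes m: "0 < m" and \<beta>: "0 < \<beta>" and n: "2 \<le> n" "(real n - 1) * \<beta> \<le> 1"
  shows "\<exists>x\<in>M_eight m. potential_integral (2 * \<beta>) m x
    < ennreal (m\<^sup>2 * (6 * pi * (pi * m * collision_level n) powr \<beta>))"
proof -
  define k where "k = 1 / (pi * m)"
  have k: "0 < k" using m by (simp add: k_def)
  \<comment> \<open>\<open>k\<close> is the mean squared speed that kinetic energy 1 prescribes.
    Averaging over the three bodies makes the squared speed of the configuration constant, 6 A^2 +
    3/2 B^2, which is 30 A^2 when B^2 = 16 A^2.\<close>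
  define A where "A = sqrt (k / 30)"
  define B where "B = sqrt (8 * k / 15)"
  have AB: "A\<^sup>2 = k / 30" "B\<^sup>2 = 8 * k / 15" using k by (simp_all add: A_def B_def)
  let ?g = "eight_curve A B"
  have dg: "((\<lambda>t. ?g (t + c) $ j) has_real_derivative vector [2 * A * cos (2 * (t + c)), B * cos (t + c)] $ j) (at t)"
    for t c and j :: 2
  proof -
    have "j = 1 \<or> j = 2" using exhaust_2 by blast
    then show ?thesis
      unfolding eight_curve_def by (auto intro!: derivative_eq_intros)
  qed
  define x :: "real \<Rightarrow> configuration" where "x t = (\<chi> i. ?g (t + eight_shift i))" for t
  define x' :: "real \<Rightarrow> configuration" where
    "x' t = (\<chi> i. vector [2 * A * cos (2 * (t + eight_shift i)), B * cos (t + eight_shift i)])" for t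
  have cx': "continuous_on UNIV x'"
  proof -
    have "continuous_on UNIV (\<lambda>t. vector [2 * A * cos (2 * (t + c)), B * cos (t + c)] :: real ^ 2)" for c
    proof -
      have "continuous_on UNIV (\<lambda>t. \<chi> j. (vector [2 * A * cos (2 * (t + c)), B * cos (t + c)] :: real ^ 2) $ j)"
      proof (rule continuous_on_vec_lambda)
        fix j :: 2
        have "j = 1 \<or> j = 2" using exhaust_2 by blast
        then show "continuous_on UNIV (\<lambda>t. (vector [2 * A * cos (2 * (t + c)), B * cos (t + c)] :: real ^ 2) $ j)"
          by (elim disjE) (simp_all, (intro continuous_intros)+)
      qed
      then show ?thesis by (simp only: vec_lambda_eta)
    qed
    then show ?thesis unfolding x'_def by (intro continuous_on_vec_lambda)
  qed
  have wx: "has_weak_derivative x x'"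
  proof (rule has_weak_derivative_C1[OF _ cx'])
    show "(x has_vector_derivative x' t) (at t)" for t
      using dg by (intro has_vector_derivative_vec_vec) (simp add: x_def x'_def)
    show "x (t + 2 * pi) = x t" for t
      unfolding x_def add.assoc[of t "2 * pi"] add.commute[of "2 * pi"] add.assoc[symmetric] eight_curve_periodic
      by (rule refl)
  qed
  have wg: "has_weak_derivative ?g (\<lambda>t. x' t $ 0)"
    using has_weak_derivative_bounded_linear[OF bounded_linear_vec_nth[of 0] wx]
    by (simp add: x_def eight_shift_def)
  define y where "y = Abs_h1loop x"
  define \<gamma> where "\<gamma> = Abs_h1loop ?g"
  have cy: "curve y = x" unfolding y_def using wx by (intro Abs_h1loop_inverse) auto
  have cg: "curve \<gamma> = ?g" unfolding \<gamma>_def using wg by (intro Abs_h1loop_inverse) auto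
  have "y \<in> H_eight"
  proof -
    have "eight_generator \<gamma>"
      unfolding eight_generator_def cg
    proof (intro conjI allI)
      fix t
      have "2 * (t + pi) = 2 * t + 2 * pi" "2 * (pi / 2 + t) = pi + 2 * t" "2 * (pi / 2 - t) = pi - 2 * t"
        by (simp_all add: algebra_simps)
      then have s: "sin (2 * (t + pi)) = sin (2 * t)" "sin (2 * (pi / 2 + t)) = - sin (2 * t)" "sin (2 * (pi / 2 - t)) = sin (2 * t)"
        by (simp_all only: sin_periodic sin_pi_minus sin_add sin_pi cos_pi) simp_all
      have s': "sin (pi / 2 + t) = cos t" "sin (pi / 2 - t) = cos t"
        by (simp_all add: sin_add sin_diff)
      show "?g (t + pi) = vector [?g t $ 1, - (?g t $ 2)]"
        by (simp add: eight_curve_def s)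
      show "?g (pi / 2 + t) = vector [- (?g (pi / 2 - t) $ 1), ?g (pi / 2 - t) $ 2]"
        unfolding eight_curve_def s s' vector_2 by simp
    qed (simp add: eight_curve_def vec_eq_iff forall_2)
    moreover have "curve y t $ of_nat i = curve \<gamma> (t + 2 * pi * real i / 3)" if "i < 3" for i :: nat and t
    proof -
      have "i = 0 \<or> i = 1 \<or> i = 2" using that by auto
      then show ?thesis by (auto simp: cy cg x_def eight_shift_def mult.commute)
    qed
    ultimately show ?thesis unfolding H_eight_def by blast
  qed
  moreover have "kinetic m y = 1"
  proof -
    have "(norm (x' t))\<^sup>2 = k" for t
    proof -
      have c2: "(cos (2 * t))\<^sup>2 + (cos (2 * (t + 2 * pi / 3)))\<^sup>2 + (cos (2 * (t + 4 * pi / 3)))\<^sup>2 = 3 / 2"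
      proof -
        have "cos (2 * (t + 2 * pi / 3)) = cos (2 * t + 4 * pi / 3)" by (simp add: algebra_simps)
        moreover have "cos (2 * (t + 4 * pi / 3)) = cos ((2 * t + 2 * pi / 3) + 2 * pi)" by (simp add: algebra_simps)
        ultimately show ?thesis
          using cos_square_sum_thirds[of "2 * t"] by (simp only: cos_periodic)
      qed
      have "(norm (x' t))\<^sup>2 = 4 * A\<^sup>2 * ((cos (2 * t))\<^sup>2 + (cos (2 * (t + 2 * pi / 3)))\<^sup>2 + (cos (2 * (t + 4 * pi / 3)))\<^sup>2)
          + B\<^sup>2 * ((cos t)\<^sup>2 + (cos (t + 2 * pi / 3))\<^sup>2 + (cos (t + 4 * pi / 3))\<^sup>2)"
        unfolding norm_configuration_square norm_plane_square x'_def
        by (simp add: eight_shift_def power_mult_distrib distrib_left)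
      then show ?thesis unfolding c2 cos_square_sum_thirds AB by simp
    qed
    then have "energy y = (LINT t:{0..2 * pi}|lborel. k)"
      using energy_eq[of y x'] wx cy by simp
    then show ?thesis
      using m by (simp add: kinetic_eq set_integral_const k_def)
  qed
  ultimately have yM: "y \<in> M_eight m" by (simp add: M_eight_def)
  define I where "I = integral {0..2 * pi} (\<lambda>t. eight_dist ((cos t)\<^sup>2) powr (- \<beta>))"
  have pos: "0 < eight_dist ((cos t)\<^sup>2)" for t by (rule eight_dist_pos) simp
  have cf: "continuous_on X (\<lambda>t. eight_dist ((cos t)\<^sup>2) powr (- \<beta>))" for X
    using pos[THEN less_imp_neq] unfolding eight_dist_def by (auto intro!: continuous_intros)
  \<comment> \<open>The three mutual distances are translates in time of one function, so all pairs
    contribute the same integral.\<close>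
  have V: "loop_potential (2 * \<beta>) (pair_loop i j y)
      = ennreal (k powr (- \<beta>) * I)"
    if c: "0 \<le> c" "c \<le> 2 * pi" and d: "\<And>t. (norm (curve (pair_loop i j y) t))\<^sup>2 = k * eight_dist ((cos (t + c))\<^sup>2)" for i j c
  proof -
    let ?f = "\<lambda>t. eight_dist ((cos t)\<^sup>2) powr (- \<beta>)"
    have pp: "power_potential (2 * \<beta>) (norm (curve (pair_loop i j y) t)) = ennreal (k powr (- \<beta>) * ?f (t + c))" for t
    proof -
      let ?r = "norm (curve (pair_loop i j y) t)"
      have r: "0 < ?r" using d[of t] k pos[of "t + c"] by (metis mult_pos_pos zero_less_norm_iff norm_zero power_zero_numeral less_irrefl)
      then have "?r powr (- (2 * \<beta>)) = (?r\<^sup>2) powr (- \<beta>)"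
        by (simp add: powr_powr flip: powr_numeral)
      also have "\<dots> = k powr (- \<beta>) * ?f (t + c)"
        unfolding d by (rule powr_mult)
      finally show ?thesis using r by (simp add: power_potential_def)
    qed
    have cfc: "continuous_on X (\<lambda>t. k powr (- \<beta>) * ?f (t + c))" for X
      by (intro continuous_intros continuous_on_compose2[OF cf[of UNIV]]) auto
    have i: "set_integrable lborel {0..2 * pi} (\<lambda>t. k powr (- \<beta>) * ?f (t + c))"
      by (rule borel_integrable_atLeastAtMost'[OF cfc])
    have "loop_potential (2 * \<beta>) (pair_loop i j y)
        = (\<integral>\<^sup>+t. ennreal (indicator {0..2 * pi} t *\<^sub>R (k powr (- \<beta>) * ?f (t + c))) \<partial>lborel)"
      unfolding loop_potential_def pp by (intro nn_integral_cong) (auto simp: indicator_def)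
    also have "\<dots> = ennreal (LINT t:{0..2 * pi}|lborel. k powr (- \<beta>) * ?f (t + c))"
      unfolding set_lebesgue_integral_def
      by (rule nn_integral_eq_integral) (use i in \<open>auto simp: set_integrable_def\<close>)
    also have "(LINT t:{0..2 * pi}|lborel. k powr (- \<beta>) * ?f (t + c))
        = integral {0..2 * pi} (\<lambda>t. k powr (- \<beta>) * ?f (t + c))"
      by (rule set_borel_integral_eq_integral(2)[OF i])
    also have "\<dots> = k powr (- \<beta>) * integral {0..2 * pi} (\<lambda>t. ?f (t + c))"
      by (rule integral_mult_right)
    also have "integral {0..2 * pi} (\<lambda>t. ?f (t + c)) = I"
      unfolding I_def by (rule integral_periodic_shift[OF cf _ c]) simp
    finally show ?thesis .
  qed
  have dist: "(norm (?g (s + 2 * pi / 3) - ?g s))\<^sup>2 = k * eight_dist ((cos (s + pi / 3))\<^sup>2)" for s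
  proof -
    have "3 * (k / 30) * (2 * u - 1)\<^sup>2 + 3 * (8 * k / 15) * u = k * (1 / 10 + 6 / 5 * u + 2 / 5 * u\<^sup>2)" for u
      by (simp add: power2_eq_square field_simps)
    then show ?thesis
      unfolding eight_curve_dist AB eight_dist_def cos_double_cos .
  qed
  have V1: "loop_potential (2 * \<beta>) (pair_loop 0 1 y)
      = ennreal (k powr (- \<beta>) * I)"
  proof (rule V[of "pi / 3"])
    show "(norm (curve (pair_loop 0 1 y) t))\<^sup>2 = k * eight_dist ((cos (t + pi / 3))\<^sup>2)" for t
      using dist[of t] by (simp add: pair_loop.rep_eq cy x_def eight_shift_def norm_minus_commute)
  qed auto
  have V2: "loop_potential (2 * \<beta>) (pair_loop 1 2 y)
      = ennreal (k powr (- \<beta>) * I)"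
  proof (rule V[of pi])
    fix t
    have e: "t + 2 * pi / 3 + 2 * pi / 3 = t + 4 * pi / 3" "t + 2 * pi / 3 + pi / 3 = t + pi" by simp_all
    show "(norm (curve (pair_loop 1 2 y) t))\<^sup>2 = k * eight_dist ((cos (t + pi))\<^sup>2)"
      using dist[of "t + 2 * pi / 3"] unfolding e by (simp add: pair_loop.rep_eq cy x_def eight_shift_def norm_minus_commute)
  qed auto
  have V3: "loop_potential (2 * \<beta>) (pair_loop 0 2 y)
      = ennreal (k powr (- \<beta>) * I)"
  proof (rule V[of "5 * pi / 3"])
    fix t
    have e: "t + 4 * pi / 3 + 2 * pi / 3 = t + 2 * pi" "t + 4 * pi / 3 + pi / 3 = t + 5 * pi / 3" by simp_all
    show "(norm (curve (pair_loop 0 2 y) t))\<^sup>2 = k * eight_dist ((cos (t + 5 * pi / 3))\<^sup>2)"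
      using dist[of "t + 4 * pi / 3"] unfolding e eight_curve_periodic
      by (simp add: pair_loop.rep_eq cy x_def eight_shift_def)
  qed auto
  have I0: "0 \<le> I" unfolding I_def by (intro integral_nonneg integrable_continuous_real cf) auto
  have "potential_integral (2 * \<beta>) m y = ennreal (m\<^sup>2 * (3 * (k powr (- \<beta>) * I)))"
  proof -
    have "ennreal (m\<^sup>2) * (ennreal c + ennreal c + ennreal c) = ennreal (m\<^sup>2 * (3 * c))" if "0 \<le> c" for c
    proof -
      have "ennreal c + ennreal c + ennreal c = ennreal (3 * c)"
        using that by (simp flip: ennreal_plus)
      then show ?thesis using that by (simp only: ennreal_mult'[symmetric] zero_le_power2)
    qed
    then show ?thesis
      unfolding potential_integral_eq[OF m] V1 V2 V3 using I0 by simp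
  qed
  also have "\<dots> < ennreal (m\<^sup>2 * (6 * pi * (pi * m * collision_level n) powr \<beta>))"
  proof (rule ennreal_lessI)
    have "I < 2 * pi * collision_level n powr \<beta>"
      unfolding I_def by (rule eight_level_bound[OF n(1) \<beta> n(2)])
    then have "3 * (k powr (- \<beta>) * I) < 3 * (k powr (- \<beta>) * (2 * pi * collision_level n powr \<beta>))"
      using k by (intro mult_strict_left_mono) auto
    also have "\<dots> = 6 * pi * (pi * m * collision_level n) powr \<beta>"
    proof -
      have "k powr (- \<beta>) = (pi * m) powr \<beta>" by (simp add: k_def powr_minus powr_divide)
      moreover have "(pi * m * collision_level n) powr \<beta> = (pi * m) powr \<beta> * collision_level n powr \<beta>"
        by (rule powr_mult)
      ultimately show ?thesis by simp
    qed
    finally show "m\<^sup>2 * (3 * (k powr (- \<beta>) * I)) < m\<^sup>2 * (6 * pi * (pi * m * collision_level n) powr \<beta>)"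
      using m by (intro mult_strict_left_mono) auto
    show "0 < m\<^sup>2 * (6 * pi * (pi * m * collision_level n) powr \<beta>)"
      using m collision_level_pos[OF n(1)] by simp
  qed
  finally show ?thesis using yM by blast
qed

section \<open>Differentiability of the potential\<close>

text \<open>Beyond \<open>e\<close> the second derivative of f = t^(-\<beta>) lies between 0 and
  \<open>C\<close>. Hence f and C t^2 - f are convex, and their tangents bound the remainder from
  both sides.\<close>

lemma powr_neg_taylor:
  fixes s k e \<beta> :: real
  assumes e: "0 < e" and s: "e < s" "e < s + k" and \<beta>: "0 < \<beta>"
  shows "\<bar>(s + k) powr (- \<beta>) - s powr (- \<beta>) + \<beta> * s powr (- \<beta> - 1) * k\<bar>
    \<le> \<beta> * (\<beta> + 1) * e powr (- \<beta> - 2) * k\<^sup>2"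
proof -
  define C where "C = \<beta> * (\<beta> + 1) * e powr (- \<beta> - 2)"
  define f where "f t = t powr (- \<beta>)" for t :: real
  define f' where "f' t = - \<beta> * t powr (- \<beta> - 1)" for t :: real
  define f'' where "f'' t = \<beta> * (\<beta> + 1) * t powr (- \<beta> - 2)" for t :: real
  have d1: "(f has_real_derivative f' t) (at t)" if "0 < t" for t
    unfolding f_def f'_def using has_real_derivative_powr[OF that, of "- \<beta>"] by simp
  have d2: "(f' has_real_derivative f'' t) (at t)" if "0 < t" for t
    unfolding f'_def f''_def using DERIV_cmult[OF has_real_derivative_powr[OF that, of "- \<beta> - 1"], of "- \<beta>"]
    by (simp add: algebra_simps)
  have f'': "0 \<le> f'' t" "f'' t \<le> C" if "e < t" for t
  proof -
    show "0 \<le> f'' t" using \<beta> by (simp add: f''_def)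
    have "t powr (- \<beta> - 2) \<le> e powr (- \<beta> - 2)"
      using that e \<beta> by (intro powr_mono2') auto
    then show "f'' t \<le> C" unfolding f''_def C_def using \<beta> by (intro mult_left_mono) auto
  qed
  have low: "f' s * (s + k - s) \<le> f (s + k) - f s"
  proof (rule convex_on_imp_above_tangent[where A = "{e<..}"])
    show "convex_on {e<..} f"
      by (rule f''_ge0_imp_convex[where f' = f' and f'' = f'']) (use d1 d2 f'' e in auto)
    show "(f has_real_derivative f' s) (at s within {e<..})"
      by (rule has_field_derivative_at_within, rule d1) (use s e in simp)
  qed (use s in \<open>auto simp: interior_open\<close>)
  define g where "g t = C * t\<^sup>2 - f t" for t
  have dg: "(g has_real_derivative 2 * C * t - f' t) (at t)" if "0 < t" for t
    unfolding g_def using d1[OF that] by (auto intro!: derivative_eq_intros)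
  have "(2 * C * s - f' s) * (s + k - s) \<le> g (s + k) - g s"
  proof (rule convex_on_imp_above_tangent[where A = "{e<..}"])
    show "convex_on {e<..} g"
    proof (rule f''_ge0_imp_convex[where f' = "\<lambda>t. 2 * C * t - f' t" and f'' = "\<lambda>t. 2 * C - f'' t"])
      fix t assume t: "t \<in> {e<..}"
      show "(g has_real_derivative 2 * C * t - f' t) (at t)"
        using dg[of t] t e by simp
      show "((\<lambda>t. 2 * C * t - f' t) has_real_derivative 2 * C - f'' t) (at t)"
        using d2[of t] t e by (auto intro!: derivative_eq_intros)
      show "0 \<le> 2 * C - f'' t" using f''[of t] t by auto
    qed simp
    show "(g has_real_derivative 2 * C * s - f' s) (at s within {e<..})"
      by (rule has_field_derivative_at_within, rule dg) (use s e in simp)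
  qed (use s in \<open>auto simp: interior_open\<close>)
  then have "f (s + k) - f s - f' s * k \<le> C * k\<^sup>2"
    by (simp add: g_def power2_eq_square algebra_simps)
  then show ?thesis
    using low by (simp add: f_def f'_def C_def abs_le_iff)
qed

text \<open>The square of the norm is a quadratic polynomial in \<open>w\<close>, so the
  one-variable bound applies to the increment \<open>k\<close> of that square. The constant depends
  on \<open>u\<close> only through the bounds \<delta> and \<open>M\<close>, which makes the
  remainder uniform in time.\<close>

lemma norm_powr_taylor:
  fixes u w :: "'a::real_inner"
  assumes \<delta>: "0 < \<delta>" "2 * \<delta> \<le> norm u" "norm w \<le> \<delta>" and M: "norm u \<le> M" and \<beta>: "0 < \<beta>"
  shows "\<bar>norm (u + w) powr (- (2 * \<beta>)) - norm u powr (- (2 * \<beta>))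
      + 2 * \<beta> * norm u powr (- (2 * \<beta>) - 2) * inner u w\<bar>
    \<le> (\<beta> * (\<beta> + 1) * (\<delta>\<^sup>2 / 2) powr (- \<beta> - 2) * (2 * M + \<delta>)\<^sup>2 + \<beta> * (\<delta>\<^sup>2 / 2) powr (- \<beta> - 1)) * (norm w)\<^sup>2"
proof -
  define e where "e = \<delta>\<^sup>2 / 2"
  define s where "s = (norm u)\<^sup>2"
  define k where "k = 2 * inner u w + (norm w)\<^sup>2"
  have sk: "(norm (u + w))\<^sup>2 = s + k"
    by (simp add: s_def k_def power2_norm_eq_inner inner_add inner_commute)
  have uw: "\<delta> \<le> norm (u + w)" using norm_triangle_ineq2[of u "- w"] \<delta> by simp
  have e: "0 < e" using \<delta> by (simp add: e_def)
  have s: "e < s" "e < s + k"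
  proof -
    have "\<delta>\<^sup>2 \<le> (norm u)\<^sup>2" "\<delta>\<^sup>2 \<le> (norm (u + w))\<^sup>2"
      using \<delta> uw by (auto intro!: power_mono)
    moreover have "e < \<delta>\<^sup>2" using \<delta> by (simp add: e_def)
    ultimately show "e < s" "e < s + k" using sk s_def by linarith+
  qed
  have pw: "norm v powr (- (2 * b)) = ((norm v)\<^sup>2) powr (- b)" if "v \<noteq> 0" for v :: 'a and b
    using that by (simp add: powr_powr flip: powr_numeral)
  have nz: "u \<noteq> 0" "u + w \<noteq> 0" using \<delta> uw by auto
  have "- (2 * \<beta>) - 2 = - (2 * (\<beta> + 1))" by simp
  then have "norm u powr (- (2 * \<beta>) - 2) = s powr (- \<beta> - 1)"
    using pw[OF nz(1), of "\<beta> + 1"] by (simp add: s_def)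
  then have "norm (u + w) powr (- (2 * \<beta>)) - norm u powr (- (2 * \<beta>))
      + 2 * \<beta> * norm u powr (- (2 * \<beta>) - 2) * inner u w
    = ((s + k) powr (- \<beta>) - s powr (- \<beta>) + \<beta> * s powr (- \<beta> - 1) * k) - \<beta> * s powr (- \<beta> - 1) * (norm w)\<^sup>2"
    unfolding pw[OF nz(1)] pw[OF nz(2)] sk by (simp add: s_def k_def algebra_simps)
  also have "\<bar>\<dots>\<bar> \<le> \<beta> * (\<beta> + 1) * e powr (- \<beta> - 2) * k\<^sup>2 + \<beta> * s powr (- \<beta> - 1) * (norm w)\<^sup>2"
    using powr_neg_taylor[OF e s \<beta>] \<beta> by (intro order_trans[OF abs_triangle_ineq4] add_mono) auto
  also have "\<dots> \<le> \<beta> * (\<beta> + 1) * e powr (- \<beta> - 2) * ((2 * M + \<delta>) * norm w)\<^sup>2 + \<beta> * e powr (- \<beta> - 1) * (norm w)\<^sup>2"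
  proof (intro add_mono mult_left_mono mult_right_mono)
    have "\<bar>k\<bar> \<le> 2 * \<bar>inner u w\<bar> + (norm w)\<^sup>2" by (simp add: k_def abs_triangle_ineq[THEN order_trans])
    also have "\<dots> \<le> 2 * (M * norm w) + \<delta> * norm w"
      using Cauchy_Schwarz_ineq2[of u w] mult_right_mono[OF M, of "norm w"] mult_right_mono[OF \<delta>(3), of "norm w"]
      by (simp add: power2_eq_square)
    finally have "\<bar>k\<bar> \<le> (2 * M + \<delta>) * norm w" by (simp add: algebra_simps)
    then show "k\<^sup>2 \<le> ((2 * M + \<delta>) * norm w)\<^sup>2"
      by (metis abs_ge_zero power2_abs power_mono)
    show "s powr (- \<beta> - 1) \<le> e powr (- \<beta> - 1)"
      using s e \<beta> by (intro powr_mono2') auto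
  qed (use \<beta> in auto)
  finally show ?thesis unfolding power_mult_distrib e_def by (simp only: distrib_right mult.assoc)
qed

text \<open>A real-valued version, to be differentiated. It is used at collision-free loops, where
  it agrees with \<open>loop_potential\<close>.\<close>

definition pair_action :: "real \<Rightarrow> 3 \<Rightarrow> 3 \<Rightarrow> configuration h1loop \<Rightarrow> real" where
  "pair_action \<beta> i j x = (LINT t:{0..2 * pi}|lborel. norm (curve x t $ i - curve x t $ j) powr (- (2 * \<beta>)))"

lemma collision_free_distance:
  assumes "collision_free x"
  obtains \<delta> where "0 < \<delta>" "\<And>t i j. i \<noteq> j \<Longrightarrow> \<delta> \<le> norm (curve x t $ i - curve x t $ j)"
proof -
  have "\<exists>d>0. \<forall>t\<in>{0..2 * pi}. d \<le> norm (curve x t $ i - curve x t $ j)" if "i \<noteq> j" for i j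
  proof -
    have c: "continuous_on {0..2 * pi} (\<lambda>t. norm (curve x t $ i - curve x t $ j))"
      by (intro continuous_intros continuous_on_curve)
    obtain t0 where "\<forall>t\<in>{0..2 * pi}. norm (curve x t0 $ i - curve x t0 $ j) \<le> norm (curve x t $ i - curve x t $ j)"
      using continuous_attains_inf[OF compact_Icc _ c] by auto
    moreover have "0 < norm (curve x t0 $ i - curve x t0 $ j)"
      using assms that by (auto simp: collision_free_def collision_def)
    ultimately show ?thesis by blast
  qed
  then obtain d where d: "\<And>i j. i \<noteq> j \<Longrightarrow> 0 < d i j"
    "\<And>i j t. i \<noteq> j \<Longrightarrow> t \<in> {0..2 * pi} \<Longrightarrow> d i j \<le> norm (curve x t $ i - curve x t $ j)"
    by metis
  define D where "D = insert 1 ((\<lambda>(i, j). d i j) ` {(i, j). i \<noteq> j})"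
  have fin: "finite D" unfolding D_def by (intro finite.insertI finite_imageI) simp
  show thesis
  proof (rule that)
    show "0 < Min D" using fin d(1) by (subst Min_gr_iff) (auto simp: D_def)
    fix t and i j :: 3 assume ij: "i \<noteq> j"
    obtain s where s: "s \<in> {0..2 * pi}" "curve x t = curve x s" by (rule curve_reduce)
    have "Min D \<le> d i j" using fin ij by (intro Min_le) (auto simp: D_def)
    then show "Min D \<le> norm (curve x t $ i - curve x t $ j)"
      using d(2)[OF ij s(1)] s(2) by simp
  qed
qed

lemma has_derivativeI_quadratic:
  fixes f :: "'a::real_normed_vector \<Rightarrow> real"
  assumes L: "bounded_linear L" and r: "0 < r"
    and le: "\<And>h. norm h < r \<Longrightarrow> \<bar>f (x + h) - f x - L h\<bar> \<le> C * (norm h)\<^sup>2"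
  shows "(f has_derivative L) (at x)"
proof (rule has_derivativeI_sandwich[OF r L])
  fix y assume y: "y \<noteq> x" "dist y x < r"
  have "norm (f y - f x - L (y - x)) \<le> C * (norm (y - x))\<^sup>2"
    using le[of "y - x"] y by (simp add: dist_norm)
  then show "norm (f y - f x - L (y - x)) / norm (y - x) \<le> C * norm (y - x)"
    using y by (simp add: divide_le_eq power2_eq_square mult.assoc)
next
  have "((\<lambda>y. C * norm (y - x)) \<longlongrightarrow> C * norm (x - x)) (at x)"
    by (intro tendsto_intros)
  then show "((\<lambda>y. C * norm (y - x)) \<longlongrightarrow> 0) (at x)" by simp
qed

lemma bounded_linearI_functional:
  fixes L :: "'a::real_normed_vector \<Rightarrow> real"
  assumes "\<And>x y. L (x + y) = L x + L y" "\<And>r x. L (r *\<^sub>R x) = r * L x" "\<And>x. \<bar>L x\<bar> \<le> norm x * K"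
  shows "bounded_linear L"
  by (rule bounded_linear_intro) (use assms in auto)

lemma norm_pair_le: "norm (z $ i - z $ j) \<le> 2 * norm z" for z :: configuration
  using norm_triangle_ineq4[of "z $ i" "z $ j"] Finite_Cartesian_Product.norm_nth_le[of z i]
    Finite_Cartesian_Product.norm_nth_le[of z j] by linarith

text \<open>By the Sobolev bound a small variation \<open>h\<close> moves every mutual position by
  at most 8 |h|, uniformly in time, and so keeps it away from 0. The quadratic pointwise remainder
  can then be integrated over the period.\<close>

lemma pair_action_has_derivative:
  assumes x: "collision_free x" and ij: "i \<noteq> j" and \<beta>: "0 < \<beta>"
  shows "\<exists>L. (pair_action \<beta> i j has_derivative L) (at x)"
proof -
  obtain d where d: "0 < d" "\<And>t i j. i \<noteq> j \<Longrightarrow> d \<le> norm (curve x t $ i - curve x t $ j)"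
    using collision_free_distance[OF x] by blast
  define \<delta> where "\<delta> = d / 2"
  have \<delta>: "0 < \<delta>" "\<And>t. 2 * \<delta> \<le> norm (curve x t $ i - curve x t $ j)"
    using d ij by (auto simp: \<delta>_def)
  define M where "M = 8 * norm x"
  have pn: "norm (curve h t $ i - curve h t $ j) \<le> 8 * norm h" for h :: "configuration h1loop" and t
    using norm_pair_le[of "curve h t" i j] curve_le_norm[of h t] by linarith
  define u where "u t = curve x t $ i - curve x t $ j" for t
  have u0: "u t \<noteq> 0" for t using \<delta>(1) \<delta>(2)[of t] by (auto simp: u_def)
  have cu: "continuous_on {0..2 * pi} u"
    unfolding u_def by (intro continuous_intros continuous_on_curve)
  define a where "a t = - (2 * \<beta> * norm (u t) powr (- (2 * \<beta>) - 2))" for t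
  have ca: "continuous_on {0..2 * pi} a"
    unfolding a_def using u0 by (intro continuous_intros cu) auto
  define L where "L h = (LINT t:{0..2 * pi}|lborel. a t * inner (u t) (curve h t $ i - curve h t $ j))" for h
  have iL: "set_integrable lborel {0..2 * pi} (\<lambda>t. a t * inner (u t) (curve h t $ i - curve h t $ j))" for h
    by (rule borel_integrable_atLeastAtMost') (intro continuous_intros ca cu continuous_on_curve)
  define K where "K = (LINT t:{0..2 * pi}|lborel. \<bar>a t\<bar> * norm (u t) * 8)"
  have L: "bounded_linear L"
  proof (rule bounded_linearI_functional)
    show "L (g + h) = L g + L h" for g h
      unfolding L_def using set_integral_add(2)[OF iL[of g] iL[of h]]
      by (simp add: plus_h1loop.rep_eq inner_add inner_diff algebra_simps)
    show "L (r *\<^sub>R h) = r * L h" for r h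
      unfolding L_def by (subst set_integral_mult_right[symmetric])
        (simp add: scaleR_h1loop.rep_eq inner_diff algebra_simps)
    fix h
    have "\<bar>L h\<bar> \<le> (LINT t:{0..2 * pi}|lborel. \<bar>a t * inner (u t) (curve h t $ i - curve h t $ j)\<bar>)"
      unfolding L_def using set_integral_norm_bound[OF iL[of h]] by simp
    also have "\<dots> \<le> (LINT t:{0..2 * pi}|lborel. norm h * (\<bar>a t\<bar> * norm (u t) * 8))"
    proof (rule set_integral_mono)
      show "set_integrable lborel {0..2 * pi} (\<lambda>t. \<bar>a t * inner (u t) (curve h t $ i - curve h t $ j)\<bar>)"
        using set_integrable_norm[OF iL[of h]] by simp
      show "set_integrable lborel {0..2 * pi} (\<lambda>t. norm h * (\<bar>a t\<bar> * norm (u t) * 8))"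
        by (rule borel_integrable_atLeastAtMost') (intro continuous_intros ca cu)
      fix t
      have "\<bar>inner (u t) (curve h t $ i - curve h t $ j)\<bar> \<le> norm (u t) * (8 * norm h)"
        using Cauchy_Schwarz_ineq2[of "u t"] mult_left_mono[OF pn[of h t], of "norm (u t)"]
        by (meson norm_ge_zero order_trans)
      then have "\<bar>a t\<bar> * \<bar>inner (u t) (curve h t $ i - curve h t $ j)\<bar> \<le> \<bar>a t\<bar> * (norm (u t) * (8 * norm h))"
        by (intro mult_left_mono) auto
      then show "\<bar>a t * inner (u t) (curve h t $ i - curve h t $ j)\<bar> \<le> norm h * (\<bar>a t\<bar> * norm (u t) * 8)"
        by (simp add: abs_mult ac_simps)
    qed
    also have "\<dots> = norm h * K" unfolding K_def by (rule set_integral_mult_right)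
    finally show "\<bar>L h\<bar> \<le> norm h * K" .
  qed
  define C where "C = \<beta> * (\<beta> + 1) * (\<delta>\<^sup>2 / 2) powr (- \<beta> - 2) * (2 * M + \<delta>)\<^sup>2 + \<beta> * (\<delta>\<^sup>2 / 2) powr (- \<beta> - 1)"
  have C: "0 \<le> C" using \<beta> by (simp add: C_def)
  have "(pair_action \<beta> i j has_derivative L) (at x)"
  proof (rule has_derivativeI_quadratic[OF L, of "\<delta> / 8" _ _ "2 * pi * (C * 64)"])
    fix h :: "configuration h1loop" assume h: "norm h < \<delta> / 8"
    define w where "w t = curve h t $ i - curve h t $ j" for t
    let ?E = "\<lambda>t. norm (u t + w t) powr (- (2 * \<beta>)) - norm (u t) powr (- (2 * \<beta>)) - a t * inner (u t) (w t)"
    have w: "norm (w t) \<le> 8 * norm h" for t unfolding w_def by (rule pn)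
    have w\<delta>: "norm (w t) \<le> \<delta>" for t using w[of t] h by simp
    have cw: "continuous_on {0..2 * pi} w"
      unfolding w_def by (intro continuous_intros continuous_on_curve)
    have uw: "u t + w t \<noteq> 0" for t
    proof
      assume "u t + w t = 0"
      then have "norm (u t) = norm (w t)" by (metis add_eq_0_iff norm_minus_cancel)
      then show False using \<delta>(1) \<delta>(2)[of t] w\<delta>[of t] by (simp add: u_def)
    qed
    have i1: "set_integrable lborel {0..2 * pi} (\<lambda>t. norm (u t + w t) powr (- (2 * \<beta>)))"
      by (rule borel_integrable_atLeastAtMost') (intro continuous_intros cu cw, use uw in auto)
    have i2: "set_integrable lborel {0..2 * pi} (\<lambda>t. norm (u t) powr (- (2 * \<beta>)))"
      by (rule borel_integrable_atLeastAtMost') (intro continuous_intros cu cw, use u0 in auto)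
    have "pair_action \<beta> i j (x + h) = (LINT t:{0..2 * pi}|lborel. norm (u t + w t) powr (- (2 * \<beta>)))"
      by (simp add: pair_action_def plus_h1loop.rep_eq u_def w_def algebra_simps)
    moreover have "pair_action \<beta> i j x = (LINT t:{0..2 * pi}|lborel. norm (u t) powr (- (2 * \<beta>)))"
      by (simp add: pair_action_def u_def)
    ultimately have eq: "pair_action \<beta> i j (x + h) - pair_action \<beta> i j x - L h
        = (LINT t:{0..2 * pi}|lborel. ?E t)"
      unfolding L_def w_def[symmetric] using iL[of h] i1 i2
      by (subst set_integral_diff) (simp_all add: w_def[symmetric] set_integral_diff)
    have "\<bar>pair_action \<beta> i j (x + h) - pair_action \<beta> i j x - L h\<bar> \<le> (LINT t:{0..2 * pi}|lborel. \<bar>?E t\<bar>)"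
    proof -
      have "set_integrable lborel {0..2 * pi} (\<lambda>t. ?E t)"
        using iL[of h] i1 i2 by (intro set_integral_diff(1)) (simp_all add: w_def)
      from set_integral_norm_bound[OF this] show ?thesis unfolding eq by simp
    qed
    also have "\<dots> \<le> (LINT t:{0..2 * pi}|lborel. C * 64 * (norm h)\<^sup>2)"
    proof (rule set_integral_mono)
      show "set_integrable lborel {0..2 * pi} (\<lambda>t. \<bar>?E t\<bar>)"
        by (rule borel_integrable_atLeastAtMost') (intro continuous_intros cu cw ca, use u0 uw in auto)
      show "set_integrable lborel {0..2 * pi} (\<lambda>t. C * 64 * (norm h)\<^sup>2)"
        by (rule borel_integrable_atLeastAtMost') simp
      fix t
      have "\<bar>norm (u t + w t) powr (- (2 * \<beta>)) - norm (u t) powr (- (2 * \<beta>))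
          + 2 * \<beta> * norm (u t) powr (- (2 * \<beta>) - 2) * inner (u t) (w t)\<bar> \<le> C * (norm (w t))\<^sup>2"
        unfolding C_def
        by (rule norm_powr_taylor) (use \<delta> w\<delta> \<beta> pn[of x t] in \<open>auto simp: u_def M_def\<close>)
      also have "\<dots> \<le> C * (8 * norm h)\<^sup>2"
        using w[of t] C by (intro mult_left_mono power_mono) auto
      finally show "\<bar>?E t\<bar>
          \<le> C * 64 * (norm h)\<^sup>2"
        by (simp add: a_def power_mult_distrib algebra_simps)
    qed
    also have "\<dots> = 2 * pi * (C * 64) * (norm h)\<^sup>2" by (simp add: set_integral_const)
    finally show "\<bar>pair_action \<beta> i j (x + h) - pair_action \<beta> i j x - L h\<bar> \<le> 2 * pi * (C * 64) * (norm h)\<^sup>2" .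
  qed (use \<delta> in auto)
  then show ?thesis by blast
qed

lemma pair_action_pos:
  assumes x: "collision_free x" and ij: "i \<noteq> j"
  shows "0 < pair_action \<beta> i j x"
    and "loop_potential (2 * \<beta>) (pair_loop i j x)
      = ennreal (pair_action \<beta> i j x)"
proof -
  define u where "u t = curve x t $ i - curve x t $ j" for t
  have u0: "u t \<noteq> 0" for t using x ij by (auto simp: u_def collision_free_def collision_def)
  have cu: "continuous_on {0..2 * pi} u"
    unfolding u_def by (intro continuous_intros continuous_on_curve)
  have cf: "continuous_on {0..2 * pi} (\<lambda>t. norm (u t) powr (- (2 * \<beta>)))"
    by (intro continuous_intros cu) (use u0 in auto)
  note i = borel_integrable_atLeastAtMost'[OF cf]
  have pa: "pair_action \<beta> i j x = (LINT t:{0..2 * pi}|lborel. norm (u t) powr (- (2 * \<beta>)))"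
    by (simp add: pair_action_def u_def)
  obtain t0 where t0: "\<forall>t\<in>{0..2 * pi}. norm (u t0) powr (- (2 * \<beta>)) \<le> norm (u t) powr (- (2 * \<beta>))"
    using continuous_attains_inf[OF compact_Icc _ cf] by auto
  have "(LINT t:{0..2 * pi}|lborel. norm (u t0) powr (- (2 * \<beta>)))
      \<le> (LINT t:{0..2 * pi}|lborel. norm (u t) powr (- (2 * \<beta>)))"
  proof -
    have "set_integrable lborel {0..2 * pi} (\<lambda>t. norm (u t0) powr (- (2 * \<beta>)))"
      by (rule borel_integrable_atLeastAtMost') simp
    then show ?thesis
      using i t0 unfolding set_lebesgue_integral_def set_integrable_def
      by (intro integral_mono) (auto simp: indicator_def)
  qed
  moreover have "0 < (LINT t:{0..2 * pi}|lborel. norm (u t0) powr (- (2 * \<beta>)))"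
    using u0[of t0] by (simp add: set_integral_const)
  ultimately show "0 < pair_action \<beta> i j x" by (simp add: pa)
  have "loop_potential (2 * \<beta>) (pair_loop i j x)
      = (\<integral>\<^sup>+t. ennreal (indicator {0..2 * pi} t *\<^sub>R norm (u t) powr (- (2 * \<beta>))) \<partial>lborel)"
    unfolding loop_potential_def using u0 by (intro nn_integral_cong) (auto simp: indicator_def pair_loop.rep_eq power_potential_def u_def)
  also have "\<dots> = ennreal (pair_action \<beta> i j x)"
    unfolding pa set_lebesgue_integral_def
    by (rule nn_integral_eq_integral) (use i in \<open>auto simp: set_integrable_def\<close>)
  finally show "loop_potential (2 * \<beta>) (pair_loop i j x)
      = ennreal (pair_action \<beta> i j x)" .
qed

definition total_action :: "real \<Rightarrow> real \<Rightarrow> configuration h1loop \<Rightarrow> real" where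
  "total_action \<beta> m x = m\<^sup>2 * (pair_action \<beta> 0 1 x + pair_action \<beta> 1 2 x + pair_action \<beta> 0 2 x)"

lemma total_action_pos: "0 < m \<Longrightarrow> collision_free x \<Longrightarrow> 0 < total_action \<beta> m x"
  unfolding total_action_def by (intro mult_pos_pos add_pos_pos pair_action_pos) auto

lemma potential_integral_collision_free:
  assumes m: "0 < m" and x: "collision_free x"
  shows "potential_integral (2 * \<beta>) m x = ennreal (total_action \<beta> m x)"
proof -
  have p: "0 \<le> pair_action \<beta> 0 1 x" "0 \<le> pair_action \<beta> 1 2 x" "0 \<le> pair_action \<beta> 0 2 x"
    using pair_action_pos(1)[OF x, THEN less_imp_le] by auto
  have "(0::3) \<noteq> 1" "(1::3) \<noteq> 2" "(0::3) \<noteq> 2" by simp_all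
  note e = this[THEN pair_action_pos(2)[OF x]]
  show ?thesis
    unfolding potential_integral_eq[OF m] e total_action_def
    using p by (simp add: ennreal_mult'[symmetric] flip: ennreal_plus)
qed

lemma collision_free_open:
  assumes x: "collision_free x"
  shows "\<exists>r>0. \<forall>y. dist y x < r \<longrightarrow> collision_free y"
proof -
  obtain d where d: "0 < d" "\<And>t i j. i \<noteq> j \<Longrightarrow> d \<le> norm (curve x t $ i - curve x t $ j)"
    using collision_free_distance[OF x] by blast
  have "collision_free y" if y: "dist y x < d / 8" for y
    unfolding collision_free_def collision_def
  proof (intro allI notI)
    fix t assume "\<exists>i j. i \<noteq> j \<and> curve y t $ i = curve y t $ j"
    then obtain i j where ij: "i \<noteq> j" "curve y t $ i = curve y t $ j" by blast
    have "norm (curve (x - y) t $ i - curve (x - y) t $ j) \<le> 2 * norm (curve (x - y) t)"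
      by (rule norm_pair_le)
    also have "\<dots> \<le> 8 * norm (x - y)" using curve_le_norm[of "x - y" t] by simp
    also have "\<dots> < d" using y by (simp add: dist_norm norm_minus_commute)
    also have "d \<le> norm (curve x t $ i - curve x t $ j)" by (rule d(2)[OF ij(1)])
    also have "\<dots> = norm (curve (x - y) t $ i - curve (x - y) t $ j)"
      using ij(2) by (simp add: curve_diff)
    finally show False by simp
  qed
  then show ?thesis using d(1) by (intro exI[of _ "d / 8"]) auto
qed

text \<open>Near \<open>x\<close> the extended value is a power of the real function
  \<open>total_action\<close>. This is positive, which makes the power differentiable, and the Riesz
  representation turns the derivative into a gradient.\<close>

lemma potential_power_gderiv:
  assumes m: "0 < m" and x: "collision_free x" and \<beta>: "0 < \<beta>"
  shows "\<exists>D. GDERIV (\<lambda>x. enn2real (ennreal_powr (potential_integral (2 * \<beta>) m x) q)) x :> D"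
proof -
  have ne: "(0::3) \<noteq> 1" "(1::3) \<noteq> 2" "(0::3) \<noteq> 2" by simp_all
  obtain L1 L2 L3 where L: "(pair_action \<beta> 0 1 has_derivative L1) (at x)"
    "(pair_action \<beta> 1 2 has_derivative L2) (at x)" "(pair_action \<beta> 0 2 has_derivative L3) (at x)"
    using ne[THEN pair_action_has_derivative[OF x _ \<beta>]] by blast
  have "(total_action \<beta> m has_derivative (\<lambda>h. m\<^sup>2 * (L1 h + L2 h + L3 h))) (at x)"
    unfolding total_action_def by (intro derivative_intros L)
  from DERIV_compose_FDERIV[OF has_real_derivative_powr[OF total_action_pos[OF m x], of q] this]
  obtain L' where L': "((\<lambda>y. total_action \<beta> m y powr q) has_derivative L') (at x)" by blast
  obtain r where r: "0 < r" "\<And>y. dist y x < r \<Longrightarrow> collision_free y"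
    using collision_free_open[OF x] by blast
  have "((\<lambda>x. enn2real (ennreal_powr (potential_integral (2 * \<beta>) m x) q)) has_derivative L') (at x)"
  proof (rule has_derivative_transform_within[OF L' r(1)])
    fix y assume "dist y x < r"
    then have y: "collision_free y" by (rule r(2))
    show "total_action \<beta> m y powr q = enn2real (ennreal_powr (potential_integral (2 * \<beta>) m y) q)"
      unfolding potential_integral_collision_free[OF m y] ennreal_powr_def
      using total_action_pos[OF m y, of \<beta>] by simp
  qed simp
  moreover obtain D where "\<And>h. L' h = inner h D"
    using h1loop_riesz_representation[OF has_derivative_bounded_linear[OF L']] by blast
  then have "L' = (\<lambda>h. inner h D)" by auto
  ultimately show ?thesis unfolding gderiv_def by blast
qed

section \<open>Existence of a minimizer\<close>

text \<open>With the generator eliminated, membership consists of pointwise linear equations for the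
  curve. These pass to pointwise limits and to multiples.\<close>

lemma H_eight_iff:
  "x \<in> H_eight \<longleftrightarrow>
    (\<forall>t. curve x t $ 1 = curve x (t + 2 * pi / 3) $ 0) \<and> (\<forall>t. curve x t $ 2 = curve x (t + 4 * pi / 3) $ 0) \<and>
    curve x 0 $ 0 = 0 \<and>
    (\<forall>t. curve x (t + pi) $ 0 $ 1 = curve x t $ 0 $ 1 \<and> curve x (t + pi) $ 0 $ 2 = - (curve x t $ 0 $ 2)) \<and>
    (\<forall>t. curve x (pi / 2 + t) $ 0 $ 1 = - (curve x (pi / 2 - t) $ 0 $ 1)
      \<and> curve x (pi / 2 + t) $ 0 $ 2 = curve x (pi / 2 - t) $ 0 $ 2)" (is "_ \<longleftrightarrow> ?R")
proof
  assume "x \<in> H_eight"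
  then obtain \<gamma> where g: "eight_generator \<gamma>" "\<And>t. curve x t $ 0 = curve \<gamma> t"
    "\<And>t. curve x t $ 1 = curve \<gamma> (t + 2 * pi / 3)" "\<And>t. curve x t $ 2 = curve \<gamma> (t + 4 * pi / 3)"
    using H_eightE[of x] by metis
  have "curve \<gamma> 0 = 0" "\<And>t. curve \<gamma> (t + pi) = vector [curve \<gamma> t $ 1, - (curve \<gamma> t $ 2)]"
    "\<And>t. curve \<gamma> (pi / 2 + t) = vector [- (curve \<gamma> (pi / 2 - t) $ 1), curve \<gamma> (pi / 2 - t) $ 2]"
    using g(1) unfolding eight_generator_def by blast+
  then show ?R unfolding g(2-4) by simp
next
  assume R: ?R
  have w: "has_weak_derivative (\<lambda>t. curve x t $ 0) (\<lambda>t. velocity x t $ 0)"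
    by (rule has_weak_derivative_bounded_linear[OF bounded_linear_vec_nth has_weak_derivative_velocity])
  define \<gamma> where "\<gamma> = Abs_h1loop (\<lambda>t. curve x t $ 0)"
  have cg: "curve \<gamma> = (\<lambda>t. curve x t $ 0)"
    unfolding \<gamma>_def using w by (intro Abs_h1loop_inverse) auto
  have "eight_generator \<gamma>"
    unfolding eight_generator_def cg using R by (simp add: vec_eq_iff[of _ "vector _"] forall_2)
  moreover have "curve x t $ of_nat i = curve \<gamma> (t + 2 * pi * real i / 3)" if "i < 3" for i :: nat and t
  proof -
    have "i = 0 \<or> i = 1 \<or> i = 2" using that by auto
    then show ?thesis using R by (auto simp: cg mult.commute)
  qed
  ultimately show "x \<in> H_eight" unfolding H_eight_def by blast
qed

lemma H_eight_pointwise_limit: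
  assumes X: "\<And>n. X n \<in> H_eight" and lim: "\<And>t. (\<lambda>n. curve (X n) t) \<longlonglongrightarrow> curve x t"
  shows "x \<in> H_eight"
proof -
  note C = X[unfolded H_eight_iff]
  have l1: "(\<lambda>n. curve (X n) t $ i) \<longlonglongrightarrow> curve x t $ i" for t i
    by (intro tendsto_intros lim)
  have l2: "(\<lambda>n. curve (X n) t $ i $ j) \<longlonglongrightarrow> curve x t $ i $ j" for t i j
    by (intro tendsto_intros lim)
  have l3: "(\<lambda>n. - (curve (X n) t $ i $ j)) \<longlonglongrightarrow> - (curve x t $ i $ j)" for t i j
    by (intro tendsto_intros lim)
  have "curve x t $ 1 = curve x (t + 2 * pi / 3) $ 0" for t
    by (rule LIMSEQ_unique[OF l1]) (use C l1[of "t + 2 * pi / 3" 0] in simp)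
  moreover have "curve x t $ 2 = curve x (t + 4 * pi / 3) $ 0" for t
    by (rule LIMSEQ_unique[OF l1]) (use C l1[of "t + 4 * pi / 3" 0] in simp)
  moreover have "curve x 0 $ 0 = 0"
    by (rule LIMSEQ_unique[OF l1]) (use C in simp)
  moreover have "curve x (t + pi) $ 0 $ 1 = curve x t $ 0 $ 1" for t
    by (rule LIMSEQ_unique[OF l2]) (use C l2[of t 0 1] in simp)
  moreover have "curve x (t + pi) $ 0 $ 2 = - (curve x t $ 0 $ 2)" for t
    by (rule LIMSEQ_unique[OF l2]) (use C l3[of t 0 2] in simp)
  moreover have "curve x (pi / 2 + t) $ 0 $ 1 = - (curve x (pi / 2 - t) $ 0 $ 1)" for t
    by (rule LIMSEQ_unique[OF l2]) (use C l3[of "pi / 2 - t" 0 1] in simp)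
  moreover have "curve x (pi / 2 + t) $ 0 $ 2 = curve x (pi / 2 - t) $ 0 $ 2" for t
    by (rule LIMSEQ_unique[OF l2]) (use C l2[of "pi / 2 - t" 0 2] in simp)
  ultimately show ?thesis unfolding H_eight_iff by blast
qed

lemma H_eight_scaleR: "x \<in> H_eight \<Longrightarrow> r *\<^sub>R x \<in> H_eight"
  unfolding H_eight_iff scaleR_h1loop.rep_eq by simp

lemma M_eight_iff: "0 < m \<Longrightarrow> x \<in> M_eight m \<longleftrightarrow> x \<in> H_eight \<and> energy x = 2 / m"
  by (auto simp: M_eight_def kinetic_eq field_simps)

text \<open>A Poincare inequality: body 0 is at the origin at time 0, and the other bodies run
  through the same curve.\<close>

lemma H_eight_norm_le:
  assumes "x \<in> H_eight"
  shows "(norm (curve x t))\<^sup>2 \<le> 6 * pi * energy x"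
proof -
  note C = assms[unfolded H_eight_iff]
  have b: "(norm (curve x s $ 0))\<^sup>2 \<le> 2 * pi * energy x" for s
  proof -
    obtain r where r: "r \<in> {0..2 * pi}" "curve x s = curve x r" by (rule curve_reduce)
    have "norm (curve x r $ 0) \<le> norm (curve x r - curve x 0)"
      using C Finite_Cartesian_Product.norm_nth_le[of "curve x r - curve x 0" 0] by simp
    then have "(norm (curve x r $ 0))\<^sup>2 \<le> (norm (curve x r - curve x 0))\<^sup>2"
      by (intro power_mono) auto
    also have "\<dots> \<le> (r - 0) * energy x" using r by (intro curve_holder) auto
    also have "\<dots> \<le> 2 * pi * energy x" using r energy_nonneg[of x] by (intro mult_right_mono) auto
    finally show ?thesis by (simp add: r(2))
  qed
  have "(norm (curve x t))\<^sup>2 = (norm (curve x t $ 0))\<^sup>2 + (norm (curve x (t + 2 * pi / 3) $ 0))\<^sup>2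
      + (norm (curve x (t + 4 * pi / 3) $ 0))\<^sup>2"
    unfolding norm_configuration_square using C by simp
  then show ?thesis using b[of t] b[of "t + 2 * pi / 3"] b[of "t + 4 * pi / 3"] by linarith
qed

lemma curve_equicontinuous:
  assumes "s \<in> {0..2 * pi}" "t \<in> {0..2 * pi}"
  shows "(norm (curve x s - curve x t))\<^sup>2 \<le> \<bar>s - t\<bar> * energy x"
proof (cases "s \<le> t")
  case True
  then show ?thesis using curve_holder[of s t x] assms by (simp add: norm_minus_commute)
next
  case False
  then show ?thesis using curve_holder[of t s x] assms by simp
qed

text \<open>Continuity includes the collision value, so Fatou's lemma also covers limits that do
  collide.\<close>

lemma power_potential_tendsto:
  assumes \<alpha>: "0 < \<alpha>" and r: "\<And>n. 0 \<le> r n" "r \<longlonglongrightarrow> l"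
  shows "(\<lambda>n. power_potential \<alpha> (r n)) \<longlonglongrightarrow> power_potential \<alpha> l"
proof (cases "l = 0")
  case True
  have "\<forall>\<^sub>F n in sequentially. ennreal K < power_potential \<alpha> (r n)" if K: "0 \<le> K" for K
  proof -
    define b where "b = (K + 1) powr (- (1 / \<alpha>))"
    have "0 < b" using K by (simp add: b_def)
    then have "\<forall>\<^sub>F n in sequentially. r n < b"
      using order_tendstoD(2)[OF r(2)] True by simp
    then show ?thesis
    proof eventually_elim
      fix n assume n: "r n < b"
      show "ennreal K < power_potential \<alpha> (r n)"
      proof (cases "r n = 0")
        case False
        then have rn: "0 < r n" using r(1)[of n] by simp
        have "K + 1 = b powr (- \<alpha>)" using \<alpha> K by (simp add: b_def powr_powr)
        also have "\<dots> \<le> r n powr (- \<alpha>)" using n rn \<alpha> by (intro powr_mono2') auto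
        finally have "ennreal K < ennreal (r n powr (- \<alpha>))" using K by (intro ennreal_lessI) auto
        then show ?thesis using False by (simp add: power_potential_def)
      qed (simp add: power_potential_def ennreal_less_top)
    qed
  qed
  then have "(\<lambda>n. power_potential \<alpha> (r n)) \<longlonglongrightarrow> top"
    unfolding tendsto_top_iff_ennreal by blast
  then show ?thesis using True by (simp add: power_potential_def)
next
  case False
  have "0 \<le> l" using LIMSEQ_le_const[OF r(2)] r(1) by blast
  then have l: "0 < l" using False by simp
  have "(\<lambda>n. ennreal (r n powr (- \<alpha>))) \<longlonglongrightarrow> ennreal (l powr (- \<alpha>))"
    using l by (intro tendsto_intros r(2)) auto
  moreover have "\<forall>\<^sub>F n in sequentially. ennreal (r n powr (- \<alpha>)) = power_potential \<alpha> (r n)"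
    using order_tendstoD(1)[OF r(2) l] by eventually_elim (simp add: power_potential_def)
  ultimately show ?thesis
    using False by (simp add: power_potential_def tendsto_cong)
qed

lemma potential_integral_lower_semicontinuous:
  assumes m: "0 < m" and \<alpha>: "0 < \<alpha>" and lim: "\<And>t. (\<lambda>n. curve (X n) t) \<longlonglongrightarrow> curve x t"
  shows "potential_integral \<alpha> m x \<le> liminf (\<lambda>n. potential_integral \<alpha> m (X n))"
proof -
  let ?p = "\<lambda>x t. potential \<alpha> m (curve x t) * indicator {0..2 * pi} t"
  have meas: "?p x \<in> borel_measurable lborel" for x
  proof -
    have "?p x = (\<lambda>t. ennreal (m\<^sup>2) * (power_potential \<alpha> (norm (curve (pair_loop 0 1 x) t))
      + power_potential \<alpha> (norm (curve (pair_loop 1 2 x) t)) + power_potential \<alpha> (norm (curve (pair_loop 0 2 x) t)))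
      * indicator {0..2 * pi} t)"
      by (simp add: potential_eq_sum[OF m] pair_loop.rep_eq)
    then show ?thesis by (simp only:) measurable
  qed
  have "potential_integral \<alpha> m x = (\<integral>\<^sup>+t. liminf (\<lambda>n. ?p (X n) t) \<partial>lborel)"
    unfolding potential_integral_def
  proof (rule nn_integral_cong)
    fix t
    have "(\<lambda>n. potential \<alpha> m (curve (X n) t)) \<longlonglongrightarrow> potential \<alpha> m (curve x t)"
      unfolding potential_eq_sum[OF m]
      by (intro ennreal_tendsto_cmult tendsto_add power_potential_tendsto[OF \<alpha>] tendsto_intros lim) simp_all
    then have "(\<lambda>n. ?p (X n) t) \<longlonglongrightarrow> ?p x t"
      by (cases "t \<in> {0..2 * pi}") simp_all
    then show "?p x t = liminf (\<lambda>n. ?p (X n) t)"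
      using lim_imp_Liminf[OF sequentially_bot] by metis
  qed
  also have "\<dots> \<le> liminf (\<lambda>n. potential_integral \<alpha> m (X n))"
    unfolding potential_integral_def by (rule nn_integral_liminf) (rule meas)
  finally show ?thesis .
qed

text \<open>This lets pointwise limits pass from the tails of a sequence to their convex
  hulls.\<close>

lemma convex_curve_near: "convex {u. norm (curve u t - c) \<le> e}"
proof (rule convexI)
  fix x y and a b :: real
  assume x: "x \<in> {u. norm (curve u t - c) \<le> e}" and y: "y \<in> {u. norm (curve u t - c) \<le> e}"
    and ab: "0 \<le> a" "0 \<le> b" "a + b = 1"
  have "curve (a *\<^sub>R x + b *\<^sub>R y) t - c = a *\<^sub>R (curve x t - c) + b *\<^sub>R (curve y t - c)"
  proof -
    have c: "a *\<^sub>R c + b *\<^sub>R c = c" using ab(3) by (simp flip: scaleR_add_left)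
    have "a *\<^sub>R (curve x t - c) + b *\<^sub>R (curve y t - c)
        = a *\<^sub>R curve x t + b *\<^sub>R curve y t - (a *\<^sub>R c + b *\<^sub>R c)"
      by (simp add: scaleR_diff_right)
    then show ?thesis
      unfolding c by (simp add: plus_h1loop.rep_eq scaleR_h1loop.rep_eq)
  qed
  also have "norm \<dots> \<le> a * norm (curve x t - c) + b * norm (curve y t - c)"
    using ab by (intro norm_triangle_le) simp
  also have "\<dots> \<le> a * e + b * e"
    using x y ab by (intro add_mono mult_left_mono) auto
  also have "\<dots> = e" using ab(3) by (simp flip: distrib_right)
  finally show "a *\<^sub>R x + b *\<^sub>R y \<in> {u. norm (curve u t - c) \<le> e}" by simp
qed

text \<open>
  The norm limit of convex combinations of the tails is the uniform limit of a subsequence, and its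
  norm is at most the limit of the norms along that subsequence.
\<close>

lemma M_eight_compactness:
  assumes m: "0 < m" and X: "\<And>n. X n \<in> M_eight m"
  shows "\<exists>k z. strict_mono (k :: nat \<Rightarrow> nat) \<and> z \<in> H_eight \<and> energy z \<le> 2 / m
    \<and> (\<forall>t. (\<lambda>n. curve (X (k n)) t) \<longlonglongrightarrow> curve z t)"
proof -
  let ?I = "{0..2 * pi}"
  have XH: "X n \<in> H_eight" and XE: "energy (X n) = 2 / m" for n
    using X[of n] m by (simp_all add: M_eight_iff)
  define b where "b = 12 * pi / m"
  have b: "0 \<le> b" using m by (simp add: b_def)
  have Xb: "(norm (curve (X n) t))\<^sup>2 \<le> b" for n t
    using H_eight_norm_le[OF XH[of n], of t] by (simp add: XE b_def)
  obtain g k where g: "strict_mono (k :: nat \<Rightarrow> nat)"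
    "\<And>e. 0 < e \<Longrightarrow> \<exists>N. \<forall>n t. n \<ge> N \<and> t \<in> ?I \<longrightarrow> norm (curve (X (k n)) t - g t) < e"
  proof (rule Arzela_Ascoli[of ?I "\<lambda>n. curve (X n)" "sqrt b"])
    show "norm (curve (X n) t) \<le> sqrt b" for n t
      using Xb[of n t] by (intro real_le_rsqrt)
    fix t e :: real assume t: "t \<in> ?I" and e: "0 < e"
    \<comment> \<open>The energy is 2 / m along the sequence, so the Hoelder estimate gives |x(t) -
      x(s)|^2 < d * 2 / m = e^2.\<close>
    define d where "d = e\<^sup>2 * m / 2"
    have d: "0 < d" using e m by (simp add: d_def)
    have "norm (curve (X n) t - curve (X n) s) < e" if s: "s \<in> ?I" "norm (t - s) < d" for n s
    proof -
      have "(norm (curve (X n) t - curve (X n) s))\<^sup>2 \<le> \<bar>t - s\<bar> * (2 / m)"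
        using curve_equicontinuous[OF t s(1), of "X n"] by (simp add: XE)
      also have "\<dots> < d * (2 / m)" using s(2) m by (intro mult_strict_right_mono) auto
      also have "\<dots> = e\<^sup>2" using m by (simp add: d_def)
      finally show ?thesis by (rule power2_less_imp_less) (use e in simp)
    qed
    then show "\<exists>d>0. \<forall>n s. s \<in> ?I \<and> norm (t - s) < d \<longrightarrow> norm (curve (X n) t - curve (X n) s) < e"
      using d by blast
  qed (auto intro: that)
  define W where "W n = X (k n)" for n
  \<comment> \<open>The uniform limit is obtained on one period only and is continued periodically
    here.\<close>
  define Y where "Y t = g (t - 2 * pi * of_int \<lfloor>t / (2 * pi)\<rfloor>)" for t
  have WY: "(\<lambda>n. curve (W n) t) \<longlonglongrightarrow> Y t" for t
  proof -
    define s where "s = t - 2 * pi * of_int \<lfloor>t / (2 * pi)\<rfloor>"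
    have "of_int \<lfloor>t / (2 * pi)\<rfloor> * (2 * pi) \<le> t" "t < (of_int \<lfloor>t / (2 * pi)\<rfloor> + 1) * (2 * pi)"
      by (simp_all flip: pos_le_divide_eq pos_divide_less_eq)
    then have s: "s \<in> ?I" by (simp add: s_def algebra_simps)
    have "(\<lambda>n. curve (W n) s) \<longlonglongrightarrow> g s"
    proof (rule LIMSEQ_I)
      fix e :: real assume "0 < e"
      from g(2)[OF this] show "\<exists>N. \<forall>n\<ge>N. norm (curve (W n) s - g s) < e"
        using s unfolding W_def by blast
    qed
    moreover have "curve (W n) t = curve (W n) s" for n
      unfolding s_def by (rule curve_floor)
    ultimately show ?thesis
      unfolding Y_def s_def[symmetric] by simp
  qed
  have WE: "energy (W n) = 2 / m" and Wb: "(norm (curve (W n) t))\<^sup>2 \<le> b" and WH: "W n \<in> H_eight" for n t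
    by (simp_all add: W_def XE Xb XH)
  define J where "J = (LINT t:?I|lborel. (norm (Y t))\<^sup>2)"
  have J: "(\<lambda>n. LINT t:?I|lborel. (norm (curve (W n) t))\<^sup>2) \<longlonglongrightarrow> J"
    unfolding J_def set_lebesgue_integral_def
  proof (rule integral_dominated_convergence)
    have Ym: "Y \<in> borel_measurable borel"
      by (rule borel_measurable_LIMSEQ_metric[where f = "\<lambda>n. curve (W n)"]) (use WY in auto)
    then show "(\<lambda>t. indicator ?I t *\<^sub>R (norm (Y t))\<^sup>2) \<in> borel_measurable lborel" by measurable
    show "integrable lborel (\<lambda>t. indicator ?I t *\<^sub>R b)"
      using borel_integrable_atLeastAtMost'[of 0 "2 * pi" "\<lambda>t. b"] by (simp add: set_integrable_def)
    show "AE t in lborel. (\<lambda>n. indicator ?I t *\<^sub>R (norm (curve (W n) t))\<^sup>2) \<longlonglongrightarrow> indicator ?I t *\<^sub>R (norm (Y t))\<^sup>2"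
      by (intro AE_I2 tendsto_intros WY)
    show "AE t in lborel. norm (indicator ?I t *\<^sub>R (norm (curve (W n) t))\<^sup>2) \<le> indicator ?I t *\<^sub>R b" for n
      using Wb by (auto simp: indicator_def)
  qed measurable
  have nW: "(norm (W n))\<^sup>2 = (LINT t:?I|lborel. (norm (curve (W n) t))\<^sup>2) + 2 / m" for n
    unfolding norm_h1loop_square WE by simp
  have "(\<lambda>n. (norm (W n))\<^sup>2) \<longlonglongrightarrow> J + 2 / m"
    unfolding nW by (intro tendsto_intros J)
  note nlim = this
  then obtain B where B: "\<And>n. norm ((norm (W n))\<^sup>2) \<le> B"
    using convergent_imp_Bseq[OF convergentI, of "\<lambda>n. (norm (W n))\<^sup>2"] unfolding Bseq_def by blast
  have "norm (W n) \<le> sqrt B" for n using B[of n] by (intro real_le_rsqrt) simp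
  then obtain y where y: "Cauchy y" "\<And>n. y n \<in> convex hull (W ` {n..})"
    using Cauchy_convex_hull_tails[of W] by blast
  obtain z where z: "y \<longlonglongrightarrow> z" using h1loop_Cauchy_convergent[OF y(1)] by blast
  have yhull: "y n \<in> C" if "convex C" "\<And>j. n \<le> j \<Longrightarrow> W j \<in> C" for n C
    using y(2)[of n] hull_minimal[of "W ` {n..}" C convex] that by auto
  have cz: "curve z t = Y t" for t
  proof (rule LIMSEQ_unique)
    show "(\<lambda>n. curve (y n) t) \<longlonglongrightarrow> curve z t"
    proof (rule LIM_zero_cancel, rule Lim_null_comparison)
      show "\<forall>\<^sub>F n in sequentially. norm (curve (y n) t - curve z t) \<le> 4 * norm (y n - z)"
        using curve_le_norm[of "y _ - z" t] by (simp add: curve_diff)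
      have "(\<lambda>n. 4 * norm (y n - z)) \<longlonglongrightarrow> 4 * norm (z - z)"
        by (intro tendsto_intros z)
      then show "(\<lambda>n. 4 * norm (y n - z)) \<longlonglongrightarrow> 0" by simp
    qed
    show "(\<lambda>n. curve (y n) t) \<longlonglongrightarrow> Y t"
    proof (rule LIMSEQ_I)
      fix e :: real assume "0 < e"
      then have "0 < e / 2" by simp
      from LIMSEQ_D[OF WY this] obtain N where N: "\<And>n. N \<le> n \<Longrightarrow> norm (curve (W n) t - Y t) < e / 2"
        by blast
      have le: "norm (curve (y n) t - Y t) \<le> e / 2" if n: "N \<le> n" for n
      proof -
        have "y n \<in> {u. norm (curve u t - Y t) \<le> e / 2}"
        proof (rule yhull[OF convex_curve_near])
          fix j assume "n \<le> j"
          then show "W j \<in> {u. norm (curve u t - Y t) \<le> e / 2}" using N[of j] n by simp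
        qed
        then show ?thesis by simp
      qed
      show "\<exists>N. \<forall>n\<ge>N. norm (curve (y n) t - Y t) < e"
      proof (intro exI allI impI)
        fix n assume "N \<le> n"
        from le[OF this] show "norm (curve (y n) t - Y t) < e" using \<open>0 < e\<close> by linarith
      qed
    qed
  qed
  \<comment> \<open>The mean square parts of the norms converge to \<open>J\<close>, which is
    exactly that part for \<open>z\<close>. A bound of the whole squared norm of \<open>z\<close> by
    J + 2 / m therefore leaves 2 / m for the energy.\<close>
  have "energy z \<le> 2 / m"
  proof (rule field_le_epsilon)
    fix e :: real assume e: "0 < e"
    have "\<forall>\<^sub>F n in sequentially. (norm (W n))\<^sup>2 < J + 2 / m + e"
      using order_tendstoD(2)[OF nlim] e by simp
    then obtain N where N: "\<And>n. N \<le> n \<Longrightarrow> (norm (W n))\<^sup>2 < J + 2 / m + e"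
      by (auto simp: eventually_sequentially)
    have "norm (y n) \<le> sqrt (J + 2 / m + e)" if n: "N \<le> n" for n
    proof -
      have "W j \<in> cball 0 (sqrt (J + 2 / m + e))" if "n \<le> j" for j
        using real_le_rsqrt[OF less_imp_le[OF N[of j]]] n that by simp
      then have "y n \<in> cball 0 (sqrt (J + 2 / m + e))" by (intro yhull convex_cball)
      then show ?thesis by simp
    qed
    moreover have "(\<lambda>n. norm (y n)) \<longlonglongrightarrow> norm z" by (intro tendsto_intros z)
    ultimately have "norm z \<le> sqrt (J + 2 / m + e)"
      by (intro tendsto_upperbound[of "\<lambda>n. norm (y n)" _ sequentially]) (auto simp: eventually_sequentially)
    moreover have "0 \<le> J + 2 / m + e"
      using e m unfolding J_def by (intro add_nonneg_nonneg set_integral_nonneg_real) auto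
    ultimately have "(norm z)\<^sup>2 \<le> J + 2 / m + e"
      using power_mono[of "norm z" "sqrt (J + 2 / m + e)" 2] by simp
    then show "energy z \<le> 2 / m + e"
      unfolding norm_h1loop_square cz J_def by simp
  qed
  moreover have zl: "(\<lambda>n. curve (X (k n)) t) \<longlonglongrightarrow> curve z t" for t
    using WY[of t] by (simp add: cz W_def)
  moreover have "z \<in> H_eight" by (rule H_eight_pointwise_limit[OF XH zl])
  ultimately show ?thesis using g(1) by blast
qed

lemma power_potential_scale:
  assumes "1 \<le> c" "0 < \<alpha>" "0 \<le> r"
  shows "power_potential \<alpha> (c * r) \<le> power_potential \<alpha> r"
proof (cases "r = 0")
  case False
  have "(c * r) powr (- \<alpha>) \<le> r powr (- \<alpha>)"
    using assms False mult_right_mono[of 1 c r] by (intro powr_mono2') auto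
  then show ?thesis using False assms by (simp add: power_potential_def ennreal_leI)
qed (simp add: power_potential_def)

lemma potential_integral_minimizer:
  assumes m: "0 < m" and \<alpha>: "0 < \<alpha>" and fin: "x0 \<in> M_eight m" "potential_integral \<alpha> m x0 < \<infinity>"
  obtains x where "x \<in> M_eight m" "\<And>y. y \<in> M_eight m \<Longrightarrow> potential_integral \<alpha> m x \<le> potential_integral \<alpha> m y"
proof -
  let ?V = "potential_integral \<alpha> m"
  define v where "v = Inf (?V ` M_eight m)"
  have vle: "v \<le> ?V y" if "y \<in> M_eight m" for y unfolding v_def by (rule Inf_lower) (use that in auto)
  obtain u where u: "\<And>n. u n \<in> ?V ` M_eight m" "u \<longlonglongrightarrow> v"
    using Inf_as_limit[of "?V ` M_eight m"] fin(1) unfolding v_def by blast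
  have "\<exists>x. x \<in> M_eight m \<and> u n = ?V x" for n using u(1)[of n] by auto
  then obtain X where X': "\<And>n. X n \<in> M_eight m \<and> u n = ?V (X n)" by metis
  have "u = (\<lambda>n. ?V (X n))" using X' by (intro ext) blast
  then have X: "\<And>n. X n \<in> M_eight m" "(\<lambda>n. ?V (X n)) \<longlonglongrightarrow> v" using u(2) X' by simp_all
  obtain k z where z: "strict_mono k" "z \<in> H_eight" "energy z \<le> 2 / m"
    "\<And>t. (\<lambda>n. curve (X (k n)) t) \<longlonglongrightarrow> curve z t"
    using M_eight_compactness[of m X, OF m X(1)] by blast
  have "?V z \<le> liminf (\<lambda>n. ?V (X (k n)))"
    by (rule potential_integral_lower_semicontinuous[OF m \<alpha> z(4)])
  also have "\<dots> = v"
    using LIMSEQ_subseq_LIMSEQ[OF X(2) z(1)] by (intro lim_imp_Liminf) (simp_all add: comp_def)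
  finally have Vz: "?V z \<le> v" .
  have "v < \<infinity>" using vle[OF fin(1)] fin(2) by simp
  \<comment> \<open>Scaling needs positive energy. With zero energy the loop would rest at 0, a
    permanent collision of infinite potential.\<close>
  have e0: "0 < energy z"
  proof (rule ccontr)
    assume "\<not> 0 < energy z"
    then have "energy z = 0" using energy_nonneg[of z] by simp
    then have "curve z t = 0" for t using H_eight_norm_le[OF z(2), of t] by simp
    then have "?V z = (\<integral>\<^sup>+t\<in>{0..2 * pi}. \<infinity> \<partial>lborel)"
      unfolding potential_integral_def by (simp add: potential_eq collision_iff)
    also have "\<dots> = \<infinity>" by (subst nn_integral_cmult_indicator) (auto simp: ennreal_top_mult)
    finally show False using Vz \<open>v < \<infinity>\<close> by simp
  qed
  define c where "c = sqrt (2 / m / energy z)"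
  have c: "1 \<le> c" "c\<^sup>2 * energy z = 2 / m"
    using z(3) e0 m by (simp_all add: c_def field_simps)
  define x where "x = c *\<^sub>R z"
  have xM: "x \<in> M_eight m"
    unfolding M_eight_iff[OF m] x_def energy_scaleR using H_eight_scaleR[OF z(2)] c by simp
  have "?V x \<le> ?V z"
    unfolding potential_integral_def
  proof (intro nn_integral_mono mult_right_mono)
    fix t
    have "norm (curve x t $ i - curve x t $ j) = c * norm (curve z t $ i - curve z t $ j)" for i j
      using c(1) by (simp add: x_def scaleR_h1loop.rep_eq flip: scaleR_diff_right)
    then show "potential \<alpha> m (curve x t) \<le> potential \<alpha> m (curve z t)"
      unfolding potential_eq_sum[OF m] using c(1) \<alpha>
      by (intro mult_left_mono add_mono) (auto simp: power_potential_scale)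
  qed simp
  then show thesis using that[OF xM] Vz vle by (meson order_trans)
qed

lemma eight_minimizer_collision_free:
  assumes m: "0 < m" and \<alpha>: "0 < \<alpha>" "\<alpha> \<le> 2"
  obtains x where "x \<in> M_eight m" "collision_free x"
    "\<And>y. y \<in> M_eight m \<Longrightarrow> potential_integral \<alpha> m x \<le> potential_integral \<alpha> m y"
proof -
  define \<beta> where "\<beta> = \<alpha> / 2"
  have \<beta>: "0 < \<beta>" "\<beta> \<le> 1" "\<alpha> = 2 * \<beta>" using \<alpha> by (simp_all add: \<beta>_def)
  \<comment> \<open>The lower bound on n \<beta> serves the collision estimate, the upper bound on
    (n - 1) \<beta> the test loop. For \<beta> between 1/2 and 1 both hold with 2, and otherwise
    with the ceiling of 1 / \<beta>.\<close>
  obtain n where n: "2 \<le> n" "1 \<le> real n * \<beta>" "(real n - 1) * \<beta> \<le> 1"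
  proof (cases "1 \<le> 2 * \<beta>")
    case True
    then show ?thesis using that[of 2] \<beta> by simp
  next
    case False
    define n where "n = nat \<lceil>1 / \<beta>\<rceil>"
    have b: "2 < 1 / \<beta>" using False \<beta> by (simp add: field_simps)
    then have "real n = of_int \<lceil>1 / \<beta>\<rceil>" by (simp add: n_def)
    then have "1 / \<beta> \<le> real n" "real n - 1 \<le> 1 / \<beta>" by linarith+
    then have "1 \<le> real n * \<beta>" "(real n - 1) * \<beta> \<le> 1"
      using \<beta> by (simp_all add: field_simps)
    moreover have "2 \<le> n" using b \<open>1 / \<beta> \<le> real n\<close> by linarith
    ultimately show ?thesis using that by blast
  qed
  let ?L = "ennreal (m\<^sup>2 * (6 * pi * (pi * m * collision_level n) powr \<beta>))"
  obtain x0 where x0: "x0 \<in> M_eight m" "potential_integral \<alpha> m x0 < ?L"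
    using test_loop_exists[OF m \<beta>(1) n(1,3)] unfolding \<beta>(3) by blast
  have "potential_integral \<alpha> m x0 < \<infinity>" using less_trans[OF x0(2) ennreal_less_top] by simp
  then obtain x where x: "x \<in> M_eight m" "\<And>y. y \<in> M_eight m \<Longrightarrow> potential_integral \<alpha> m x \<le> potential_integral \<alpha> m y"
    using potential_integral_minimizer[OF m \<alpha>(1) x0(1)] by blast
  moreover have "collision_free x"
  proof (rule ccontr)
    assume "\<not> collision_free x"
    then have "?L \<le> potential_integral \<alpha> m x"
      using potential_integral_collision_ge[OF m \<beta>(1) n(1,2) x(1)] by (simp add: \<beta>(3))
    then show False using x(2)[OF x0(1)] x0(2) by simp
  qed
  ultimately show thesis using that by blast
qed

lemma ennreal_powr_mono: "0 < q \<Longrightarrow> a \<le> b \<Longrightarrow> ennreal_powr a q \<le> ennreal_powr b q"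
  unfolding ennreal_powr_def
  by (auto simp: top_unique intro!: ennreal_leI powr_mono2 enn2real_mono simp: top.not_eq_extremum)

theorem proposition4p2:
  fixes \<alpha> m q :: real and f :: "configuration h1loop \<Rightarrow> ennreal"
  assumes "0 < \<alpha>" "\<alpha> \<le> 2" "0 < m"
    and q_def: "q = 2 / (\<alpha> + 2)"
    and f_def: "f = (\<lambda>x. ennreal_powr (potential_integral \<alpha> m x) q)"
  shows "\<exists>x\<^sub>s \<in> M_eight m.
           f x\<^sub>s = (INF x\<in>M_eight m. f x) \<and>
           (\<exists>X G r.
              (\<forall>n::nat. X n \<in> M_eight m \<and> collision_free (X n)) \<and>
              (\<lambda>n. f (X n)) \<longlonglongrightarrow> (INF x\<in>M_eight m. f x) \<and>
              (\<forall>n. has_tangential_gradient (\<lambda>x. enn2real (f x)) (M_eight m) (X n) (G n)) \<and>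
              (\<lambda>n. norm (G n)) \<longlonglongrightarrow> 0 \<and>
              strict_mono (r :: nat \<Rightarrow> nat) \<and>
              (\<lambda>n. X (r n)) \<longlonglongrightarrow> x\<^sub>s \<and>
              uniform_limit UNIV (\<lambda>n. curve (X (r n))) (curve x\<^sub>s) sequentially)"
proof -
  obtain x where x: "x \<in> M_eight m" "collision_free x"
    "\<And>y. y \<in> M_eight m \<Longrightarrow> potential_integral \<alpha> m x \<le> potential_integral \<alpha> m y"
    using eight_minimizer_collision_free[of m \<alpha>] assms by blast
  have q: "0 < q" using assms by simp
  have fmin: "f x \<le> f y" if "y \<in> M_eight m" for y
    unfolding f_def using ennreal_powr_mono[OF q x(3)[OF that]] .
  have inf: "f x = (INF x\<in>M_eight m. f x)"
    by (rule antisym) (auto intro: INF_greatest INF_lower fmin x(1))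
  have fin: "f y < \<infinity>" if "collision_free y" for y
    using potential_integral_collision_free[OF assms(3) that, of "\<alpha> / 2"]
    by (simp add: f_def ennreal_powr_def)
  obtain D where D: "GDERIV (\<lambda>x. enn2real (f x)) x :> D"
    using potential_power_gderiv[OF assms(3) x(2), of "\<alpha> / 2" q] assms(1) by (auto simp: f_def)
  have "has_tangential_gradient (\<lambda>x. enn2real (f x)) (M_eight m) x 0"
    unfolding has_tangential_gradient_def
  proof (intro exI[of _ D] conjI ballI)
    show "GDERIV (\<lambda>x. enn2real (f x)) x :> D" by (rule D)
    show "0 \<in> tangent_space (M_eight m) x"
      unfolding tangent_space_def using x(1) by (auto intro!: exI[of _ "\<lambda>_. x"])
    \<comment> \<open>Tangent vectors are velocities of curves inside the constraint set. Along such
      a curve the function has a local minimum at 0, so \<open>D\<close> is orthogonal to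
      \<open>v\<close> and its projection is 0.\<close>
    fix v assume "v \<in> tangent_space (M_eight m) x"
    then obtain c where c: "c 0 = x" "\<And>s. c s \<in> M_eight m" "(c has_vector_derivative v) (at 0)"
      unfolding tangent_space_def by blast
    have "((\<lambda>s. enn2real (f (c s))) has_derivative (\<lambda>s. inner (s *\<^sub>R v) D)) (at 0)"
      using has_derivative_compose[OF c(3)[unfolded has_vector_derivative_def], of "\<lambda>x. enn2real (f x)" "\<lambda>h. inner h D"] D
      by (simp add: c(1) gderiv_def)
    then have der: "((\<lambda>s. enn2real (f (c s))) has_real_derivative inner v D) (at 0)"
      by (simp add: has_field_derivative_def mult_commute_abs)
    \<comment> \<open>\<open>enn2real\<close> sends infinity to 0, so minimality transfers to the
      real-valued function only where \<open>f\<close> is finite. For small times the curve stays in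
      a ball of collision-free loops.\<close>
    obtain r where r: "0 < r" "\<And>y. dist y x < r \<Longrightarrow> collision_free y"
      using collision_free_open[OF x(2)] by blast
    have "isCont c 0" using c(3) by (rule has_vector_derivative_continuous)
    then obtain d where d: "0 < d" "\<And>s. dist s 0 < d \<Longrightarrow> dist (c s) (c 0) < r"
      using r(1) unfolding continuous_at_eps_delta by blast
    have "enn2real (f (c 0)) \<le> enn2real (f (c s))" if "\<bar>0 - s\<bar> < d" for s
    proof -
      have "collision_free (c s)" using r(2) d(2)[of s] that c(1) by (simp add: dist_real_def)
      then show ?thesis
        using fmin[OF c(2)[of s]] fin c(1) by (intro enn2real_mono) auto
    qed
    then have "inner v D = 0"
      by (intro DERIV_local_min[OF der d(1)]) blast
    then show "orthogonal (D - 0) v" by (simp add: orthogonal_def inner_commute)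
  qed
  then show ?thesis
    using x(1,2) inf
    by (intro bexI[of _ x] conjI exI[of _ "\<lambda>_. x"] exI[of _ "\<lambda>_. 0"] exI[of _ "\<lambda>n. n"])
      (auto simp: strict_mono_def uniform_limit_const)
qed

end
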